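(* Let the centered stationary Gaussian field $G$ and its covariance $\mathcal C$ satisfy the standing assumptions (stated in the context) with $\beta>1$, and let $G\not\equiv0$. Let $f,g\in C^1([0,1])$, let $u_\varepsilon$ be the solution of $$(a(\tfrac{x}{\varepsilon})u_\varepsilon'(x))'=f'(x)\ \text{ on }(0,1),\qquad u_\varepsilon(0)=u_\varepsilon(1)=0,$$ and let $v_\varepsilon$ be the solution of the same problem with $f$ replaced by $g$. Set $I_\varepsilon(f,g):=\int_0^1u_\varepsilon'(x)g(x)dx=\int_0^1v_\varepsilon'(x)f(x)dx$ and $\sigma_\varepsilon(f,g):=\sqrt{\varepsilon^{-1}\mathrm{Var}[I_\varepsilon(f,g)]}$. Then there exists a finite constant $M$, independent of $\varepsilon$ but possibly depending on $f$ and $g$, such that for all $\varepsilon\in(0,\frac12]$ $$|\sigma_\varepsilon(f,g)^2-\sigma(f,g)^2|\le M\,\varepsilon^{\min\{\frac12,\,\beta-1\}},$$ where $$\sigma^2(f,g):=\mathcal Q\int_0^1\Big(f-\int_0^1f\Big)^2\Big(g-\int_0^1g\Big)^2,\qquad \mathcal Q=\int_{\mathbb R}\mathrm{Cov}\Big[\frac1{a(x)};\frac1{a(0)}\Big]dx>0 .$$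
   Context: Standing assumptions. $G:\mathbb R\to\mathbb R$ is a stationary centered Gaussian random field with covariance function $\mathcal C:\mathbb R\to\mathbb R$, that is, $\mathbb E[G(x)G(y)]=\mathcal C(x-y)$, where $\mathcal C$ is Hölder continuous at zero. For the given $\beta$ and a finite constant $K$ one has $|\mathcal C(x)|\le K(1+|x|)^{-\beta}$ for all $x\in\mathbb R$. Moreover $\mathcal C=\mathcal C^\circ\star\mathcal C^\circ$ (convolution) for some $\mathcal C^\circ$ satisfying, for all $x\in\mathbb R$ (when $\beta>1$), $\sup_{B(x)}|\mathcal C^\circ|\le K(1+|x|)^{-\frac{1+\beta}{2}}$, where $B(x)$ is the unit ball centered at $x$. Realizations of $G$ are almost surely continuous (continuous version). The random coefficient field is $a(x)=\exp(G(x))$. The solution $u_\varepsilon\in C^1([0,1])$ is random, with $$u_\varepsilon'(x)=\frac{1}{a(x/\varepsilon)}\Big(f(x)-\Big(\int_0^1\frac{1}{a(y/\varepsilon)}dy\Big)^{-1}\int_0^1\frac{f(y)}{a(y/\varepsilon)}dy\Big).$$ *)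

theory Defs
  imports "HOL-Probability.Probability"
begin

section \<open>Gaussian random fields on the real line\<close>

text \<open>Constants count as Gaussian (variance zero): the density-based notion of the
  library covers only the nondegenerate case.\<close>

definition gaussian_rv :: "'w measure \<Rightarrow> ('w \<Rightarrow> real) \<Rightarrow> bool" where
  "gaussian_rv M X \<longleftrightarrow> X \<in> borel_measurable M \<and>
     ((\<exists>\<mu>. AE \<omega> in M. X \<omega> = \<mu>) \<or>
      (\<exists>\<mu> s. 0 < s \<and> distributed M lborel X (normal_density \<mu> s)))"

definition gaussian_field :: "'w measure \<Rightarrow> (real \<Rightarrow> 'w \<Rightarrow> real) \<Rightarrow> bool" where
  "gaussian_field M G \<longleftrightarrow>
     (\<forall>F c. finite F \<longrightarrow> gaussian_rv M (\<lambda>\<omega>. \<Sum>x\<in>F. c x * G x \<omega>))"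

text \<open>Stationarity is expressed by the covariance depending on \<open>x - y\<close> only; for a centered
  Gaussian field this is equivalent to shift invariance of the finite-dimensional laws.\<close>

definition stationary_centered_gaussian_field ::
    "'w measure \<Rightarrow> (real \<Rightarrow> 'w \<Rightarrow> real) \<Rightarrow> (real \<Rightarrow> real) \<Rightarrow> bool" where
  "stationary_centered_gaussian_field M G C \<longleftrightarrow>
     gaussian_field M G \<and>
     (\<forall>x. prob_space.expectation M (G x) = 0) \<and>
     (\<forall>x y. prob_space.expectation M (\<lambda>\<omega>. G x \<omega> * G y \<omega>) = C (x - y)) \<and>
     (AE \<omega> in M. continuous_on UNIV (\<lambda>x. G x \<omega>))"

definition hoelder_at_zero :: "(real \<Rightarrow> real) \<Rightarrow> bool" where
  "hoelder_at_zero C \<longleftrightarrow>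
     (\<exists>\<gamma> L \<delta>. 0 < \<gamma> \<and> 0 < \<delta> \<and>
        (\<forall>x. \<bar>x\<bar> < \<delta> \<longrightarrow> \<bar>C x - C 0\<bar> \<le> L * \<bar>x\<bar> powr \<gamma>))"

definition convolution :: "(real \<Rightarrow> real) \<Rightarrow> (real \<Rightarrow> real) \<Rightarrow> real \<Rightarrow> real" where
  "convolution h k x = (LINT y|lborel. h y * k (x - y))"

text \<open>The bound on \<open>sup\<^bsub>B(x)\<^esub> \<bar>C0\<bar>\<close> is written pointwise, since a supremum of an unbounded
  set of reals has no meaning here. With \<open>\<beta> > 1\<close> the bounds make the convolution integral
  absolutely convergent.\<close>

definition covariance_decay :: "real \<Rightarrow> real \<Rightarrow> (real \<Rightarrow> real) \<Rightarrow> bool" where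
  "covariance_decay \<beta> K C \<longleftrightarrow>
     hoelder_at_zero C \<and>
     (\<forall>x. \<bar>C x\<bar> \<le> K * (1 + \<bar>x\<bar>) powr (- \<beta>)) \<and>
     (\<exists>C0. C0 \<in> borel_measurable borel \<and>
        C = convolution C0 C0 \<and>
        (\<forall>x. \<forall>y\<in>ball x 1. \<bar>C0 y\<bar> \<le> K * (1 + \<bar>x\<bar>) powr (- ((1 + \<beta>) / 2))))"

definition coeff_field :: "(real \<Rightarrow> 'w \<Rightarrow> real) \<Rightarrow> real \<Rightarrow> 'w \<Rightarrow> real" where
  "coeff_field G x \<omega> = exp (G x \<omega>)"


section \<open>The one-dimensional Dirichlet problem\<close>

text \<open>Derivatives of functions on the closed unit interval are one-sided at the end points,
  so that nothing depends on values outside of it.\<close>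

definition deriv01 :: "(real \<Rightarrow> real) \<Rightarrow> real \<Rightarrow> real" where
  "deriv01 f x = vector_derivative f (at x within {0..1})"

definition C1_01 :: "(real \<Rightarrow> real) \<Rightarrow> bool" where
  "C1_01 f \<longleftrightarrow> f differentiable_on {0..1} \<and> continuous_on {0..1} (deriv01 f)"

definition dirichlet_solution :: "(real \<Rightarrow> real) \<Rightarrow> (real \<Rightarrow> real) \<Rightarrow> (real \<Rightarrow> real) \<Rightarrow> bool" where
  "dirichlet_solution A f u \<longleftrightarrow>
     C1_01 u \<and> u 0 = 0 \<and> u 1 = 0 \<and>
     (\<forall>x\<in>{0<..<1}. ((\<lambda>y. A y * deriv01 u y) has_real_derivative deriv01 f x) (at x))"


section \<open>The observable and its limiting variance\<close>

definition observable :: "('w \<Rightarrow> real \<Rightarrow> real) \<Rightarrow> (real \<Rightarrow> real) \<Rightarrow> 'w \<Rightarrow> real" where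
  "observable u g \<omega> = (LBINT x:{0..1}. deriv01 (u \<omega>) x * g x)"

text \<open>The solution, and hence the observable, is determined only almost surely. The variance
  is therefore taken in the completion of the probability space, where changing a random
  variable on a null set preserves measurability; for random variables measurable with
  respect to \<open>M\<close> this is the variance in \<open>M\<close>.\<close>

definition sigma_eps ::
    "'w measure \<Rightarrow> real \<Rightarrow> ('w \<Rightarrow> real \<Rightarrow> real) \<Rightarrow> (real \<Rightarrow> real) \<Rightarrow> real" where
  "sigma_eps M \<epsilon> u g = sqrt (prob_space.variance (completion M) (observable u g) / \<epsilon>)"

definition cov :: "'w measure \<Rightarrow> ('w \<Rightarrow> real) \<Rightarrow> ('w \<Rightarrow> real) \<Rightarrow> real" where
  "cov M X Y = prob_space.expectation M
     (\<lambda>\<omega>. (X \<omega> - prob_space.expectation M X) * (Y \<omega> - prob_space.expectation M Y))"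

definition Q_const :: "'w measure \<Rightarrow> (real \<Rightarrow> 'w \<Rightarrow> real) \<Rightarrow> real" where
  "Q_const M G = (LINT x|lborel. cov M (\<lambda>\<omega>. 1 / coeff_field G x \<omega>) (\<lambda>\<omega>. 1 / coeff_field G 0 \<omega>))"

definition sigma_squared ::
    "'w measure \<Rightarrow> (real \<Rightarrow> 'w \<Rightarrow> real) \<Rightarrow> (real \<Rightarrow> real) \<Rightarrow> (real \<Rightarrow> real) \<Rightarrow> real" where
  "sigma_squared M G f g = Q_const M G *
     (LBINT x:{0..1}. (f x - (LBINT y:{0..1}. f y))\<^sup>2 * (g x - (LBINT y:{0..1}. g y))\<^sup>2)"

end

theory Submission
  imports Defs
begin

text \<open>
  Write \<open>b = exp (- G)\<close>, \<open>b\<^sub>\<epsilon> x = b (x / \<epsilon>)\<close>, and let integrals of these fields be over the unit interval.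
  Integrating the equation once turns the observable into
  \<open>\<integral> b\<^sub>\<epsilon> f g - (\<integral> b\<^sub>\<epsilon> f) (\<integral> b\<^sub>\<epsilon> g) / \<integral> b\<^sub>\<epsilon>\<close>. This expression is symmetric in \<open>f\<close> and \<open>g\<close> and
  does not change when constants are subtracted from them. With \<open>f\<close> and \<open>g\<close> replaced by their
  centered versions it reads \<open>X - Y Z / W\<close>, where \<open>X = \<integral> b\<^sub>\<epsilon> f g\<close>, \<open>Y = \<integral> b\<^sub>\<epsilon> f\<close>, \<open>Z = \<integral> b\<^sub>\<epsilon> g\<close> and
  \<open>W = \<integral> b\<^sub>\<epsilon>\<close>.

  The centered \<open>X\<close> is of order \<open>sqrt \<epsilon>\<close>. Since \<open>Cov (b x) (b y)\<close> is a multiple of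
  \<open>exp (C (x - y)) - 1\<close>, its variance divided by \<open>\<epsilon>\<close> is a double integral of \<open>f g \<otimes> f g\<close> against
  an approximate identity of width \<open>\<epsilon>\<close>, and the error is the truncated first moment of the
  kernel, which is of order \<open>\<epsilon> powr (\<beta> - 1)\<close> for \<open>\<beta> < 2\<close> (\<open>covariance_integral_asymptotics\<close>). After centering,
  \<open>Y\<close> and \<open>Z\<close> have mean zero and are of order \<open>sqrt \<epsilon>\<close> too, so that \<open>Y Z / W\<close> is of order \<open>\<epsilon>\<close> in
  mean square. It changes the variance by a term of order \<open>\<epsilon> powr (3/2)\<close>
  (\<open>variance_perturbation\<close>), which after division by \<open>\<epsilon>\<close> gives the rate \<open>1/2\<close>.

  The size of \<open>Y Z / W\<close> rests on fourth moments. Gaussian exponential moments are explicit, and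
  the joint moment of four centered normalized values of \<open>b\<close> is a sum over graphs on four
  vertices without isolated vertices, each edge \<open>{i, j}\<close> contributing the factor
  \<open>exp (C (x\<^sub>i - x\<^sub>j)) - 1\<close>. Every such graph contains a perfect matching or a star, and both
  integrate to order \<open>\<epsilon>\<^sup>2\<close> at most (\<open>graph_sum_bound\<close>, \<open>fluct_fourth_moment\<close>). The random denominator is
  harmless: \<open>\<bar>Y\<bar>\<close> and \<open>\<bar>Z\<bar>\<close> are bounded by multiples of \<open>W\<close>, so \<open>Y Z / W\<close> is bounded where \<open>W\<close> is
  below half its mean, and that event is controlled by the fourth moment of the fluctuation of
  \<open>W\<close> (\<open>squared_ratio_bound\<close>).

  Positivity of the limit uses \<open>exp c - 1 \<ge> c\<close>, with strict inequality for \<open>c > 0\<close>, together with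
  \<open>\<integral> C = (\<integral> C0)\<^sup>2 \<ge> 0\<close> over the line, where \<open>C0\<close> is the convolution square root of the
  covariance.
\<close>

section \<open>Polynomially decaying kernels\<close>

definition decay_kernel :: "real \<Rightarrow> real \<Rightarrow> real" where
  "decay_kernel \<beta> t = (1 + \<bar>t\<bar>) powr (- \<beta>)"

lemma decay_kernel_measurable [measurable]: "decay_kernel \<beta> \<in> borel_measurable borel"
  unfolding decay_kernel_def[abs_def] by measurable

lemma decay_kernel_nonneg [simp]: "0 \<le> decay_kernel \<beta> t"
  by (simp add: decay_kernel_def)

lemma decay_kernel_le_1: "0 \<le> \<beta> \<Longrightarrow> decay_kernel \<beta> t \<le> 1"
  unfolding decay_kernel_def using powr_mono2'[of "-\<beta>" 1 "1 + \<bar>t\<bar>"] by simp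

lemma decay_kernel_minus [simp]: "decay_kernel \<beta> (- t) = decay_kernel \<beta> t"
  by (simp add: decay_kernel_def)

lemma set_integrable_lborel_powr:
  shows powr_near_0: "a > -1 \<Longrightarrow> set_integrable lborel {0..1} (\<lambda>x::real. x powr a)"
    and powr_near_inf: "a < -1 \<Longrightarrow> set_integrable lborel {1..} (\<lambda>x::real. x powr a)"
proof -
  have key: "set_integrable lborel S (\<lambda>x::real. x powr a)"
    if "(\<lambda>x. x powr a) integrable_on S" "S \<in> sets borel" for S a
  proof -
    have "(\<lambda>x. x powr a) absolutely_integrable_on S"
      by (rule nonnegative_absolutely_integrable_1[OF that(1)]) simp
    then show ?thesis
      unfolding set_integrable_def
      using that(2) by (subst (asm) integrable_completion) auto
  qed
  show "set_integrable lborel {0..1} (\<lambda>x::real. x powr a)" if "a > -1"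
    by (rule key) (use that integrable_on_powr_from_0 in auto)
  show "set_integrable lborel {1..} (\<lambda>x::real. x powr a)" if "a < -1"
    by (rule key) (use has_integral_powr_to_inf[of a 1] that in \<open>auto simp: integrable_on_def\<close>)
qed

lemma integrable_truncated_powr:
  assumes "1 < \<beta>" "\<beta> < 2"
  shows "integrable lborel (\<lambda>s::real. \<bar>s\<bar> powr (- \<beta>) * min 1 \<bar>s\<bar>)"
proof -
  define k where "k = (\<lambda>s::real. indicator {0<..} s * (\<bar>s\<bar> powr (- \<beta>) * min 1 \<bar>s\<bar>))"
  have [measurable]: "k \<in> borel_measurable borel" unfolding k_def by measurable
  have "integrable lborel (\<lambda>s::real. indicator {0..1} s *\<^sub>R (s powr (1 - \<beta>)) +
      indicator {1..} s *\<^sub>R (s powr (- \<beta>)))"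
    using powr_near_0[of "1 - \<beta>"] powr_near_inf[of "- \<beta>"] assms
    unfolding set_integrable_def by auto
  then have k: "integrable lborel k"
  proof (rule Bochner_Integration.integrable_bound)
    show "AE s in lborel. norm (k s) \<le> norm (indicator {0..1} s *\<^sub>R (s powr (1 - \<beta>)) +
      indicator {1..} s *\<^sub>R (s powr (- \<beta>)))"
    proof (rule AE_I2)
      fix s :: real
      have "s powr (1 - \<beta>) = s powr (-\<beta>) * s" if "0 < s"
        using powr_add[of s 1 "-\<beta>"] that by (simp add: mult.commute)
      then show "norm (k s) \<le> norm (indicator {0..1} s *\<^sub>R (s powr (1 - \<beta>)) +
          indicator {1..} s *\<^sub>R (s powr (- \<beta>)))"
        by (auto simp: k_def indicator_def min_def)
    qed
  qed measurable
  have "integrable lborel (\<lambda>s. k s + k (0 + (-1) * s))"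
    using k lborel_integrable_real_affine[OF k, of "-1" 0] by (intro Bochner_Integration.integrable_add) auto
  moreover have "(\<lambda>s. k s + k (0 + (-1) * s)) = (\<lambda>s::real. \<bar>s\<bar> powr (- \<beta>) * min 1 \<bar>s\<bar>)"
    by (auto simp: k_def indicator_def fun_eq_iff)
  ultimately show ?thesis by simp
qed

lemma integrable_decay_kernel:
  assumes "1 < \<beta>" 
  shows "integrable lborel (decay_kernel \<beta>)"
proof -
  define k where "k = (\<lambda>s::real. indicator {1..} s *\<^sub>R (s powr (- \<beta>)))"
  have k: "integrable lborel k"
    using powr_near_inf[of "- \<beta>"] assms unfolding set_integrable_def k_def by auto
  have "integrable lborel (\<lambda>s. indicator {-1..1} s + (k s + k (0 + (-1) * s)))"
    using k lborel_integrable_real_affine[OF k, of "-1" 0] 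
    by (intro Bochner_Integration.integrable_add integrable_real_indicator) auto
  then show ?thesis
  proof (rule Bochner_Integration.integrable_bound)
    show "AE s in lborel. norm (decay_kernel \<beta> s) \<le> norm (indicator {-1..1} s + (k s + k (0 + (-1) * s)))"
    proof (rule AE_I2)
      fix s :: real
      have k0: "0 \<le> k t" for t by (simp add: k_def)
      have "decay_kernel \<beta> s \<le> indicator {-1..1} s + (k s + k (0 + (-1) * s))"
      proof (cases "\<bar>s\<bar> \<le> 1")
        case True
        then have "decay_kernel \<beta> s \<le> 1" "indicator {-1..1} s = (1::real)"
          using decay_kernel_le_1[of \<beta> s] assms by (auto simp: indicator_def abs_le_iff)
        then show ?thesis using k0[of s] k0[of "0 + -1 * s"] by linarith
      next
        case False
        then have "(1 + \<bar>s\<bar>) powr (- \<beta>) \<le> \<bar>s\<bar> powr (- \<beta>)"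
          using assms by (intro powr_mono2') auto
        moreover have "k s + k (0 + (-1) * s) = \<bar>s\<bar> powr (- \<beta>)"
          using False by (auto simp: k_def indicator_def abs_if)
        ultimately show ?thesis using False by (auto simp add: decay_kernel_def indicator_def)
      qed
      then show "norm (decay_kernel \<beta> s) \<le> norm (indicator {-1..1} s + (k s + k (0 + (-1) * s)))"
        using k0[of s] k0[of "0 + -1 * s"] by simp
    qed
  qed measurable
qed

text \<open>Below exponent 2 the bound \<open>decay_kernel \<beta> t \<le> \<bar>t\<bar> powr (- \<beta>)\<close> costs nothing near zero, because of
  the factor \<open>min 1 (\<epsilon> * \<bar>t\<bar>)\<close>, and makes the integrand homogeneous: rescaling \<open>t\<close> by \<open>\<epsilon>\<close> extracts
  the exact power.\<close>

lemma decay_kernel_truncated_moment: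
  assumes "1 < \<beta>" "\<beta> < 2" "0 < \<epsilon>"
  shows "integrable lborel (\<lambda>t. decay_kernel \<beta> t * min 1 (\<epsilon> * \<bar>t\<bar>))"
    and "(LINT t|lborel. decay_kernel \<beta> t * min 1 (\<epsilon> * \<bar>t\<bar>)) \<le>
      \<epsilon> powr (\<beta> - 1) * (LINT s|lborel. \<bar>s\<bar> powr (- \<beta>) * min 1 \<bar>s\<bar>)"
proof -
  define k where "k = (\<lambda>s::real. \<bar>s\<bar> powr (- \<beta>) * min 1 \<bar>s\<bar>)"
  have k: "integrable lborel k" using integrable_truncated_powr[OF assms(1,2)] by (simp add: k_def)
  have k\<epsilon>: "integrable lborel (\<lambda>t. \<epsilon> powr \<beta> * k (0 + \<epsilon> * t))"
    using lborel_integrable_real_affine[OF k, of \<epsilon> 0] assms by auto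
  have le: "decay_kernel \<beta> t * min 1 (\<epsilon> * \<bar>t\<bar>) \<le> \<epsilon> powr \<beta> * k (0 + \<epsilon> * t)" for t
  proof (cases "t = 0")
    case False
    have "decay_kernel \<beta> t \<le> \<bar>t\<bar> powr (- \<beta>)"
      unfolding decay_kernel_def using assms False by (intro powr_mono2') auto
    also have "\<dots> = \<epsilon> powr \<beta> * \<bar>\<epsilon> * t\<bar> powr (- \<beta>)"
      using assms by (simp add: abs_mult powr_mult powr_minus field_simps)
    finally have "decay_kernel \<beta> t \<le> \<epsilon> powr \<beta> * \<bar>\<epsilon> * t\<bar> powr (- \<beta>)" .
    then have "decay_kernel \<beta> t * min 1 (\<epsilon> * \<bar>t\<bar>) \<le> (\<epsilon> powr \<beta> * \<bar>\<epsilon> * t\<bar> powr (- \<beta>)) * min 1 (\<epsilon> * \<bar>t\<bar>)"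
      using assms by (intro mult_right_mono) auto
    then show ?thesis using assms by (simp add: k_def abs_mult mult.assoc)
  qed (simp add: k_def)
  show i: "integrable lborel (\<lambda>t. decay_kernel \<beta> t * min 1 (\<epsilon> * \<bar>t\<bar>))"
    by (rule Bochner_Integration.integrable_bound[OF k\<epsilon>], measurable)
       (intro AE_I2, use le assms in \<open>auto intro!: order.trans[OF _ abs_ge_self]\<close>)
  have "(LINT t|lborel. decay_kernel \<beta> t * min 1 (\<epsilon> * \<bar>t\<bar>)) \<le> (LINT t|lborel. \<epsilon> powr \<beta> * k (0 + \<epsilon> * t))"
    by (intro integral_mono i k\<epsilon> le)
  also have "\<dots> = \<epsilon> powr \<beta> * (LINT s|lborel. k s) / \<epsilon>"
    using lborel_integral_real_affine[of \<epsilon> k 0] assms by simp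
  also have "\<dots> = \<epsilon> powr (\<beta> - 1) * (LINT s|lborel. k s)"
    using assms by (simp add: powr_diff)
  finally show "(LINT t|lborel. decay_kernel \<beta> t * min 1 (\<epsilon> * \<bar>t\<bar>)) \<le>
      \<epsilon> powr (\<beta> - 1) * (LINT s|lborel. \<bar>s\<bar> powr (- \<beta>) * min 1 \<bar>s\<bar>)"
    by (simp add: k_def)
qed

section \<open>Gaussian fields: exponential moments and a continuous version\<close>

lemma abs_mult_le_sum_squares: "\<bar>a * b\<bar> \<le> a\<^sup>2 + b\<^sup>2" for a b :: real
proof -
  have "2 * \<bar>a * b\<bar> \<le> a\<^sup>2 + b\<^sup>2"
    using zero_le_power2[of "\<bar>a\<bar> - \<bar>b\<bar>"] by (simp add: power2_diff abs_mult)
  then show ?thesis by (smt (verit) abs_ge_zero)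
qed

lemma (in prob_space) gaussian_rv_exp_moment:
  assumes "gaussian_rv M X" and "expectation X = 0"
  shows "integrable M (\<lambda>\<omega>. (X \<omega>)\<^sup>2)"
    and "integrable M (\<lambda>\<omega>. exp (X \<omega>))"
    and "expectation (\<lambda>\<omega>. exp (X \<omega>)) = exp (expectation (\<lambda>\<omega>. (X \<omega>)\<^sup>2) / 2)"
proof -
  have [measurable]: "X \<in> borel_measurable M"
    using assms(1) by (simp add: gaussian_rv_def)
  consider (const) \<mu> where "AE \<omega> in M. X \<omega> = \<mu>"
    | (normal) \<mu> s where "0 < s" "distributed M lborel X (normal_density \<mu> s)"
    using assms(1) unfolding gaussian_rv_def by blast
  then have "integrable M (\<lambda>\<omega>. (X \<omega>)\<^sup>2) \<and> integrable M (\<lambda>\<omega>. exp (X \<omega>)) \<and>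
    expectation (\<lambda>\<omega>. exp (X \<omega>)) = exp (expectation (\<lambda>\<omega>. (X \<omega>)\<^sup>2) / 2)"
  proof cases
    case const
    have "expectation X = expectation (\<lambda>_. \<mu>)"
      by (intro integral_cong_AE) (use const in auto)
    then have "\<mu> = 0" using assms(2) by (simp add: prob_space)
    then have X0: "AE \<omega> in M. X \<omega> = 0" using const by simp
    have "integrable M (\<lambda>\<omega>. (X \<omega>)\<^sup>2) \<longleftrightarrow> integrable M (\<lambda>\<omega>. 0::real)"
      by (intro integrable_cong_AE) (use X0 in auto)
    moreover have "integrable M (\<lambda>\<omega>. exp (X \<omega>)) \<longleftrightarrow> integrable M (\<lambda>\<omega>. 1::real)"
      by (intro integrable_cong_AE) (use X0 in auto)
    moreover have "expectation (\<lambda>\<omega>. (X \<omega>)\<^sup>2) = expectation (\<lambda>\<omega>. 0::real)"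
      by (intro integral_cong_AE) (use X0 in auto)
    moreover have "expectation (\<lambda>\<omega>. exp (X \<omega>)) = expectation (\<lambda>\<omega>. 1::real)"
      by (intro integral_cong_AE) (use X0 in auto)
    ultimately show ?thesis by (simp add: prob_space)
  next
    case normal
    note D = normal(2)
    have "\<mu> = 0" using normal_distributed_expectation[OF normal] assms(2) by simp
    note D = D[unfolded this]
    have V: "expectation (\<lambda>\<omega>. (X \<omega>)\<^sup>2) = s\<^sup>2"
      using normal_distributed_variance[OF normal(1) D] assms(2) by simp
    have "integrable lborel (\<lambda>x. normal_density 0 s x * x\<^sup>2)"
      using integrable_normal_moment[OF normal(1), of 0 2] by simp
    then have 1: "integrable M (\<lambda>\<omega>. (X \<omega>)\<^sup>2)"
      using distributed_integrable[OF D, of "\<lambda>x. x\<^sup>2"] by simp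
    \<comment> \<open>completing the square: tilting by \<open>exp\<close> shifts the mean by \<open>s\<^sup>2\<close>\<close>
    have tilt: "normal_density 0 s x * exp x = exp (s\<^sup>2 / 2) * normal_density (s\<^sup>2) s x" for x
    proof -
      have "- x\<^sup>2 / (2 * s\<^sup>2) + x = s\<^sup>2 / 2 + - (x - s\<^sup>2)\<^sup>2 / (2 * s\<^sup>2)"
        using normal(1) by (simp add: field_simps power2_eq_square)
      then have "exp (- x\<^sup>2 / (2 * s\<^sup>2)) * exp x = exp (s\<^sup>2 / 2) * exp (- (x - s\<^sup>2)\<^sup>2 / (2 * s\<^sup>2))"
        by (metis exp_add)
      then show ?thesis by (simp add: normal_density_def)
    qed
    have 2: "integrable M (\<lambda>\<omega>. exp (X \<omega>))"
      using distributed_integrable[OF D, of exp] normal(1) by (simp add: tilt)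
    have 3: "expectation (\<lambda>\<omega>. exp (X \<omega>)) = exp (s\<^sup>2 / 2)"
      using distributed_integral[OF D, of exp] normal(1) by (simp add: tilt)
    show ?thesis using 1 2 3 V by simp
  qed
  then show "integrable M (\<lambda>\<omega>. (X \<omega>)\<^sup>2)"
    and "integrable M (\<lambda>\<omega>. exp (X \<omega>))"
    and "expectation (\<lambda>\<omega>. exp (X \<omega>)) = exp (expectation (\<lambda>\<omega>. (X \<omega>)\<^sup>2) / 2)"
    by auto
qed

lemma gaussian_field_gaussian_rv:
  assumes "gaussian_field M G" shows "gaussian_rv M (G x)"
  using assms[unfolded gaussian_field_def, rule_format, of "{x}" "\<lambda>_. 1"] by simp

lemma (in prob_space) gaussian_field_integrable_mult:
  assumes "gaussian_field M G" and "\<And>x. expectation (G x) = 0"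
  shows "integrable M (\<lambda>\<omega>. G x \<omega> * G y \<omega>)"
proof -
  have [measurable]: "G x \<in> borel_measurable M" for x
    using gaussian_field_gaussian_rv[OF assms(1)] by (simp add: gaussian_rv_def)
  have sq: "integrable M (\<lambda>\<omega>. (G x \<omega>)\<^sup>2)" for x
    using gaussian_rv_exp_moment(1)[OF gaussian_field_gaussian_rv[OF assms(1)] assms(2)] .
  show ?thesis
    by (intro Bochner_Integration.integrable_bound[OF Bochner_Integration.integrable_add[OF sq[of x] sq[of y]]])
      (auto intro!: AE_I2 abs_mult_le_sum_squares)
qed

text \<open>A linear combination of field values is a centered Gaussian variable, so its exponential moment
  is determined by its variance, the quadratic form of the covariance.\<close>

lemma (in prob_space) gaussian_field_exp_moment:
  fixes x :: "'i \<Rightarrow> real"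
  assumes field: "gaussian_field M G" and mean: "\<And>x. expectation (G x) = 0"
    and cov: "\<And>x y. expectation (\<lambda>\<omega>. G x \<omega> * G y \<omega>) = C (x - y)"
    and I: "finite I"
  shows "integrable M (\<lambda>\<omega>. \<Prod>i\<in>I. exp (- G (x i) \<omega>))"
    and "expectation (\<lambda>\<omega>. \<Prod>i\<in>I. exp (- G (x i) \<omega>)) = exp ((\<Sum>i\<in>I. \<Sum>j\<in>I. C (x i - x j)) / 2)"
proof -
  define S where "S = (\<lambda>\<omega>. \<Sum>i\<in>I. - G (x i) \<omega>)"
  have iG: "integrable M (G y)" for y
  proof -
    have [measurable]: "G y \<in> borel_measurable M" for y
      using gaussian_field_gaussian_rv[OF field] by (simp add: gaussian_rv_def)
    have "integrable M (\<lambda>\<omega>. (G y \<omega>)\<^sup>2)"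
      using gaussian_field_integrable_mult[OF field mean, of y y] by (simp add: power2_eq_square)
    then show ?thesis
      by (rule square_integrable_imp_integrable[rotated]) measurable
  qed
  \<comment> \<open>the points \<open>x i\<close> may coincide, so the linear combination is grouped by their values\<close>
  have "S = (\<lambda>\<omega>. \<Sum>y\<in>x ` I. (- real (card {i \<in> I. x i = y})) * G y \<omega>)"
    unfolding S_def using I by (subst sum.image_gen[where g = x]) (auto simp: fun_eq_iff)
  then have "gaussian_rv M S"
    using field[unfolded gaussian_field_def, rule_format, of "x ` I"
        "\<lambda>y. - real (card {i \<in> I. x i = y})"] I by simp
  moreover have "expectation S = 0"
    unfolding S_def using iG mean by (simp add: sum_negf)
  ultimately have 1: "integrable M (\<lambda>\<omega>. exp (S \<omega>))"
    and 2: "expectation (\<lambda>\<omega>. exp (S \<omega>)) = exp (expectation (\<lambda>\<omega>. (S \<omega>)\<^sup>2) / 2)"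
    using gaussian_rv_exp_moment(2,3) by auto
  have e: "exp (S \<omega>) = (\<Prod>i\<in>I. exp (- G (x i) \<omega>))" for \<omega>
    using I by (simp add: S_def exp_sum)
  have "(S \<omega>)\<^sup>2 = (\<Sum>i\<in>I. \<Sum>j\<in>I. G (x i) \<omega> * G (x j) \<omega>)" for \<omega>
    by (simp add: S_def power2_eq_square sum_product sum_negf)
  then have "expectation (\<lambda>\<omega>. (S \<omega>)\<^sup>2) = (\<Sum>i\<in>I. \<Sum>j\<in>I. C (x i - x j))"
    using gaussian_field_integrable_mult[OF field mean] cov
    by (simp add: Bochner_Integration.integral_sum)
  with 1 2 show "integrable M (\<lambda>\<omega>. \<Prod>i\<in>I. exp (- G (x i) \<omega>))"
    and "expectation (\<lambda>\<omega>. \<Prod>i\<in>I. exp (- G (x i) \<omega>)) = exp ((\<Sum>i\<in>I. \<Sum>j\<in>I. C (x i - x j)) / 2)"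
    by (simp_all add: e)
qed

text \<open>Joint measurability, on which every application of Fubini's theorem depends, comes from
  approximating a continuous path by its values at the points of a grid.\<close>

lemma continuous_modification:
  fixes G :: "real \<Rightarrow> 'w \<Rightarrow> real"
  assumes meas [measurable]: "\<And>x. G x \<in> borel_measurable M"
    and cont: "AE \<omega> in M. continuous_on UNIV (\<lambda>x. G x \<omega>)"
  obtains H where "\<And>\<omega>. continuous_on UNIV (\<lambda>x. H x \<omega>)"
    and "case_prod H \<in> borel_measurable (borel \<Otimes>\<^sub>M M)"
    and "AE \<omega> in M. \<forall>x. H x \<omega> = G x \<omega>"
proof -
  obtain N where N: "\<And>\<omega>. \<omega> \<in> space M - N \<Longrightarrow> continuous_on UNIV (\<lambda>x. G x \<omega>)" "N \<in> null_sets M"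
    using AE_E3[OF cont] by auto
  define H where "H = (\<lambda>x \<omega>. if \<omega> \<in> space M - N then G x \<omega> else 0)"
  have [measurable]: "N \<in> sets M" using N(2) by auto
  have mH [measurable]: "H x \<in> borel_measurable M" for x
    unfolding H_def by measurable
  have cH: "continuous_on UNIV (\<lambda>x. H x \<omega>)" for \<omega>
    using N(1) by (cases "\<omega> \<in> space M - N") (auto simp: H_def)
  define d where "d = (\<lambda>n x. of_int \<lfloor>real (Suc n) * x\<rfloor> / real (Suc n))"
  have d: "(\<lambda>n. d n x) \<longlonglongrightarrow> x" for x
  proof (rule real_tendsto_sandwich[where f = "\<lambda>n. x - 1 / real (Suc n)" and h = "\<lambda>n. x"])
    have "x - 1 / real (Suc n) \<le> d n x \<and> d n x \<le> x" for n
    proof -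
      have *: "x - 1 / y \<le> of_int \<lfloor>y * x\<rfloor> / y \<and> of_int \<lfloor>y * x\<rfloor> / y \<le> x" if "0 < y" for y :: real
      proof -
        have "(y * x - 1) / y \<le> of_int \<lfloor>y * x\<rfloor> / y" "of_int \<lfloor>y * x\<rfloor> / y \<le> (y * x) / y"
          using that by (intro divide_right_mono; linarith)+
        then show ?thesis using that by (simp add: diff_divide_distrib)
      qed
      show ?thesis unfolding d_def using *[of "real (Suc n)"] by simp
    qed
    then show "\<forall>\<^sub>F n in sequentially. x - 1 / real (Suc n) \<le> d n x" "\<forall>\<^sub>F n in sequentially. d n x \<le> x"
      by auto
    show "(\<lambda>n. x - 1 / real (Suc n)) \<longlonglongrightarrow> x"
      using tendsto_diff[OF tendsto_const LIMSEQ_Suc[OF lim_1_over_n], of x] by simp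
  qed auto
  have "case_prod H \<in> borel_measurable (borel \<Otimes>\<^sub>M M)"
  proof (rule borel_measurable_LIMSEQ_real)
    show "(\<lambda>n. H (d n (fst p)) (snd p)) \<longlonglongrightarrow> case_prod H p" for p
    proof -
      have "isCont (\<lambda>x. H x (snd p)) (fst p)"
        using cH[of "snd p"] by (simp add: continuous_on_eq_continuous_at)
      from isCont_tendsto_compose[OF this d] show ?thesis by (simp add: case_prod_beta)
    qed
    show "(\<lambda>p. H (d n (fst p)) (snd p)) \<in> borel_measurable (borel \<Otimes>\<^sub>M M)" for n
      unfolding d_def
      by (rule measurable_compose_countable[where f = "\<lambda>i p. H (of_int i / real (Suc n)) (snd p)"
            and g = "\<lambda>p. \<lfloor>real (Suc n) * fst p\<rfloor>"]) measurable
  qed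
  moreover have "AE \<omega> in M. \<forall>x. H x \<omega> = G x \<omega>"
    using AE_not_in[OF N(2)] AE_space by eventually_elim (simp add: H_def)
  ultimately show ?thesis using that cH by blast
qed

section \<open>Moments of integrals\<close>

text \<open>The square of an integral is a double integral of products, and the second-moment bound
  justifies exchanging it with the expectation. Fourth moments are obtained by a second
  application, to the field \<open>(x, y) \<mapsto> F x * F y\<close> on the product space; for this reason the
  pathwise statements are part of the conclusion.\<close>

lemma (in prob_space) second_moment_of_integral:
  fixes F :: "'b \<Rightarrow> 'a \<Rightarrow> real"
  assumes "finite_measure N"
    and meas [measurable]: "case_prod F \<in> borel_measurable (N \<Otimes>\<^sub>M M)"
    and int: "\<And>\<omega>. \<omega> \<in> space M \<Longrightarrow> integrable N (\<lambda>x. F x \<omega>)"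
    and sq: "\<And>x. x \<in> space N \<Longrightarrow> integrable M (\<lambda>\<omega>. (F x \<omega>)\<^sup>2)"
    and bound: "\<And>x. x \<in> space N \<Longrightarrow> expectation (\<lambda>\<omega>. (F x \<omega>)\<^sup>2) \<le> B"
  shows "integrable M (\<lambda>\<omega>. (LINT x|N. F x \<omega>)\<^sup>2)"
    and "expectation (\<lambda>\<omega>. (LINT x|N. F x \<omega>)\<^sup>2) =
      (LINT p|(N \<Otimes>\<^sub>M N). expectation (\<lambda>\<omega>. F (fst p) \<omega> * F (snd p) \<omega>))"
    and "integrable (N \<Otimes>\<^sub>M N) (\<lambda>p. expectation (\<lambda>\<omega>. F (fst p) \<omega> * F (snd p) \<omega>))"
    and "\<And>\<omega>. \<omega> \<in> space M \<Longrightarrow> integrable (N \<Otimes>\<^sub>M N) (\<lambda>p. F (fst p) \<omega> * F (snd p) \<omega>)"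
    and "\<And>\<omega>. \<omega> \<in> space M \<Longrightarrow>
      (LINT p|(N \<Otimes>\<^sub>M N). F (fst p) \<omega> * F (snd p) \<omega>) = (LINT x|N. F x \<omega>)\<^sup>2"
proof -
  interpret N: finite_measure N by fact
  interpret NN: pair_sigma_finite N N ..
  interpret NN: finite_measure "N \<Otimes>\<^sub>M N"
    by (rule finite_measure_pair_measure) fact+
  interpret NNM: pair_sigma_finite "N \<Otimes>\<^sub>M N" M ..
  have mF [measurable]: "(\<lambda>\<omega>. F x \<omega>) \<in> borel_measurable M" if "x \<in> space N" for x
    using measurable_Pair2[OF meas that] by simp
  show prod: "integrable (N \<Otimes>\<^sub>M N) (\<lambda>p. F (fst p) \<omega> * F (snd p) \<omega>)"
    "(LINT p|(N \<Otimes>\<^sub>M N). F (fst p) \<omega> * F (snd p) \<omega>) = (LINT x|N. F x \<omega>)\<^sup>2"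
    if "\<omega> \<in> space M" for \<omega>
  proof -
    have i: "integrable N (\<lambda>x. F x \<omega>)" using int that by simp
    have [measurable]: "(\<lambda>x. F x \<omega>) \<in> borel_measurable N" using i by simp
    have "integrable (N \<Otimes>\<^sub>M N) (\<lambda>(x, y). F x \<omega> * F y \<omega>)"
      using i by (intro NN.Fubini_integrable) (auto simp: abs_mult)
    then show *: "integrable (N \<Otimes>\<^sub>M N) (\<lambda>p. F (fst p) \<omega> * F (snd p) \<omega>)"
      by (simp add: case_prod_unfold)
    show "(LINT p|(N \<Otimes>\<^sub>M N). F (fst p) \<omega> * F (snd p) \<omega>) = (LINT x|N. F x \<omega>)\<^sup>2"
      using NN.integral_fst'[OF *] by (simp add: power2_eq_square)
  qed
  have iprod: "integrable M (\<lambda>\<omega>. F x \<omega> * F y \<omega>)" and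
    bprod: "expectation (\<lambda>\<omega>. \<bar>F x \<omega> * F y \<omega>\<bar>) \<le> 2 * B"
    if x: "x \<in> space N" and y: "y \<in> space N" for x y
  proof -
    show i: "integrable M (\<lambda>\<omega>. F x \<omega> * F y \<omega>)"
      by (rule Bochner_Integration.integrable_bound[OF Bochner_Integration.integrable_add[OF sq[OF x] sq[OF y]]])
        (use x y abs_mult_le_sum_squares in auto)
    have "expectation (\<lambda>\<omega>. \<bar>F x \<omega> * F y \<omega>\<bar>) \<le> expectation (\<lambda>\<omega>. (F x \<omega>)\<^sup>2 + (F y \<omega>)\<^sup>2)"
      by (intro integral_mono Bochner_Integration.integrable_add sq x y integrable_abs i abs_mult_le_sum_squares)
    also have "\<dots> \<le> 2 * B"
      using sq[OF x] sq[OF y] bound[OF x] bound[OF y] by simp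
    finally show "expectation (\<lambda>\<omega>. \<bar>F x \<omega> * F y \<omega>\<bar>) \<le> 2 * B" .
  qed
  have m3 [measurable]: "(\<lambda>(p, \<omega>). F (fst p) \<omega> * F (snd p) \<omega>) \<in> borel_measurable ((N \<Otimes>\<^sub>M N) \<Otimes>\<^sub>M M)"
    by measurable
  have i3: "integrable ((N \<Otimes>\<^sub>M N) \<Otimes>\<^sub>M M) (\<lambda>(p, \<omega>). F (fst p) \<omega> * F (snd p) \<omega>)"
  proof (rule NNM.Fubini_integrable)
    show "integrable (N \<Otimes>\<^sub>M N) (\<lambda>p. LINT \<omega>|M. norm (case (p, \<omega>) of (p, \<omega>) \<Rightarrow> F (fst p) \<omega> * F (snd p) \<omega>))"
      by (rule NN.integrable_const_bound[where B = "2 * B"])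
         (auto intro!: AE_I2 bprod simp: space_pair_measure)
    show "AE p in N \<Otimes>\<^sub>M N. integrable M (\<lambda>\<omega>. case (p, \<omega>) of (p, \<omega>) \<Rightarrow> F (fst p) \<omega> * F (snd p) \<omega>)"
      by (rule AE_I2) (auto intro!: iprod simp: space_pair_measure)
  qed measurable
  have eq: "(LINT p|(N \<Otimes>\<^sub>M N). F (fst p) \<omega> * F (snd p) \<omega>) = (LINT x|N. F x \<omega>)\<^sup>2" if "\<omega> \<in> space M" for \<omega>
    using prod that by simp
  show "integrable M (\<lambda>\<omega>. (LINT x|N. F x \<omega>)\<^sup>2)"
    using NNM.integrable_snd[OF i3] by (simp add: eq cong: Bochner_Integration.integrable_cong)
  show "integrable (N \<Otimes>\<^sub>M N) (\<lambda>p. expectation (\<lambda>\<omega>. F (fst p) \<omega> * F (snd p) \<omega>))"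
    using NNM.integrable_fst[OF i3] by simp
  show "expectation (\<lambda>\<omega>. (LINT x|N. F x \<omega>)\<^sup>2) =
      (LINT p|(N \<Otimes>\<^sub>M N). expectation (\<lambda>\<omega>. F (fst p) \<omega> * F (snd p) \<omega>))"
    using NNM.Fubini_integral[OF i3] by (simp add: eq cong: Bochner_Integration.integral_cong)
qed

definition unit_interval_measure :: "real measure" where
  "unit_interval_measure = restrict_space lborel {0..1}"

abbreviation "\<U> \<equiv> unit_interval_measure"

lemma space_unit_interval_measure [simp]: "space unit_interval_measure = {0..1}"
  by (simp add: unit_interval_measure_def space_restrict_space)

lemma sets_unit_interval_measure [measurable_cong]:
  "sets unit_interval_measure = sets (restrict_space borel {0..1})"
  unfolding unit_interval_measure_def by (rule sets_restrict_space_cong) simp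

lemma prob_space_unit_interval_measure: "prob_space unit_interval_measure"
  by (rule prob_spaceI) (simp add: unit_interval_measure_def emeasure_restrict_space space_restrict_space)

interpretation U: prob_space unit_interval_measure
  by (rule prob_space_unit_interval_measure)

interpretation UU: pair_sigma_finite unit_interval_measure unit_interval_measure ..

interpretation UU_finite: finite_measure "unit_interval_measure \<Otimes>\<^sub>M unit_interval_measure"
  by (rule finite_measure_pair_measure) unfold_locales

lemma measurable_unit_interval_measureI [measurable (raw)]:
  "f \<in> borel \<rightarrow>\<^sub>M M \<Longrightarrow> f \<in> unit_interval_measure \<rightarrow>\<^sub>M M"
  unfolding unit_interval_measure_def by (rule measurable_restrict_space1) simp

lemma nn_integral_unit_interval_measure_le:
  "(\<integral>\<^sup>+x. f x \<partial>unit_interval_measure) \<le> (\<integral>\<^sup>+x. f x \<partial>lborel)"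
  unfolding unit_interval_measure_def
  by (subst nn_integral_restrict_space) (auto intro!: nn_integral_mono simp: indicator_def)

lemma nn_integral_decay_kernel_unit_interval_measure:
  assumes "1 < \<beta>" "0 < \<epsilon>"
  shows "(\<integral>\<^sup>+y. ennreal (decay_kernel \<beta> ((x - y) / \<epsilon>)) \<partial>unit_interval_measure) \<le> ennreal (\<epsilon> * (LINT t|lborel. decay_kernel \<beta> t))"
proof -
  have "(\<integral>\<^sup>+y. ennreal (decay_kernel \<beta> ((x - y) / \<epsilon>)) \<partial>unit_interval_measure) \<le> (\<integral>\<^sup>+y. ennreal (decay_kernel \<beta> ((x - y) / \<epsilon>)) \<partial>lborel)"
    by (rule nn_integral_unit_interval_measure_le)
  also have "\<dots> = ennreal \<epsilon> * (\<integral>\<^sup>+t. ennreal (decay_kernel \<beta> t) \<partial>lborel)"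
    using nn_integral_real_affine[of "\<lambda>y. ennreal (decay_kernel \<beta> ((x - y) / \<epsilon>))" \<epsilon> x] assms
    by simp
  also have "\<dots> = ennreal (\<epsilon> * (LINT t|lborel. decay_kernel \<beta> t))"
    using nn_integral_eq_integral[OF integrable_decay_kernel[OF assms(1)]] assms
    by (simp add: ennreal_mult)
  finally show ?thesis .
qed

section \<open>Joint moments of a normalized lognormal field\<close>

text \<open>The six variables are the weights of the edges 12, 13, 14, 23, 24, 34 of the complete graph on
  four vertices. The product of \<open>1 + weight\<close> over the edges inside a vertex set is the sum
  over all graphs on this set, so the inclusion-exclusion sum \<open>P\<close> retains exactly the graphs
  that leave no vertex isolated (singletons and the empty set contribute the constant \<open>- 3\<close>). In the proof they are grouped as those containing the matching
  12|34, of the others those containing 13|24, of the rest those containing 14|23, and the four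
  stars. In each group two edges are kept and the remaining ones are bounded by constants. For a
  star two of its three edges are kept. The constant is \<open>D\<^sup>2\<close> for the two kept edges times a crude
  \<open>20 * D ^ 4\<close> for the other factors.\<close>

lemma graph_sum_bound:
  fixes a b c d f g :: real
  defines "P \<equiv> (1+a)*(1+b)*(1+c)*(1+d)*(1+f)*(1+g)
      - (1+a)*(1+b)*(1+d) - (1+a)*(1+c)*(1+f) - (1+b)*(1+c)*(1+g) - (1+d)*(1+f)*(1+g)
      + (1+a) + (1+b) + (1+c) + (1+d) + (1+f) + (1+g) - 3"
  assumes D: "1 \<le> D"
    and a: "\<bar>a\<bar> \<le> D * ra" "0 \<le> ra" "ra \<le> 1" and b: "\<bar>b\<bar> \<le> D * rb" "0 \<le> rb" "rb \<le> 1"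
    and c: "\<bar>c\<bar> \<le> D * rc" "0 \<le> rc" "rc \<le> 1" and d: "\<bar>d\<bar> \<le> D * rd" "0 \<le> rd" "rd \<le> 1"
    and f: "\<bar>f\<bar> \<le> D * rf" "0 \<le> rf" "rf \<le> 1" and g: "\<bar>g\<bar> \<le> D * rg" "0 \<le> rg" "rg \<le> 1"
  shows "\<bar>P\<bar> \<le> 20 * D ^ 6 *
    (ra * rg + rb * rf + rc * rd + rb * rc + rd * rf + rb * rg + rc * rg)"
proof -
  have P: "P = a*g * ((1+b)*(1+c)*(1+d)*(1+f)) + b*f * (((1+a)*(1+g) - a*g)*((1+c)*(1+d)))
      + c*d * ((1+a+g)*(1+b+f)) + (b*c)*a + (d*f)*a + (b*g)*d + (c*g)*f"
    unfolding P_def by (simp only: ring_distribs mult_1_left mult_1_right ac_simps)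
  have le: "\<bar>x\<bar> \<le> D" if "\<bar>x\<bar> \<le> D * r" "r \<le> 1" for x r
    using that D by (meson mult_left_le order_trans zero_le_one)
  note l = le[OF a(1,3)] le[OF b(1,3)] le[OF c(1,3)] le[OF d(1,3)] le[OF f(1,3)] le[OF g(1,3)]
  have p1: "\<bar>1 + x\<bar> \<le> 2 * D" if "\<bar>x\<bar> \<le> D" for x
    using that D by linarith
  have p2: "\<bar>1 + x + y\<bar> \<le> 3 * D" if "\<bar>x\<bar> \<le> D" "\<bar>y\<bar> \<le> D" for x y
    using that D by linarith
  have pp: "\<bar>x * y\<bar> \<le> D^2 * (r * s)" if "\<bar>x\<bar> \<le> D * r" "0 \<le> r" "\<bar>y\<bar> \<le> D * s" for x y r s
  proof -
    have "\<bar>x\<bar> * \<bar>y\<bar> \<le> (D * r) * (D * s)" using that D by (intro mult_mono) auto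
    then show ?thesis by (simp add: abs_mult power2_eq_square algebra_simps)
  qed
  have grp: "\<bar>z * w\<bar> \<le> 20 * D ^ 6 * t" if "\<bar>z\<bar> \<le> D^2 * t" "0 \<le> t" "\<bar>w\<bar> \<le> 20 * D ^ 4" for z w t
  proof -
    have "\<bar>z\<bar> * \<bar>w\<bar> \<le> (D^2 * t) * (20 * D ^ 4)" using that D by (intro mult_mono) auto
    then show ?thesis by (simp add: abs_mult algebra_simps flip: power_add)
  qed
  have Dp: "D \<le> D^4" "D^2 \<le> D^4" "0 \<le> D^4"
    using D power_increasing[of 1 4 D] power_increasing[of 2 4 D] by auto
  have t1: "\<bar>(1+b)*(1+c)*(1+d)*(1+f)\<bar> \<le> 20 * D ^ 4"
  proof -
    have "\<bar>1+b\<bar> * \<bar>1+c\<bar> * \<bar>1+d\<bar> * \<bar>1+f\<bar> \<le> (2*D) * (2*D) * (2*D) * (2*D)"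
      by (intro mult_mono p1 l mult_nonneg_nonneg abs_ge_zero) (use D in auto)
    also have "\<dots> = 16 * D^4" by (simp add: power4_eq_xxxx)
    also have "\<dots> \<le> 20 * D^4" using Dp by linarith
    finally show ?thesis by (simp add: abs_mult)
  qed
  have t2: "\<bar>((1+a)*(1+g) - a*g)*((1+c)*(1+d))\<bar> \<le> 20 * D ^ 4"
  proof -
    have "\<bar>1 + a + g\<bar> * (\<bar>1+c\<bar> * \<bar>1+d\<bar>) \<le> (3*D) * ((2*D) * (2*D))"
      by (intro mult_mono p1 p2 l mult_nonneg_nonneg abs_ge_zero) (use D in auto)
    also have "\<dots> = 12 * D^3" by (simp add: power3_eq_cube)
    also have "\<dots> \<le> 20 * D^4" using power_increasing[of 3 4 D] D Dp by linarith
    finally have "\<bar>(1 + a + g) * ((1+c)*(1+d))\<bar> \<le> 20 * D ^ 4" by (simp add: abs_mult)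
    moreover have "(1+a)*(1+g) - a*g = 1 + a + g" by (simp add: ring_distribs)
    ultimately show ?thesis by simp
  qed
  have t3: "\<bar>(1+a+g)*(1+b+f)\<bar> \<le> 20 * D ^ 4"
  proof -
    have "\<bar>1 + a + g\<bar> * \<bar>1+b+f\<bar> \<le> (3*D) * (3*D)"
      by (intro mult_mono p2 l mult_nonneg_nonneg abs_ge_zero) (use D in auto)
    also have "\<dots> = 9 * D^2" by (simp add: power2_eq_square)
    also have "\<dots> \<le> 20 * D^4" using Dp by linarith
    finally show ?thesis by (simp add: abs_mult)
  qed
  have t4: "\<bar>x\<bar> \<le> 20 * D ^ 4" if "\<bar>x\<bar> \<le> D" for x
    using that Dp by linarith
  have q1: "\<bar>a*g * ((1+b)*(1+c)*(1+d)*(1+f))\<bar> \<le> 20 * D ^ 6 * (ra * rg)"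
    by (rule grp[OF pp[OF a(1,2) g(1)] mult_nonneg_nonneg[OF a(2) g(2)] t1])
  have q2: "\<bar>b*f * (((1+a)*(1+g) - a*g)*((1+c)*(1+d)))\<bar> \<le> 20 * D ^ 6 * (rb * rf)"
    by (rule grp[OF pp[OF b(1,2) f(1)] mult_nonneg_nonneg[OF b(2) f(2)] t2])
  have q3: "\<bar>c*d * ((1+a+g)*(1+b+f))\<bar> \<le> 20 * D ^ 6 * (rc * rd)"
    by (rule grp[OF pp[OF c(1,2) d(1)] mult_nonneg_nonneg[OF c(2) d(2)] t3])
  have q4: "\<bar>b*c*a\<bar> \<le> 20 * D ^ 6 * (rb * rc)"
    by (rule grp[OF pp[OF b(1,2) c(1)] mult_nonneg_nonneg[OF b(2) c(2)] t4[OF le[OF a(1,3)]]])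
  have q5: "\<bar>d*f*a\<bar> \<le> 20 * D ^ 6 * (rd * rf)"
    by (rule grp[OF pp[OF d(1,2) f(1)] mult_nonneg_nonneg[OF d(2) f(2)] t4[OF le[OF a(1,3)]]])
  have q6: "\<bar>b*g*d\<bar> \<le> 20 * D ^ 6 * (rb * rg)"
    by (rule grp[OF pp[OF b(1,2) g(1)] mult_nonneg_nonneg[OF b(2) g(2)] t4[OF le[OF d(1,3)]]])
  have q7: "\<bar>c*g*f\<bar> \<le> 20 * D ^ 6 * (rc * rg)"
    by (rule grp[OF pp[OF c(1,2) g(1)] mult_nonneg_nonneg[OF c(2) g(2)] t4[OF le[OF f(1,3)]]])
  have tri: "\<bar>x1+x2+x3+x4+x5+x6+x7\<bar> \<le> y1+y2+y3+y4+y5+y6+y7"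
    if "\<bar>x1\<bar> \<le> y1" "\<bar>x2\<bar> \<le> y2" "\<bar>x3\<bar> \<le> y3" "\<bar>x4\<bar> \<le> y4" "\<bar>x5\<bar> \<le> y5"
      "\<bar>x6\<bar> \<le> y6" "\<bar>x7\<bar> \<le> y7" for x1 x2 x3 x4 x5 x6 x7 y1 y2 y3 y4 y5 y6 y7 :: real
    by (intro order_trans[OF abs_triangle_ineq add_mono] that)
  show ?thesis
    unfolding P by (rule order_trans[OF tri[OF q1 q2 q3 q4 q5 q6 q7]]) (simp only: distrib_left order_refl)
qed

text \<open>The field enters only through joint moments of \<open>exp (- H)\<close>, so these moments take the place of
  the Gaussian law. The paths are continuous everywhere, not just almost surely, to make all
  pathwise integrals meaningful without exceptional sets. The exponent is kept below 2, the
  range in which the truncated first moment of the decay kernel has order \<open>\<epsilon> powr (\<beta> - 1)\<close>.\<close>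

locale lognormal_field = prob_space M for M :: "'w measure" +
  fixes H :: "real \<Rightarrow> 'w \<Rightarrow> real" and C :: "real \<Rightarrow> real" and \<beta> K :: real
  assumes H_measurable [measurable]: "case_prod H \<in> borel_measurable (borel \<Otimes>\<^sub>M M)"
    and H_continuous: "continuous_on UNIV (\<lambda>x. H x \<omega>)"
    and exp_integrable: "\<And>I (x :: nat \<Rightarrow> real). finite I \<Longrightarrow> integrable M (\<lambda>\<omega>. \<Prod>i\<in>I. exp (- H (x i) \<omega>))"
    and exp_moment: "\<And>I (x :: nat \<Rightarrow> real). finite I \<Longrightarrow>
      expectation (\<lambda>\<omega>. \<Prod>i\<in>I. exp (- H (x i) \<omega>)) = exp ((\<Sum>i\<in>I. \<Sum>j\<in>I. C (x i - x j)) / 2)"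
    and C_minus: "C (- t) = C t"
    and C_measurable [measurable]: "C \<in> borel_measurable borel"
    and C_decay: "\<bar>C t\<bar> \<le> K * decay_kernel \<beta> t"
    and \<beta>: "1 < \<beta>" "\<beta> < 2"
begin

definition m :: real where "m = exp (C 0 / 2)"

definition \<xi> :: "real \<Rightarrow> 'w \<Rightarrow> real" where "\<xi> x \<omega> = exp (- H x \<omega>) / m - 1"

definition e :: "real \<Rightarrow> real" where "e t = exp (C t) - 1"

lemma m_pos: "0 < m" by (simp add: m_def)

lemma e_measurable [measurable]: "e \<in> borel_measurable borel"
  unfolding e_def[abs_def] by measurable

lemma \<xi>_measurable [measurable]: "case_prod \<xi> \<in> borel_measurable (borel \<Otimes>\<^sub>M M)"
  unfolding \<xi>_def[abs_def] by measurable

lemma K_nonneg: "0 \<le> K"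
  using C_decay[of 0] by (simp add: decay_kernel_def)

text \<open>The constant \<open>K * exp K\<close> comes from \<open>\<bar>exp c - 1\<bar> \<le> \<bar>c\<bar> * exp \<bar>c\<bar>\<close> and \<open>\<bar>C t\<bar> \<le> K\<close>. Adding 1 makes powers
  of \<open>D\<close> increase with the exponent.\<close>

definition D :: real where "D = 1 + K * exp K"

lemma D_ge_1: "1 \<le> D" using K_nonneg by (simp add: D_def)

lemma e_decay: "\<bar>e t\<bar> \<le> D * decay_kernel \<beta> t"
proof -
  have *: "\<bar>exp c - 1\<bar> \<le> \<bar>c\<bar> * exp \<bar>c\<bar>" for c :: real
  proof (cases "c \<ge> 0")
    case True
    have "1 - c \<le> exp (- c)" using exp_ge_add_one_self[of "-c"] by simp
    then have "(1 - c) * exp c \<le> 1" by (simp add: exp_minus field_simps)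
    then show ?thesis using True by (simp add: algebra_simps)
  next
    case False
    then have "\<bar>exp c - 1\<bar> = 1 - exp c" by simp
    also have "\<dots> \<le> - c" using exp_ge_add_one_self[of c] by linarith
    also have "\<dots> \<le> \<bar>c\<bar> * exp \<bar>c\<bar>" using False mult_left_mono[of 1 "exp \<bar>c\<bar>" "\<bar>c\<bar>"] by simp
    finally show ?thesis .
  qed
  have k1: "decay_kernel \<beta> t \<le> 1" using decay_kernel_le_1 \<beta> by simp
  have CK: "\<bar>C t\<bar> \<le> K" using C_decay[of t] k1 K_nonneg by (meson mult_left_le order_trans)
  have "\<bar>e t\<bar> \<le> \<bar>C t\<bar> * exp \<bar>C t\<bar>" unfolding e_def by (rule *)
  also have "\<dots> \<le> (K * decay_kernel \<beta> t) * exp K"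
    using C_decay[of t] CK K_nonneg by (intro mult_mono) auto
  also have "\<dots> \<le> D * decay_kernel \<beta> t" by (simp add: D_def algebra_simps)
  finally show ?thesis .
qed

lemma integrable_e: "integrable lborel e"
  by (rule Bochner_Integration.integrable_bound[OF integrable_mult_right[of D, OF integrable_decay_kernel[OF \<beta>(1)]]])
     (use e_decay D_ge_1 in \<open>auto simp: abs_mult\<close>)

abbreviation \<eta> :: "real \<Rightarrow> 'w \<Rightarrow> real" where "\<eta> x \<omega> \<equiv> exp (- H x \<omega>) / m"

lemma normalized_moments:
  shows moment1: "has_bochner_integral M (\<lambda>\<omega>. \<eta> p \<omega>) 1"
    and moment2: "has_bochner_integral M (\<lambda>\<omega>. \<eta> p \<omega> * \<eta> q \<omega>) (1 + e (p - q))"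
    and moment3: "has_bochner_integral M (\<lambda>\<omega>. \<eta> p \<omega> * \<eta> q \<omega> * \<eta> r \<omega>)
      ((1 + e (p - q)) * (1 + e (p - r)) * (1 + e (q - r)))"
    and moment4: "has_bochner_integral M (\<lambda>\<omega>. \<eta> p \<omega> * \<eta> q \<omega> * \<eta> r \<omega> * \<eta> s \<omega>)
      ((1 + e (p - q)) * (1 + e (p - r)) * (1 + e (p - s)) * (1 + e (q - r)) * (1 + e (q - s)) * (1 + e (r - s)))"
proof -
  have sym: "C (q - p) = C (p - q)" for p q using C_minus[of "p - q"] by simp
  define x where "x = (\<lambda>i::nat. if i = 0 then p else if i = 1 then q else if i = 2 then r else s)"
  have x: "x 0 = p" "x (Suc 0) = q" "x 2 = r" "x 3 = s" by (auto simp: x_def)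
  have hb: "has_bochner_integral M (\<lambda>\<omega>. (\<Prod>i\<in>{..<n}. exp (- H (x i) \<omega>)) / m ^ n)
      (exp ((\<Sum>i<n. \<Sum>j<n. C (x i - x j)) / 2 - n * C 0 / 2))" for n
  proof -
    have "has_bochner_integral M (\<lambda>\<omega>. \<Prod>i\<in>{..<n}. exp (- H (x i) \<omega>)) (exp ((\<Sum>i<n. \<Sum>j<n. C (x i - x j)) / 2))"
      using exp_integrable[of "{..<n}" x] exp_moment[of "{..<n}" x] by (simp add: has_bochner_integral_iff)
    then have "has_bochner_integral M (\<lambda>\<omega>. (\<Prod>i\<in>{..<n}. exp (- H (x i) \<omega>)) / m ^ n)
      (exp ((\<Sum>i<n. \<Sum>j<n. C (x i - x j)) / 2) / m ^ n)"
      by (rule has_bochner_integral_divide_zero)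
    then show ?thesis by (simp add: exp_diff m_def flip: exp_of_nat_mult)
  qed
  have e1: "1 + e t = exp (C t)" for t by (simp add: e_def)
  show "has_bochner_integral M (\<lambda>\<omega>. \<eta> p \<omega>) 1"
    using hb[of 1] by (simp add: x)
  show "has_bochner_integral M (\<lambda>\<omega>. \<eta> p \<omega> * \<eta> q \<omega>) (1 + e (p - q))"
    using hb[of 2] unfolding e1 by (simp add: x sym[of q p] numeral_2_eq_2 field_simps)
  show "has_bochner_integral M (\<lambda>\<omega>. \<eta> p \<omega> * \<eta> q \<omega> * \<eta> r \<omega>)
      ((1 + e (p - q)) * (1 + e (p - r)) * (1 + e (q - r)))"
  proof -
    have "(\<Sum>i<3. \<Sum>j<3. C (x i - x j)) / 2 - 3 * C 0 / 2 = C (p - q) + C (p - r) + C (q - r)"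
      by (simp add: lessThan_nat_numeral x sym[of q p] sym[of r p] sym[of r q] field_simps)
    with hb[of 3] show ?thesis
      unfolding e1 by (simp add: lessThan_nat_numeral x exp_add power3_eq_cube mult_ac)
  qed
  show "has_bochner_integral M (\<lambda>\<omega>. \<eta> p \<omega> * \<eta> q \<omega> * \<eta> r \<omega> * \<eta> s \<omega>)
      ((1 + e (p - q)) * (1 + e (p - r)) * (1 + e (p - s)) * (1 + e (q - r)) * (1 + e (q - s)) * (1 + e (r - s)))"
  proof -
    have "(\<Sum>i<4. \<Sum>j<4. C (x i - x j)) / 2 - 4 * C 0 / 2 =
        C (p - q) + C (p - r) + C (p - s) + C (q - r) + C (q - s) + C (r - s)"
      by (simp add: lessThan_nat_numeral x sym[of q p] sym[of r p] sym[of r q] sym[of s p] sym[of s q] sym[of s r] field_simps)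
    with hb[of 4] show ?thesis
      unfolding e1 by (simp add: lessThan_nat_numeral x exp_add power4_eq_xxxx mult_ac)
  qed
qed

lemma \<xi>_mean: "has_bochner_integral M (\<xi> x) 0"
proof -
  have "has_bochner_integral M (\<lambda>\<omega>. \<eta> x \<omega> - 1) (1 - 1)"
    by (intro has_bochner_integral_diff moment1) (simp add: has_bochner_integral_iff prob_space)
  then show ?thesis by (simp add: \<xi>_def[abs_def])
qed

lemma one_moment: "has_bochner_integral M (\<lambda>\<omega>. 1::real) 1"
  by (simp add: has_bochner_integral_iff prob_space)

lemma \<xi>_covariance: "has_bochner_integral M (\<lambda>\<omega>. \<xi> x \<omega> * \<xi> y \<omega>) (e (x - y))"
proof -
  have "has_bochner_integral M (\<lambda>\<omega>. \<eta> x \<omega> * \<eta> y \<omega> - \<eta> x \<omega> - \<eta> y \<omega> + 1) ((1 + e (x - y)) - 1 - 1 + 1)"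
    by (intro has_bochner_integral_diff has_bochner_integral_add moment1 moment2 one_moment)
  then show ?thesis by (simp add: \<xi>_def algebra_simps)
qed

text \<open>Products of two edge weights on the vertices \<open>p, q, r, s\<close>: the three perfect matchings, and for
  each of the four stars two of its edges.\<close>

definition pairing_kernel :: "real \<Rightarrow> real \<Rightarrow> real \<Rightarrow> real \<Rightarrow> real" where
  "pairing_kernel p q r s = decay_kernel \<beta> (p - q) * decay_kernel \<beta> (r - s) + decay_kernel \<beta> (p - r) * decay_kernel \<beta> (q - s)
    + decay_kernel \<beta> (p - s) * decay_kernel \<beta> (q - r) + decay_kernel \<beta> (p - r) * decay_kernel \<beta> (p - s)
    + decay_kernel \<beta> (q - r) * decay_kernel \<beta> (q - s) + decay_kernel \<beta> (p - r) * decay_kernel \<beta> (r - s) + decay_kernel \<beta> (p - s) * decay_kernel \<beta> (r - s)"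

lemma \<xi>_fourth_moment:
  shows "integrable M (\<lambda>\<omega>. \<xi> p \<omega> * \<xi> q \<omega> * \<xi> r \<omega> * \<xi> s \<omega>)"
    and "\<bar>expectation (\<lambda>\<omega>. \<xi> p \<omega> * \<xi> q \<omega> * \<xi> r \<omega> * \<xi> s \<omega>)\<bar> \<le> 20 * D ^ 6 * pairing_kernel p q r s"
proof -
  define a where "a = e (p - q)"
  define b where "b = e (p - r)"
  define c where "c = e (p - s)"
  define d where "d = e (q - r)"
  define f where "f = e (q - s)"
  define g where "g = e (r - s)"
  note defs = a_def b_def c_def d_def f_def g_def
  have eq: "(\<lambda>\<omega>. \<xi> p \<omega> * \<xi> q \<omega> * \<xi> r \<omega> * \<xi> s \<omega>) = (\<lambda>\<omega>. \<eta> p \<omega> * \<eta> q \<omega> * \<eta> r \<omega> * \<eta> s \<omega>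
      - \<eta> p \<omega> * \<eta> q \<omega> * \<eta> r \<omega> - \<eta> p \<omega> * \<eta> q \<omega> * \<eta> s \<omega> - \<eta> p \<omega> * \<eta> r \<omega> * \<eta> s \<omega> - \<eta> q \<omega> * \<eta> r \<omega> * \<eta> s \<omega>
      + \<eta> p \<omega> * \<eta> q \<omega> + \<eta> p \<omega> * \<eta> r \<omega> + \<eta> p \<omega> * \<eta> s \<omega> + \<eta> q \<omega> * \<eta> r \<omega> + \<eta> q \<omega> * \<eta> s \<omega> + \<eta> r \<omega> * \<eta> s \<omega>
      - \<eta> p \<omega> - \<eta> q \<omega> - \<eta> r \<omega> - \<eta> s \<omega> + 1)"
  proof
    fix \<omega>
    have *: "(v - 1) * (w - 1) * (x - 1) * (y - 1) = v * w * x * y - v * w * x - v * w * y - v * x * y - w * x * y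
      + v * w + v * x + v * y + w * x + w * y + x * y - v - w - x - y + 1" for v w x y :: real
      by (simp add: algebra_simps)
    show "\<xi> p \<omega> * \<xi> q \<omega> * \<xi> r \<omega> * \<xi> s \<omega> = \<eta> p \<omega> * \<eta> q \<omega> * \<eta> r \<omega> * \<eta> s \<omega>
      - \<eta> p \<omega> * \<eta> q \<omega> * \<eta> r \<omega> - \<eta> p \<omega> * \<eta> q \<omega> * \<eta> s \<omega> - \<eta> p \<omega> * \<eta> r \<omega> * \<eta> s \<omega> - \<eta> q \<omega> * \<eta> r \<omega> * \<eta> s \<omega>
      + \<eta> p \<omega> * \<eta> q \<omega> + \<eta> p \<omega> * \<eta> r \<omega> + \<eta> p \<omega> * \<eta> s \<omega> + \<eta> q \<omega> * \<eta> r \<omega> + \<eta> q \<omega> * \<eta> s \<omega> + \<eta> r \<omega> * \<eta> s \<omega>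
      - \<eta> p \<omega> - \<eta> q \<omega> - \<eta> r \<omega> - \<eta> s \<omega> + 1"
      unfolding \<xi>_def by (rule *)
  qed
  have "has_bochner_integral M (\<lambda>\<omega>. \<xi> p \<omega> * \<xi> q \<omega> * \<xi> r \<omega> * \<xi> s \<omega>)
     ((1+a)*(1+b)*(1+c)*(1+d)*(1+f)*(1+g)
      - (1+a)*(1+b)*(1+d) - (1+a)*(1+c)*(1+f) - (1+b)*(1+c)*(1+g) - (1+d)*(1+f)*(1+g)
      + (1+a) + (1+b) + (1+c) + (1+d) + (1+f) + (1+g) - 1 - 1 - 1 - 1 + 1)"
    unfolding eq defs
    by (intro has_bochner_integral_diff has_bochner_integral_add moment1 moment2 moment3 moment4 one_moment)
  then have hb: "has_bochner_integral M (\<lambda>\<omega>. \<xi> p \<omega> * \<xi> q \<omega> * \<xi> r \<omega> * \<xi> s \<omega>)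
     ((1+a)*(1+b)*(1+c)*(1+d)*(1+f)*(1+g)
      - (1+a)*(1+b)*(1+d) - (1+a)*(1+c)*(1+f) - (1+b)*(1+c)*(1+g) - (1+d)*(1+f)*(1+g)
      + (1+a) + (1+b) + (1+c) + (1+d) + (1+f) + (1+g) - 3)"
    by (rule back_subst[of "has_bochner_integral M _"]) simp
  then show "integrable M (\<lambda>\<omega>. \<xi> p \<omega> * \<xi> q \<omega> * \<xi> r \<omega> * \<xi> s \<omega>)"
    by (rule integrable.intros)
  have k1: "decay_kernel \<beta> t \<le> 1" for t using decay_kernel_le_1 \<beta> by simp
  show "\<bar>expectation (\<lambda>\<omega>. \<xi> p \<omega> * \<xi> q \<omega> * \<xi> r \<omega> * \<xi> s \<omega>)\<bar> \<le> 20 * D ^ 6 * pairing_kernel p q r s"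
    unfolding has_bochner_integral_integral_eq[OF hb] pairing_kernel_def
    by (rule graph_sum_bound) (auto simp: defs D_ge_1 e_decay k1)
qed

end

section \<open>Second and fourth moments of weighted averages\<close>

text \<open>Each of the seven products of two kernels has a variable occurring in one factor only. That
  factor integrates to at most \<open>S\<close>, uniformly in its other variable, and so does then the
  second factor. The nested integrals follow the pair structure in which the fourth moment of
  \<open>second_moment_of_integral\<close> is delivered.\<close>

lemma nn_integral_decay_kernel_chain:
  assumes \<beta>: "1 < \<beta>" and \<epsilon>: "0 < \<epsilon>"
  defines "r \<equiv> \<lambda>x y. ennreal (decay_kernel \<beta> ((x - y) / \<epsilon>))"
  defines "S \<equiv> ennreal (\<epsilon> * (LINT t|lborel. decay_kernel \<beta> t))"
  shows "(\<integral>\<^sup>+p. (\<integral>\<^sup>+q. r (fst p) (snd p) * r (fst q) (snd q) + r (fst p) (fst q) * r (snd p) (snd q)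
    + r (fst p) (snd q) * r (snd p) (fst q) + r (fst p) (fst q) * r (fst p) (snd q)
    + r (snd p) (fst q) * r (snd p) (snd q) + r (fst p) (fst q) * r (fst q) (snd q)
    + r (fst p) (snd q) * r (fst q) (snd q) \<partial>(\<U> \<Otimes>\<^sub>M \<U>)) \<partial>(\<U> \<Otimes>\<^sub>M \<U>)) \<le> 7 * S\<^sup>2"
proof -
  have [measurable]: "(\<lambda>x. r (f x) (g x)) \<in> borel_measurable N"
    if [measurable]: "f \<in> borel_measurable N" "g \<in> borel_measurable N" for f g and N :: "'c measure"
    unfolding r_def by measurable
  have fs [measurable]: "fst \<in> borel_measurable (\<U> \<Otimes>\<^sub>M \<U>)" "snd \<in> borel_measurable (\<U> \<Otimes>\<^sub>M \<U>)"
    by (auto intro!: measurable_compose[OF measurable_fst] measurable_compose[OF measurable_snd])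
  have r1: "(\<integral>\<^sup>+y. r x y \<partial>\<U>) \<le> S" for x
    unfolding r_def S_def by (rule nn_integral_decay_kernel_unit_interval_measure[OF \<beta> \<epsilon>])
  have sym: "r x y = r y x" for x y
    unfolding r_def using decay_kernel_minus[of \<beta> "(x - y) / \<epsilon>"] by (simp add: minus_divide_left)
  have r2: "(\<integral>\<^sup>+x. r x y \<partial>\<U>) \<le> S" for y
    using r1[of y] by (simp add: sym[of _ y])
  have pair: "(\<integral>\<^sup>+q. f (fst q) (snd q) \<partial>(\<U> \<Otimes>\<^sub>M \<U>)) = (\<integral>\<^sup>+x. \<integral>\<^sup>+y. f x y \<partial>\<U> \<partial>\<U>)"
    if [measurable]: "(\<lambda>q. f (fst q) (snd q)) \<in> borel_measurable (\<U> \<Otimes>\<^sub>M \<U>)" for f :: "real \<Rightarrow> real \<Rightarrow> ennreal"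
    using U.nn_integral_fst[OF that, symmetric] by simp
  \<comment> \<open>integrate out a variable that occurs in one factor only, then the other factor\<close>
  have two: "(\<integral>\<^sup>+x. \<integral>\<^sup>+y. f x * g x y \<partial>\<U> \<partial>\<U>) \<le> F * S"
    if "(\<integral>\<^sup>+x. f x \<partial>\<U>) \<le> F" "\<And>x. (\<integral>\<^sup>+y. g x y \<partial>\<U>) \<le> S"
      and [measurable]: "f \<in> borel_measurable \<U>" "\<And>x. g x \<in> borel_measurable \<U>" for f g F
  proof -
    have "(\<integral>\<^sup>+x. \<integral>\<^sup>+y. f x * g x y \<partial>\<U> \<partial>\<U>) = (\<integral>\<^sup>+x. f x * (\<integral>\<^sup>+y. g x y \<partial>\<U>) \<partial>\<U>)"
      by (intro nn_integral_cong nn_integral_cmult) simp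
    also have "\<dots> \<le> (\<integral>\<^sup>+x. f x * S \<partial>\<U>)"
      by (intro nn_integral_mono mult_left_mono that) simp
    also have "\<dots> = (\<integral>\<^sup>+x. f x \<partial>\<U>) * S" by (rule nn_integral_multc) simp
    also have "\<dots> \<le> F * S" by (intro mult_right_mono that) simp
    finally show ?thesis .
  qed
  have SS: "S\<^sup>2 = S * S" by (simp add: power2_eq_square)
  have seven: "7 * S\<^sup>2 = S * S + 6 * S\<^sup>2"
  proof -
    have "7 * S\<^sup>2 = (1 + 6) * S\<^sup>2" by simp
    then show ?thesis by (simp only: distrib_right SS mult_1_left)
  qed
  have six: "z + S\<^sup>2 + S\<^sup>2 + S\<^sup>2 + S\<^sup>2 + S\<^sup>2 + S\<^sup>2 = z + 6 * S\<^sup>2" for z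
  proof -
    have "6 * S\<^sup>2 = (1 + 1 + 1 + 1 + 1 + 1) * S\<^sup>2" by simp
    then show ?thesis by (simp only: distrib_right mult_1_left add.assoc)
  qed
  have inner: "(\<integral>\<^sup>+q. r x y * r (fst q) (snd q) + r x (fst q) * r y (snd q)
    + r x (snd q) * r y (fst q) + r x (fst q) * r x (snd q)
    + r y (fst q) * r y (snd q) + r x (fst q) * r (fst q) (snd q)
    + r x (snd q) * r (fst q) (snd q) \<partial>(\<U> \<Otimes>\<^sub>M \<U>)) \<le> r x y * S + 6 * S\<^sup>2" for x y
  proof -
    have t1: "(\<integral>\<^sup>+q. r x y * r (fst q) (snd q) \<partial>(\<U> \<Otimes>\<^sub>M \<U>)) \<le> r x y * S"
      by (subst pair) (auto intro!: two r1 simp: U.emeasure_space_1[simplified])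
    have t2: "(\<integral>\<^sup>+q. r x (fst q) * r y (snd q) \<partial>(\<U> \<Otimes>\<^sub>M \<U>)) \<le> S\<^sup>2"
      unfolding SS by (subst pair) (auto intro!: two r1 r2)
    have t3: "(\<integral>\<^sup>+q. r x (snd q) * r y (fst q) \<partial>(\<U> \<Otimes>\<^sub>M \<U>)) \<le> S\<^sup>2"
      unfolding SS by (subst mult.commute, subst pair) (auto intro!: two r1 r2)
    have t4: "(\<integral>\<^sup>+q. r x (fst q) * r x (snd q) \<partial>(\<U> \<Otimes>\<^sub>M \<U>)) \<le> S\<^sup>2"
      unfolding SS by (subst pair) (auto intro!: two r1 r2)
    have t5: "(\<integral>\<^sup>+q. r y (fst q) * r y (snd q) \<partial>(\<U> \<Otimes>\<^sub>M \<U>)) \<le> S\<^sup>2"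
      unfolding SS by (subst pair) (auto intro!: two r1 r2)
    have t6: "(\<integral>\<^sup>+q. r x (fst q) * r (fst q) (snd q) \<partial>(\<U> \<Otimes>\<^sub>M \<U>)) \<le> S\<^sup>2"
      unfolding SS by (subst pair) (auto intro!: two r1 r2)
    have t7: "(\<integral>\<^sup>+q. r x (snd q) * r (fst q) (snd q) \<partial>(\<U> \<Otimes>\<^sub>M \<U>)) \<le> S\<^sup>2"
    proof -
      have "(\<integral>\<^sup>+q. r x (snd q) * r (fst q) (snd q) \<partial>(\<U> \<Otimes>\<^sub>M \<U>)) =
          (\<integral>\<^sup>+v. \<integral>\<^sup>+u. r x v * r u v \<partial>\<U> \<partial>\<U>)"
        using UU.nn_integral_snd[of "\<lambda>q. r x (snd q) * r (fst q) (snd q)", symmetric] by simp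
      also have "\<dots> \<le> S\<^sup>2" unfolding SS by (auto intro!: two r1 r2)
      finally show ?thesis .
    qed
    have "(\<integral>\<^sup>+q. r x y * r (fst q) (snd q) + r x (fst q) * r y (snd q)
      + r x (snd q) * r y (fst q) + r x (fst q) * r x (snd q)
      + r y (fst q) * r y (snd q) + r x (fst q) * r (fst q) (snd q)
      + r x (snd q) * r (fst q) (snd q) \<partial>(\<U> \<Otimes>\<^sub>M \<U>)) \<le> r x y * S + S\<^sup>2 + S\<^sup>2 + S\<^sup>2 + S\<^sup>2 + S\<^sup>2 + S\<^sup>2"
      using add_mono[OF add_mono[OF add_mono[OF add_mono[OF add_mono[OF add_mono[OF t1 t2] t3] t4] t5] t6] t7]
      by (simp add: nn_integral_add)
    also have "\<dots> = r x y * S + 6 * S\<^sup>2"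
      by (rule six)
    finally show ?thesis .
  qed
  have "(\<integral>\<^sup>+p. r (fst p) (snd p) \<partial>(\<U> \<Otimes>\<^sub>M \<U>)) \<le> S"
  proof -
    have "(\<integral>\<^sup>+x. \<integral>\<^sup>+y. 1 * r x y \<partial>\<U> \<partial>\<U>) \<le> 1 * S"
      by (rule two) (auto intro!: r1 simp: U.emeasure_space_1[simplified])
    then show ?thesis by (subst pair) auto
  qed
  then have fin: "(\<integral>\<^sup>+p. r (fst p) (snd p) * S + 6 * S\<^sup>2 \<partial>(\<U> \<Otimes>\<^sub>M \<U>)) \<le> S * S + 6 * S\<^sup>2"
  proof -
    have 1: "emeasure (\<U> \<Otimes>\<^sub>M \<U>) (space (\<U> \<Otimes>\<^sub>M \<U>)) = 1"
      using U.emeasure_pair_measure_Times[of "{0..1}" \<U> "{0..1}"] U.emeasure_space_1 sets.top[of \<U>]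
      by (simp add: space_pair_measure)
    assume "(\<integral>\<^sup>+p. r (fst p) (snd p) \<partial>(\<U> \<Otimes>\<^sub>M \<U>)) \<le> S"
    then show ?thesis
      by (simp add: nn_integral_add nn_integral_multc 1 add_mono mult_right_mono)
  qed
  show ?thesis
    unfolding seven by (rule order_trans[OF nn_integral_mono[OF inner] fin])
qed

context lognormal_field begin

definition fluct :: "(real \<Rightarrow> real) \<Rightarrow> real \<Rightarrow> 'w \<Rightarrow> real" where
  "fluct \<phi> \<epsilon> \<omega> = (LINT x|\<U>. \<phi> x * \<xi> (x / \<epsilon>) \<omega>)"

lemma \<xi>_bounded:
  obtains R where "\<And>x. x \<in> {0..1} \<Longrightarrow> \<bar>\<xi> (x / \<epsilon>) \<omega>\<bar> \<le> R"
proof -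
  have "continuous_on {0..1} (\<lambda>x. H (x / \<epsilon>) \<omega>)"
    by (rule continuous_on_compose2[OF H_continuous]) (auto intro!: continuous_intros simp: divide_inverse)
  then have "continuous_on {0..1} (\<lambda>x. \<xi> (x / \<epsilon>) \<omega>)"
    unfolding \<xi>_def using m_pos by (auto intro!: continuous_intros)
  then have "bounded ((\<lambda>x. \<xi> (x / \<epsilon>) \<omega>) ` {0..1})"
    by (intro compact_imp_bounded compact_continuous_image) auto
  then obtain R where "\<forall>x\<in>{0..1}. \<bar>\<xi> (x / \<epsilon>) \<omega>\<bar> \<le> R" by (auto simp: bounded_iff)
  then show ?thesis by (intro that) auto
qed

lemma \<xi>_measurable_x [measurable]: "\<omega> \<in> space M \<Longrightarrow> (\<lambda>x. \<xi> x \<omega>) \<in> borel_measurable borel"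
  using measurable_Pair1[OF \<xi>_measurable] by simp

lemma integrable_mult_\<xi>:
  assumes [measurable]: "\<phi> \<in> borel_measurable \<U>" and "\<And>x. x \<in> {0..1} \<Longrightarrow> \<bar>\<phi> x\<bar> \<le> b" and "\<omega> \<in> space M"
  shows "integrable \<U> (\<lambda>x. \<phi> x * \<xi> (x / \<epsilon>) \<omega>)"
proof -
  obtain R where R: "\<And>x. x \<in> {0..1} \<Longrightarrow> \<bar>\<xi> (x / \<epsilon>) \<omega>\<bar> \<le> R" by (rule \<xi>_bounded[of \<epsilon> \<omega>]) blast
  have [measurable]: "(\<lambda>x. \<xi> (x / \<epsilon>) \<omega>) \<in> borel_measurable \<U>"
    by (intro measurable_unit_interval_measureI measurable_compose[OF _ \<xi>_measurable_x[OF assms(3)]]) measurable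
  have "\<bar>\<phi> x * \<xi> (x / \<epsilon>) \<omega>\<bar> \<le> b * R" if "x \<in> {0..1}" for x
    unfolding abs_mult using assms(2)[OF that] R[OF that] by (intro mult_mono) auto
  then show ?thesis
    by (intro U.integrable_const_bound[where B = "b * R"] AE_I2) auto
qed

context
  fixes \<phi> :: "real \<Rightarrow> real" and b \<epsilon> :: real
  assumes \<phi>_meas [measurable]: "\<phi> \<in> borel_measurable \<U>" and \<phi>_bound: "\<And>x. x \<in> {0..1} \<Longrightarrow> \<bar>\<phi> x\<bar> \<le> b"
    and \<epsilon>: "0 < \<epsilon>"
begin

lemma weighted_\<xi>_measurable [measurable]: "(\<lambda>(x, \<omega>). \<phi> x * \<xi> (x / \<epsilon>) \<omega>) \<in> borel_measurable (\<U> \<Otimes>\<^sub>M M)"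
proof -
  have "fst \<in> borel_measurable (\<U> \<Otimes>\<^sub>M M)"
    by (rule measurable_compose[OF measurable_fst]) auto
  then have "(\<lambda>p. (fst p / \<epsilon>, snd p)) \<in> \<U> \<Otimes>\<^sub>M M \<rightarrow>\<^sub>M borel \<Otimes>\<^sub>M M"
    by (intro measurable_Pair borel_measurable_divide borel_measurable_const measurable_snd)
  from measurable_compose[OF this \<xi>_measurable]
  have [measurable]: "(\<lambda>p. \<xi> (fst p / \<epsilon>) (snd p)) \<in> borel_measurable (\<U> \<Otimes>\<^sub>M M)"
    by simp
  show ?thesis by (simp add: case_prod_beta')
qed

lemma fluct_measurable [measurable]: "fluct \<phi> \<epsilon> \<in> borel_measurable M"
proof -
  have "(\<lambda>(\<omega>, x). \<phi> x * \<xi> (x / \<epsilon>) \<omega>) \<in> borel_measurable (M \<Otimes>\<^sub>M \<U>)"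
    using measurable_pair_swap[OF weighted_\<xi>_measurable] by simp
  then show ?thesis unfolding fluct_def[abs_def] by measurable
qed

lemma b_nonneg: "0 \<le> b"
  using \<phi>_bound[of 0] by simp

lemma weighted_\<xi>_covariance:
  "has_bochner_integral M (\<lambda>\<omega>. (\<phi> x * \<xi> (x / \<epsilon>) \<omega>) * (\<phi> y * \<xi> (y / \<epsilon>) \<omega>)) (\<phi> x * \<phi> y * e ((x - y) / \<epsilon>))"
proof -
  have "has_bochner_integral M (\<lambda>\<omega>. \<phi> x * \<phi> y * (\<xi> (x / \<epsilon>) \<omega> * \<xi> (y / \<epsilon>) \<omega>)) (\<phi> x * \<phi> y * e (x / \<epsilon> - y / \<epsilon>))"
    by (rule has_bochner_integral_mult_right) (rule \<xi>_covariance)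
  then show ?thesis by (simp add: mult_ac diff_divide_distrib)
qed

lemma weighted_\<xi>_square:
  assumes "x \<in> {0..1}"
  shows "integrable M (\<lambda>\<omega>. (\<phi> x * \<xi> (x / \<epsilon>) \<omega>)\<^sup>2)"
    and "expectation (\<lambda>\<omega>. (\<phi> x * \<xi> (x / \<epsilon>) \<omega>)\<^sup>2) \<le> b\<^sup>2 * \<bar>e 0\<bar>"
proof -
  note hb = weighted_\<xi>_covariance[of x x, folded power2_eq_square, simplified]
  show "integrable M (\<lambda>\<omega>. (\<phi> x * \<xi> (x / \<epsilon>) \<omega>)\<^sup>2)" using hb by (rule integrable.intros)
  have "\<bar>\<phi> x\<bar>\<^sup>2 \<le> b\<^sup>2" using \<phi>_bound[OF assms] by (intro power_mono) auto
  then have "(\<phi> x)\<^sup>2 * \<bar>e 0\<bar> \<le> b\<^sup>2 * \<bar>e 0\<bar>" by (intro mult_right_mono) auto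
  moreover have "(\<phi> x)\<^sup>2 * e 0 \<le> (\<phi> x)\<^sup>2 * \<bar>e 0\<bar>" by (intro mult_left_mono) auto
  ultimately have "(\<phi> x)\<^sup>2 * e 0 \<le> b\<^sup>2 * \<bar>e 0\<bar>" by linarith
  then show "expectation (\<lambda>\<omega>. (\<phi> x * \<xi> (x / \<epsilon>) \<omega>)\<^sup>2) \<le> b\<^sup>2 * \<bar>e 0\<bar>"
    using has_bochner_integral_integral_eq[OF hb] by simp
qed

lemma weighted_\<xi>_integrable: "\<omega> \<in> space M \<Longrightarrow> integrable \<U> (\<lambda>x. \<phi> x * \<xi> (x / \<epsilon>) \<omega>)"
  using integrable_mult_\<xi>[OF \<phi>_meas \<phi>_bound] by simp

lemmas weighted_\<xi>_moments = second_moment_of_integral[OF U.finite_measure_axioms weighted_\<xi>_measurable weighted_\<xi>_integrable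
    weighted_\<xi>_square[unfolded space_unit_interval_measure[symmetric]]]

lemma fluct_second_moment:
  shows "integrable M (\<lambda>\<omega>. (fluct \<phi> \<epsilon> \<omega>)\<^sup>2)"
    and "expectation (\<lambda>\<omega>. (fluct \<phi> \<epsilon> \<omega>)\<^sup>2) =
      (LINT p|(\<U> \<Otimes>\<^sub>M \<U>). \<phi> (fst p) * \<phi> (snd p) * e ((fst p - snd p) / \<epsilon>))"
    and "integrable (\<U> \<Otimes>\<^sub>M \<U>) (\<lambda>p. \<phi> (fst p) * \<phi> (snd p) * e ((fst p - snd p) / \<epsilon>))"
  using weighted_\<xi>_moments(1-3) unfolding has_bochner_integral_integral_eq[OF weighted_\<xi>_covariance]
  by (auto simp: fluct_def)

lemma weighted_\<xi>_fourth_moment: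
  assumes "x \<in> {0..1}" "y \<in> {0..1}" "z \<in> {0..1}" "w \<in> {0..1}"
  shows "\<bar>expectation (\<lambda>\<omega>. (\<phi> x * \<xi> (x / \<epsilon>) \<omega> * (\<phi> y * \<xi> (y / \<epsilon>) \<omega>)) * (\<phi> z * \<xi> (z / \<epsilon>) \<omega> * (\<phi> w * \<xi> (w / \<epsilon>) \<omega>)))\<bar>
      \<le> b ^ 4 * (20 * D ^ 6 * pairing_kernel (x / \<epsilon>) (y / \<epsilon>) (z / \<epsilon>) (w / \<epsilon>))" 
    and "integrable M (\<lambda>\<omega>. (\<phi> x * \<xi> (x / \<epsilon>) \<omega> * (\<phi> y * \<xi> (y / \<epsilon>) \<omega>)) * (\<phi> z * \<xi> (z / \<epsilon>) \<omega> * (\<phi> w * \<xi> (w / \<epsilon>) \<omega>)))"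
proof -
  have eq: "(\<lambda>\<omega>. (\<phi> x * \<xi> (x / \<epsilon>) \<omega> * (\<phi> y * \<xi> (y / \<epsilon>) \<omega>)) * (\<phi> z * \<xi> (z / \<epsilon>) \<omega> * (\<phi> w * \<xi> (w / \<epsilon>) \<omega>)))
    = (\<lambda>\<omega>. (\<phi> x * \<phi> y * \<phi> z * \<phi> w) * (\<xi> (x / \<epsilon>) \<omega> * \<xi> (y / \<epsilon>) \<omega> * \<xi> (z / \<epsilon>) \<omega> * \<xi> (w / \<epsilon>) \<omega>))"
    by (simp add: mult_ac)
  show "integrable M (\<lambda>\<omega>. (\<phi> x * \<xi> (x / \<epsilon>) \<omega> * (\<phi> y * \<xi> (y / \<epsilon>) \<omega>)) * (\<phi> z * \<xi> (z / \<epsilon>) \<omega> * (\<phi> w * \<xi> (w / \<epsilon>) \<omega>)))"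
    unfolding eq by (intro integrable_mult_right \<xi>_fourth_moment)
  have "\<bar>\<phi> x * \<phi> y * \<phi> z * \<phi> w\<bar> \<le> b * b * b * b"
    unfolding abs_mult using \<phi>_bound assms b_nonneg by (intro mult_mono mult_nonneg_nonneg) auto
  then show "\<bar>expectation (\<lambda>\<omega>. (\<phi> x * \<xi> (x / \<epsilon>) \<omega> * (\<phi> y * \<xi> (y / \<epsilon>) \<omega>)) * (\<phi> z * \<xi> (z / \<epsilon>) \<omega> * (\<phi> w * \<xi> (w / \<epsilon>) \<omega>)))\<bar>
      \<le> b ^ 4 * (20 * D ^ 6 * pairing_kernel (x / \<epsilon>) (y / \<epsilon>) (z / \<epsilon>) (w / \<epsilon>))"
    unfolding eq integral_mult_right_zero abs_mult[of "\<phi> x * \<phi> y * \<phi> z * \<phi> w"] power4_eq_xxxx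
    using \<xi>_fourth_moment(2) b_nonneg by (intro mult_mono) auto
qed

lemma pairing_kernel_le: "pairing_kernel x y z w \<le> 7"
proof -
  have "decay_kernel \<beta> s * decay_kernel \<beta> t \<le> 1" for s t
    using decay_kernel_le_1[of \<beta>] \<beta> mult_mono[of "decay_kernel \<beta> s" 1 "decay_kernel \<beta> t" 1] by simp
  note this[of "x - y" "z - w"] this[of "x - z" "y - w"] this[of "x - w" "y - z"] this[of "x - z" "x - w"]
    this[of "y - z" "y - w"] this[of "x - z" "z - w"] this[of "x - w" "z - w"]
  then show ?thesis unfolding pairing_kernel_def by linarith
qed

lemma pairing_kernel_nonneg: "0 \<le> pairing_kernel x y z w"
  unfolding pairing_kernel_def by (intro add_nonneg_nonneg mult_nonneg_nonneg decay_kernel_nonneg)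

lemma pairing_kernel_integral:
  "(LINT q|((\<U> \<Otimes>\<^sub>M \<U>) \<Otimes>\<^sub>M (\<U> \<Otimes>\<^sub>M \<U>)).
      pairing_kernel (fst (fst q) / \<epsilon>) (snd (fst q) / \<epsilon>) (fst (snd q) / \<epsilon>) (snd (snd q) / \<epsilon>))
    \<le> 7 * (\<epsilon> * (LINT t|lborel. decay_kernel \<beta> t))\<^sup>2" (is "(LINT q|_. ?k q) \<le> 7 * ?S\<^sup>2")
  and pairing_kernel_integrable: "integrable ((\<U> \<Otimes>\<^sub>M \<U>) \<Otimes>\<^sub>M (\<U> \<Otimes>\<^sub>M \<U>))
      (\<lambda>q. pairing_kernel (fst (fst q) / \<epsilon>) (snd (fst q) / \<epsilon>) (fst (snd q) / \<epsilon>) (snd (snd q) / \<epsilon>))"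
proof -
  interpret Q: finite_measure "(\<U> \<Otimes>\<^sub>M \<U>) \<Otimes>\<^sub>M (\<U> \<Otimes>\<^sub>M \<U>)"
    by (rule finite_measure_pair_measure) unfold_locales
  have [measurable]: "?k \<in> borel_measurable ((\<U> \<Otimes>\<^sub>M \<U>) \<Otimes>\<^sub>M (\<U> \<Otimes>\<^sub>M \<U>))"
  proof -
    have fs: "fst \<in> borel_measurable (\<U> \<Otimes>\<^sub>M \<U>)" "snd \<in> borel_measurable (\<U> \<Otimes>\<^sub>M \<U>)"
      by (auto intro!: measurable_compose[OF measurable_fst] measurable_compose[OF measurable_snd])
    have [measurable]: "(\<lambda>q. fst (fst q)) \<in> borel_measurable ((\<U> \<Otimes>\<^sub>M \<U>) \<Otimes>\<^sub>M (\<U> \<Otimes>\<^sub>M \<U>))"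
      "(\<lambda>q. snd (fst q)) \<in> borel_measurable ((\<U> \<Otimes>\<^sub>M \<U>) \<Otimes>\<^sub>M (\<U> \<Otimes>\<^sub>M \<U>))"
      "(\<lambda>q. fst (snd q)) \<in> borel_measurable ((\<U> \<Otimes>\<^sub>M \<U>) \<Otimes>\<^sub>M (\<U> \<Otimes>\<^sub>M \<U>))"
      "(\<lambda>q. snd (snd q)) \<in> borel_measurable ((\<U> \<Otimes>\<^sub>M \<U>) \<Otimes>\<^sub>M (\<U> \<Otimes>\<^sub>M \<U>))"
      by (rule measurable_compose[OF measurable_fst fs(1)] measurable_compose[OF measurable_fst fs(2)]
        measurable_compose[OF measurable_snd fs(1)] measurable_compose[OF measurable_snd fs(2)])+
    show ?thesis unfolding pairing_kernel_def by measurable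
  qed
  show int: "integrable ((\<U> \<Otimes>\<^sub>M \<U>) \<Otimes>\<^sub>M (\<U> \<Otimes>\<^sub>M \<U>)) ?k"
    by (intro Q.integrable_const_bound[where B = 7] AE_I2) (use pairing_kernel_le pairing_kernel_nonneg in auto)
  have S: "0 \<le> ?S" using \<epsilon> by simp
  have "ennreal (LINT q|((\<U> \<Otimes>\<^sub>M \<U>) \<Otimes>\<^sub>M (\<U> \<Otimes>\<^sub>M \<U>)). ?k q) = (\<integral>\<^sup>+q. ennreal (?k q) \<partial>((\<U> \<Otimes>\<^sub>M \<U>) \<Otimes>\<^sub>M (\<U> \<Otimes>\<^sub>M \<U>)))"
    by (rule nn_integral_eq_integral[symmetric, OF int]) (use pairing_kernel_nonneg in auto)
  also have "\<dots> = (\<integral>\<^sup>+p. \<integral>\<^sup>+q. ennreal (?k (p, q)) \<partial>(\<U> \<Otimes>\<^sub>M \<U>) \<partial>(\<U> \<Otimes>\<^sub>M \<U>))"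
    by (rule UU.nn_integral_fst[symmetric]) measurable
  also have "\<dots> \<le> 7 * (ennreal ?S)\<^sup>2"
    by (rule order_trans[OF _ nn_integral_decay_kernel_chain[OF \<beta>(1) \<epsilon>]])
       (simp add: pairing_kernel_def ennreal_mult diff_divide_distrib)
  also have "\<dots> = ennreal (7 * ?S\<^sup>2)"
    using S by (simp add: ennreal_mult ennreal_power)
  finally show "(LINT q|((\<U> \<Otimes>\<^sub>M \<U>) \<Otimes>\<^sub>M (\<U> \<Otimes>\<^sub>M \<U>)). ?k q) \<le> 7 * ?S\<^sup>2"
    by (simp add: ennreal_le_iff)
qed

text \<open>The order \<open>\<epsilon>\<^sup>2\<close> is that of the square of the variance, as for a sum of about \<open>1 / \<epsilon>\<close> weakly
  dependent terms.\<close>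

lemma fluct_fourth_moment:
  shows "integrable M (\<lambda>\<omega>. (fluct \<phi> \<epsilon> \<omega>) ^ 4)"
    and "expectation (\<lambda>\<omega>. (fluct \<phi> \<epsilon> \<omega>) ^ 4) \<le> 140 * D ^ 6 * (LINT t|lborel. decay_kernel \<beta> t)\<^sup>2 * b ^ 4 * \<epsilon>\<^sup>2"
proof -
  define F where "F = (\<lambda>p \<omega>. \<phi> (fst p) * \<xi> (fst p / \<epsilon>) \<omega> * (\<phi> (snd p) * \<xi> (snd p / \<epsilon>) \<omega>))"
  define c where "c = b ^ 4 * (20 * D ^ 6)"
  have c: "0 \<le> c" using D_ge_1 b_nonneg by (simp add: c_def)
  have fm: "finite_measure (\<U> \<Otimes>\<^sub>M \<U>)" by unfold_locales
  have [measurable]: "case_prod F \<in> borel_measurable ((\<U> \<Otimes>\<^sub>M \<U>) \<Otimes>\<^sub>M M)"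
  proof -
    have 1: "(\<lambda>q. (fst (fst q), snd q)) \<in> (\<U> \<Otimes>\<^sub>M \<U>) \<Otimes>\<^sub>M M \<rightarrow>\<^sub>M \<U> \<Otimes>\<^sub>M M"
      "(\<lambda>q. (snd (fst q), snd q)) \<in> (\<U> \<Otimes>\<^sub>M \<U>) \<Otimes>\<^sub>M M \<rightarrow>\<^sub>M \<U> \<Otimes>\<^sub>M M" by measurable
    from measurable_compose[OF 1(1) weighted_\<xi>_measurable] measurable_compose[OF 1(2) weighted_\<xi>_measurable]
    show ?thesis unfolding F_def case_prod_beta
      by (intro borel_measurable_times[of "\<lambda>q. \<phi> (fst (fst q)) * \<xi> (fst (fst q) / \<epsilon>) (snd q)"]) simp_all
  qed
  have iF: "integrable (\<U> \<Otimes>\<^sub>M \<U>) (\<lambda>p. F p \<omega>)" and F: "(LINT p|(\<U> \<Otimes>\<^sub>M \<U>). F p \<omega>) = (fluct \<phi> \<epsilon> \<omega>)\<^sup>2"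
    if "\<omega> \<in> space M" for \<omega>
  proof -
    show "integrable (\<U> \<Otimes>\<^sub>M \<U>) (\<lambda>p. F p \<omega>)"
      unfolding F_def by (rule weighted_\<xi>_moments(4)) (use that in auto)
    show "(LINT p|(\<U> \<Otimes>\<^sub>M \<U>). F p \<omega>) = (fluct \<phi> \<epsilon> \<omega>)\<^sup>2"
      unfolding F_def fluct_def by (rule weighted_\<xi>_moments(5)) (use that in auto)
  qed
  have FF: "integrable M (\<lambda>\<omega>. F p \<omega> * F q \<omega>)"
    "\<bar>expectation (\<lambda>\<omega>. F p \<omega> * F q \<omega>)\<bar> \<le> c * pairing_kernel (fst p / \<epsilon>) (snd p / \<epsilon>) (fst q / \<epsilon>) (snd q / \<epsilon>)"
    if "p \<in> space (\<U> \<Otimes>\<^sub>M \<U>)" "q \<in> space (\<U> \<Otimes>\<^sub>M \<U>)" for p q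
    using weighted_\<xi>_fourth_moment[of "fst p" "snd p" "fst q" "snd q"] that
    by (auto simp: F_def space_pair_measure c_def mult_ac)
  have FF2: "integrable M (\<lambda>\<omega>. (F p \<omega>)\<^sup>2)" "expectation (\<lambda>\<omega>. (F p \<omega>)\<^sup>2) \<le> c * 7"
    if "p \<in> space (\<U> \<Otimes>\<^sub>M \<U>)" for p
  proof -
    show "integrable M (\<lambda>\<omega>. (F p \<omega>)\<^sup>2)"
      unfolding power2_eq_square by (rule FF(1)[OF that that])
    have "expectation (\<lambda>\<omega>. (F p \<omega>)\<^sup>2) \<le> \<bar>expectation (\<lambda>\<omega>. F p \<omega> * F p \<omega>)\<bar>"
      unfolding power2_eq_square by (rule abs_ge_self)
    also note FF(2)[OF that that]
    also have "c * pairing_kernel (fst p / \<epsilon>) (snd p / \<epsilon>) (fst p / \<epsilon>) (snd p / \<epsilon>) \<le> c * 7"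
      by (rule mult_left_mono[OF pairing_kernel_le c])
    finally show "expectation (\<lambda>\<omega>. (F p \<omega>)\<^sup>2) \<le> c * 7" .
  qed
  have sm1: "integrable M (\<lambda>\<omega>. (LINT p|(\<U> \<Otimes>\<^sub>M \<U>). F p \<omega>)\<^sup>2)"
    and sm2: "expectation (\<lambda>\<omega>. (LINT p|(\<U> \<Otimes>\<^sub>M \<U>). F p \<omega>)\<^sup>2) =
      (LINT q|((\<U> \<Otimes>\<^sub>M \<U>) \<Otimes>\<^sub>M (\<U> \<Otimes>\<^sub>M \<U>)). expectation (\<lambda>\<omega>. F (fst q) \<omega> * F (snd q) \<omega>))"
    and sm3: "integrable ((\<U> \<Otimes>\<^sub>M \<U>) \<Otimes>\<^sub>M (\<U> \<Otimes>\<^sub>M \<U>)) (\<lambda>q. expectation (\<lambda>\<omega>. F (fst q) \<omega> * F (snd q) \<omega>))"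
    using second_moment_of_integral(1-3)[OF fm \<open>case_prod F \<in> _\<close> iF FF2] by auto
  show "integrable M (\<lambda>\<omega>. (fluct \<phi> \<epsilon> \<omega>) ^ 4)"
    using sm1 by (simp add: F cong: Bochner_Integration.integrable_cong)
  have "expectation (\<lambda>\<omega>. (fluct \<phi> \<epsilon> \<omega>) ^ 4) = expectation (\<lambda>\<omega>. (LINT p|(\<U> \<Otimes>\<^sub>M \<U>). F p \<omega>)\<^sup>2)"
    by (rule Bochner_Integration.integral_cong) (simp_all add: F)
  also have "\<dots> \<le> (LINT q|((\<U> \<Otimes>\<^sub>M \<U>) \<Otimes>\<^sub>M (\<U> \<Otimes>\<^sub>M \<U>)).
      c * pairing_kernel (fst (fst q) / \<epsilon>) (snd (fst q) / \<epsilon>) (fst (snd q) / \<epsilon>) (snd (snd q) / \<epsilon>))"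
    unfolding sm2
  proof (rule integral_mono[OF sm3])
    fix q assume "q \<in> space ((\<U> \<Otimes>\<^sub>M \<U>) \<Otimes>\<^sub>M (\<U> \<Otimes>\<^sub>M \<U>))"
    then have "fst q \<in> space (\<U> \<Otimes>\<^sub>M \<U>)" "snd q \<in> space (\<U> \<Otimes>\<^sub>M \<U>)"
      by (auto simp: space_pair_measure)
    from FF(2)[OF this] show "expectation (\<lambda>\<omega>. F (fst q) \<omega> * F (snd q) \<omega>)
      \<le> c * pairing_kernel (fst (fst q) / \<epsilon>) (snd (fst q) / \<epsilon>) (fst (snd q) / \<epsilon>) (snd (snd q) / \<epsilon>)"
      by linarith
  qed (intro integrable_mult_right pairing_kernel_integrable)
  also have "\<dots> \<le> c * (7 * (\<epsilon> * (LINT t|lborel. decay_kernel \<beta> t))\<^sup>2)"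
    using mult_left_mono[OF pairing_kernel_integral c] by simp
  finally show "expectation (\<lambda>\<omega>. (fluct \<phi> \<epsilon> \<omega>) ^ 4) \<le> 140 * D ^ 6 * (LINT t|lborel. decay_kernel \<beta> t)\<^sup>2 * b ^ 4 * \<epsilon>\<^sup>2"
    by (simp add: c_def power_mult_distrib mult_ac)
qed

end

end

section \<open>The limit of the rescaled covariance form\<close>

lemma integral_unit_interval_measure:
  "(LINT x|\<U>. f x) = (LINT x:{0..1}|lborel. f x :: real)"
  unfolding unit_interval_measure_def set_lebesgue_integral_def
  by (rule integral_restrict_space) simp

lemma integral_indicator_unit_interval_measure_le:
  assumes "0 \<le> a" shows "(LINT x|\<U>. indicator {c..c + a} x) \<le> (a :: real)"
proof -
  have "(LINT x|\<U>. indicator {c..c + a} x) = (LINT x|lborel. indicator {0..1} x * indicator {c..c + a} x :: real)"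
    unfolding integral_unit_interval_measure set_lebesgue_integral_def by simp
  also have "\<dots> \<le> (LINT x|lborel. indicator {c..c + a} x)"
    by (intro integral_mono integrable_real_indicator
         Bochner_Integration.integrable_bound[OF integrable_real_indicator[of "{c..c + a}" lborel]])
       (use assms in \<open>auto simp: indicator_def emeasure_lborel_Icc_eq\<close>)
  also have "\<dots> = a" using assms by simp
  finally show ?thesis .
qed

text \<open>Substituting \<open>y = x - \<epsilon> * t\<close> turns the double integral into an average of
  \<open>h x * h (x - \<epsilon> * t)\<close> against \<open>R\<close>, with \<open>h\<close> extended by zero. Replacing the shifted value by \<open>h x\<close>
  costs, after integration in \<open>x\<close>, a multiple of \<open>min 1 \<bar>\<epsilon> * t\<bar>\<close>: the Lipschitz bound accounts for
  the interior and the length of the boundary layer for the jump of the extension. The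
  pointwise error near the end points is not small, so the integration in \<open>x\<close> has to come first.\<close>

lemma covariance_integral_asymptotics:
  fixes R h :: "real \<Rightarrow> real"
  assumes \<beta>: "1 < \<beta>" "\<beta> < 2" and \<epsilon>: "0 < \<epsilon>"
    and [measurable]: "R \<in> borel_measurable borel" and R: "\<And>t. \<bar>R t\<bar> \<le> D * decay_kernel \<beta> t"
    and [measurable]: "h \<in> borel_measurable \<U>"
    and hb: "\<And>x. x \<in> {0..1} \<Longrightarrow> \<bar>h x\<bar> \<le> b" 
    and hL: "\<And>x y. x \<in> {0..1} \<Longrightarrow> y \<in> {0..1} \<Longrightarrow> \<bar>h x - h y\<bar> \<le> L * \<bar>x - y\<bar>"
    and int: "integrable (\<U> \<Otimes>\<^sub>M \<U>) (\<lambda>p. h (fst p) * h (snd p) * R ((fst p - snd p) / \<epsilon>))"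
  shows "\<bar>(LINT p|(\<U> \<Otimes>\<^sub>M \<U>). h (fst p) * h (snd p) * R ((fst p - snd p) / \<epsilon>)) / \<epsilon>
      - (LINT t|lborel. R t) * (LINT x|\<U>. (h x)\<^sup>2)\<bar>
    \<le> b * (L + 2 * b) * D * (LINT s|lborel. \<bar>s\<bar> powr (- \<beta>) * min 1 \<bar>s\<bar>) * \<epsilon> powr (\<beta> - 1)"
proof -
  interpret UL: pair_sigma_finite \<U> lborel ..
  define k where "k = (\<lambda>y. indicator {0..1} y * h y)"
  have k_in: "k y = h y" if "y \<in> {0..1}" for y using that by (simp add: k_def)
  have k_out: "k y = 0" if "y \<notin> {0..1}" for y using that by (simp add: k_def)
  have b0: "0 \<le> b" and L0: "0 \<le> L"
    using hb[of 0] hL[of 0 1] by auto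
  have kb: "\<bar>k y\<bar> \<le> b" for y using hb[of y] b0 by (cases "y \<in> {0..1}") (auto simp: k_in k_out)
  have k_borel [measurable]: "k \<in> borel_measurable borel"
  proof -
    have "h \<in> borel_measurable (restrict_space borel {0..1})"
      using \<open>h \<in> borel_measurable \<U>\<close> by (simp add: measurable_cong_sets[OF sets_unit_interval_measure refl])
    then show ?thesis
      by (simp add: k_def borel_measurable_restrict_space_iff mult.commute)
  qed
  have D0: "0 \<le> D" using R[of 0] by (simp add: decay_kernel_def)
  have iR: "integrable lborel R"
    by (rule Bochner_Integration.integrable_bound[OF integrable_mult_right[of D, OF integrable_decay_kernel[OF \<beta>(1)]]])
       (use R D0 in \<open>auto simp: abs_mult\<close>)
  have shift: "(LINT y|\<U>. h x * h y * R ((x - y) / \<epsilon>)) / \<epsilon> = (LINT t|lborel. h x * k (x - \<epsilon> * t) * R t)" for x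
  proof -
    have "(LINT y|\<U>. h x * h y * R ((x - y) / \<epsilon>)) = (LINT y|lborel. h x * k y * R ((x - y) / \<epsilon>))"
      unfolding integral_unit_interval_measure set_lebesgue_integral_def
      by (intro Bochner_Integration.integral_cong) (auto simp: k_def)
    also have "\<dots> = \<epsilon> * (LINT t|lborel. h x * k (x - \<epsilon> * t) * R t)"
      using lborel_integral_real_affine[of "- \<epsilon>" "\<lambda>y. h x * k y * R ((x - y) / \<epsilon>)" x] \<epsilon> by simp
    finally show ?thesis using \<epsilon> by simp
  qed
  define \<Phi> where "\<Phi> = (\<lambda>x t. h x * (k (x - \<epsilon> * t) - h x) * R t)"
  have id_meas [measurable]: "(\<lambda>x. x) \<in> borel_measurable \<U>" by simp
  have fst_meas [measurable]: "fst \<in> borel_measurable (\<U> \<Otimes>\<^sub>M lborel)"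
    by (rule measurable_compose[OF measurable_fst id_meas])
  have \<Phi>_meas [measurable]: "case_prod \<Phi> \<in> borel_measurable (\<U> \<Otimes>\<^sub>M lborel)"
    unfolding \<Phi>_def case_prod_beta by measurable
  have R2: "integrable (\<U> \<Otimes>\<^sub>M lborel) (\<lambda>p. 2 * b\<^sup>2 * R (snd p))"
  proof -
    have "integrable (\<U> \<Otimes>\<^sub>M lborel) (\<lambda>(x, t). R t)"
      by (rule UL.Fubini_integrable) (use iR in \<open>auto\<close>)
    then show ?thesis by (simp add: case_prod_beta')
  qed
  have pt: "\<bar>h x * (k y - h x)\<bar> \<le> 2 * b\<^sup>2" if "x \<in> {0..1}" for x y
  proof -
    have "\<bar>k y - h x\<bar> \<le> 2 * b" using kb[of y] hb[OF that] by linarith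
    then have "\<bar>h x\<bar> * \<bar>k y - h x\<bar> \<le> b * (2 * b)" using hb[OF that] b0 by (intro mult_mono) auto
    then show ?thesis by (simp add: abs_mult power2_eq_square)
  qed
  have i\<Phi>: "integrable (\<U> \<Otimes>\<^sub>M lborel) (case_prod \<Phi>)"
  proof (rule Bochner_Integration.integrable_bound[OF R2 \<Phi>_meas])
    show "AE p in \<U> \<Otimes>\<^sub>M lborel. norm (case_prod \<Phi> p) \<le> norm (2 * b\<^sup>2 * R (snd p))"
      by (intro AE_I2) (auto simp: \<Phi>_def space_pair_measure abs_mult[of _ "R _"] intro!: mult_right_mono pt)
  qed
  have split: "(LINT t|lborel. h x * k (x - \<epsilon> * t) * R t) = (LINT t|lborel. \<Phi> x t) + (h x)\<^sup>2 * (LINT t|lborel. R t)" for x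
  proof -
    have i1: "integrable lborel (\<lambda>t. k (x - \<epsilon> * t) * R t)"
      by (rule Bochner_Integration.integrable_bound[OF integrable_mult_right[of b, OF iR]])
         (auto simp: abs_mult intro!: mult_mono order_trans[OF kb] b0)
    have "(LINT t|lborel. \<Phi> x t) = (LINT t|lborel. h x * (k (x - \<epsilon> * t) * R t) - (h x)\<^sup>2 * R t)"
      by (simp add: \<Phi>_def algebra_simps power2_eq_square)
    also have "\<dots> = (LINT t|lborel. h x * (k (x - \<epsilon> * t) * R t)) - (h x)\<^sup>2 * (LINT t|lborel. R t)"
      using i1 iR by simp
    finally show ?thesis by (simp add: mult.assoc)
  qed
  have ih2: "integrable \<U> (\<lambda>x. (h x)\<^sup>2)"
  proof (rule U.integrable_const_bound[where B = "b\<^sup>2"])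
    show "AE x in \<U>. norm ((h x)\<^sup>2) \<le> b\<^sup>2"
      by (intro AE_I2) (use hb in \<open>auto intro!: abs_le_square_iff[THEN iffD1] simp: b0\<close>)
  qed measurable
  have "(LINT p|(\<U> \<Otimes>\<^sub>M \<U>). h (fst p) * h (snd p) * R ((fst p - snd p) / \<epsilon>)) / \<epsilon>
      = (LINT x|\<U>. (LINT y|\<U>. h x * h y * R ((x - y) / \<epsilon>)) / \<epsilon>)"
    using UU.integral_fst'[OF int] by simp
  also have "\<dots> = (LINT x|\<U>. (LINT t|lborel. \<Phi> x t) + (h x)\<^sup>2 * (LINT t|lborel. R t))"
    by (simp add: shift split)
  also have "\<dots> = (LINT x|\<U>. LINT t|lborel. \<Phi> x t) + (LINT x|\<U>. (h x)\<^sup>2) * (LINT t|lborel. R t)"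
    using UL.integrable_fst[OF i\<Phi>] ih2 by simp
  also have "(LINT x|\<U>. LINT t|lborel. \<Phi> x t) = (LINT t|lborel. LINT x|\<U>. \<Phi> x t)"
    by (rule UL.Fubini_integral[OF i\<Phi>, symmetric])
  finally have eq: "(LINT p|(\<U> \<Otimes>\<^sub>M \<U>). h (fst p) * h (snd p) * R ((fst p - snd p) / \<epsilon>)) / \<epsilon>
      - (LINT t|lborel. R t) * (LINT x|\<U>. (h x)\<^sup>2) = (LINT t|lborel. LINT x|\<U>. \<Phi> x t)" by simp
  \<comment> \<open>only points within distance \<open>\<bar>s\<bar>\<close> of the end points are shifted out of the interval\<close>
  have sh: "(LINT x|\<U>. \<bar>k (x - s) - h x\<bar>) \<le> (L + 2 * b) * min 1 \<bar>s\<bar>"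
    and shi: "integrable \<U> (\<lambda>x. \<bar>k (x - s) - h x\<bar>)" for s
  proof -
    have [measurable]: "(\<lambda>x. k (x - s)) \<in> borel_measurable \<U>" by measurable
    have two: "\<bar>k (x - s) - h x\<bar> \<le> 2 * b" if "x \<in> {0..1}" for x
      using kb[of "x - s"] hb[OF that] by linarith
    show i: "integrable \<U> (\<lambda>x. \<bar>k (x - s) - h x\<bar>)"
      by (rule U.integrable_const_bound[where B = "2 * b"]) (auto intro!: AE_I2 two)
    have "(LINT x|\<U>. \<bar>k (x - s) - h x\<bar>) \<le> (LINT x|\<U>. 2 * b)"
      by (intro integral_mono i) (auto intro!: two)
    then have A: "(LINT x|\<U>. \<bar>k (x - s) - h x\<bar>) \<le> 2 * b" by (simp add: U.prob_space[simplified])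
    let ?g = "\<lambda>x. L * \<bar>s\<bar> + b * (indicator {0..0 + \<bar>s\<bar>} x + indicator {1 - \<bar>s\<bar>..1 - \<bar>s\<bar> + \<bar>s\<bar>} x)"
    have ii: "integrable \<U> (indicator {c..d} :: real \<Rightarrow> real)" for c d
      by (rule U.integrable_const_bound[where B = 1]) auto
    have "\<bar>k (x - s) - h x\<bar> \<le> ?g x" if x: "x \<in> {0..1}" for x
    proof (cases "x - s \<in> {0..1}")
      case True
      have "\<bar>h (x - s) - h x\<bar> \<le> L * \<bar>s\<bar>" using hL[OF True x] by simp
      moreover have "0 \<le> b * (indicator {0..0 + \<bar>s\<bar>} x + indicator {1 - \<bar>s\<bar>..1 - \<bar>s\<bar> + \<bar>s\<bar>} x)"
        using b0 by simp
      ultimately show ?thesis using True by (simp only: k_in)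
    next
      case False
      then have "1 \<le> indicator {0..0 + \<bar>s\<bar>} x + (indicator {1 - \<bar>s\<bar>..1 - \<bar>s\<bar> + \<bar>s\<bar>} x :: real)"
        using x by (auto simp: indicator_def)
      then have "b * 1 \<le> b * (indicator {0..0 + \<bar>s\<bar>} x + indicator {1 - \<bar>s\<bar>..1 - \<bar>s\<bar> + \<bar>s\<bar>} x)"
        using b0 by (intro mult_left_mono)
      moreover have "\<bar>k (x - s) - h x\<bar> \<le> b" using hb[OF x] False by (simp add: k_out)
      moreover have "0 \<le> L * \<bar>s\<bar>" using L0 by simp
      ultimately show ?thesis by linarith
    qed
    then have "(LINT x|\<U>. \<bar>k (x - s) - h x\<bar>) \<le> (LINT x|\<U>. ?g x)"
      by (intro integral_mono i) (auto intro!: Bochner_Integration.integrable_add integrable_mult_right ii)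
    also have "\<dots> = L * \<bar>s\<bar> + b * ((LINT x|\<U>. indicator {0..0 + \<bar>s\<bar>} x) + (LINT x|\<U>. indicator {1 - \<bar>s\<bar>..1 - \<bar>s\<bar> + \<bar>s\<bar>} x))"
      using ii[of 0 "0 + \<bar>s\<bar>"] ii[of "1 - \<bar>s\<bar>" "1 - \<bar>s\<bar> + \<bar>s\<bar>"] by (simp add: U.prob_space[simplified])
    also have "\<dots> \<le> L * \<bar>s\<bar> + b * (\<bar>s\<bar> + \<bar>s\<bar>)"
      by (intro add_left_mono mult_left_mono add_mono integral_indicator_unit_interval_measure_le b0) auto
    finally have B: "(LINT x|\<U>. \<bar>k (x - s) - h x\<bar>) \<le> (L + 2 * b) * \<bar>s\<bar>" by (simp add: algebra_simps)
    show "(LINT x|\<U>. \<bar>k (x - s) - h x\<bar>) \<le> (L + 2 * b) * min 1 \<bar>s\<bar>"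
      using A B L0 b0 by (auto simp: min_def)
  qed
  have inner: "\<bar>LINT x|\<U>. \<Phi> x t\<bar> \<le> b * (L + 2 * b) * D * (decay_kernel \<beta> t * min 1 (\<epsilon> * \<bar>t\<bar>))" for t
  proof -
    have [measurable]: "(\<lambda>x. \<Phi> x t) \<in> borel_measurable \<U>" unfolding \<Phi>_def by measurable
    have le: "\<bar>\<Phi> x t\<bar> \<le> b * \<bar>R t\<bar> * \<bar>k (x - \<epsilon> * t) - h x\<bar>" if "x \<in> {0..1}" for x
    proof -
      have "\<bar>h x\<bar> * (\<bar>R t\<bar> * \<bar>k (x - \<epsilon> * t) - h x\<bar>) \<le> b * (\<bar>R t\<bar> * \<bar>k (x - \<epsilon> * t) - h x\<bar>)"
        using hb[OF that] by (intro mult_right_mono) auto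
      then show ?thesis by (simp add: \<Phi>_def abs_mult mult_ac)
    qed
    have i: "integrable \<U> (\<lambda>x. b * \<bar>R t\<bar> * \<bar>k (x - \<epsilon> * t) - h x\<bar>)"
      by (intro integrable_mult_right shi)
    have i\<Phi>t: "integrable \<U> (\<lambda>x. \<Phi> x t)"
      by (rule Bochner_Integration.integrable_bound[OF i]) (auto intro!: AE_I2 order_trans[OF le] simp: b0)
    have "\<bar>LINT x|\<U>. \<Phi> x t\<bar> \<le> (LINT x|\<U>. \<bar>\<Phi> x t\<bar>)" by (rule integral_abs_bound)
    also have "\<dots> \<le> (LINT x|\<U>. b * \<bar>R t\<bar> * \<bar>k (x - \<epsilon> * t) - h x\<bar>)"
      by (intro integral_mono integrable_abs i\<Phi>t i) (auto intro: le)
    also have "\<dots> = b * \<bar>R t\<bar> * (LINT x|\<U>. \<bar>k (x - \<epsilon> * t) - h x\<bar>)" by simp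
    also have "\<dots> \<le> b * (D * decay_kernel \<beta> t) * ((L + 2 * b) * min 1 \<bar>\<epsilon> * t\<bar>)"
      by (intro mult_mono sh R order_refl mult_nonneg_nonneg b0 D0 decay_kernel_nonneg) auto
    finally show ?thesis using \<epsilon> by (simp add: abs_mult mult_ac)
  qed
  note tm = decay_kernel_truncated_moment[OF \<beta> \<epsilon>]
  have c0: "0 \<le> b * (L + 2 * b) * D" using b0 L0 D0 by simp
  have "\<bar>LINT t|lborel. LINT x|\<U>. \<Phi> x t\<bar> \<le> (LINT t|lborel. \<bar>LINT x|\<U>. \<Phi> x t\<bar>)"
    by (rule integral_abs_bound)
  also have "\<dots> \<le> (LINT t|lborel. b * (L + 2 * b) * D * (decay_kernel \<beta> t * min 1 (\<epsilon> * \<bar>t\<bar>)))"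
    using UL.integrable_snd[OF i\<Phi>] by (intro integral_mono inner integrable_mult_right tm) auto
  also have "\<dots> = b * (L + 2 * b) * D * (LINT t|lborel. decay_kernel \<beta> t * min 1 (\<epsilon> * \<bar>t\<bar>))" by simp
  also have "\<dots> \<le> b * (L + 2 * b) * D * (\<epsilon> powr (\<beta> - 1) * (LINT s|lborel. \<bar>s\<bar> powr (- \<beta>) * min 1 \<bar>s\<bar>))"
    by (intro mult_left_mono tm c0)
  finally show ?thesis unfolding eq by (simp add: mult_ac)
qed

section \<open>Functions on the unit interval and the solution formula\<close>

lemma continuous_unit_interval:
  fixes \<phi> :: "real \<Rightarrow> real"
  assumes "continuous_on {0..1} \<phi>"
  shows "\<phi> \<in> borel_measurable \<U>" "integrable \<U> \<phi>"
    and "\<exists>b. \<forall>x\<in>{0..1}. \<bar>\<phi> x\<bar> \<le> b"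
proof -
  show 1: "\<phi> \<in> borel_measurable \<U>"
    using borel_measurable_continuous_on_restrict[OF assms]
    by (simp add: measurable_cong_sets[OF sets_unit_interval_measure refl])
  have "bounded (\<phi> ` {0..1})"
    by (intro compact_imp_bounded compact_continuous_image assms) simp
  then show ex: "\<exists>b. \<forall>x\<in>{0..1}. \<bar>\<phi> x\<bar> \<le> b" by (auto simp: bounded_iff)
  then obtain b where "\<forall>x\<in>{0..1}. \<bar>\<phi> x\<bar> \<le> b" by blast
  with 1 show "integrable \<U> \<phi>"
    by (intro U.integrable_const_bound[where B = b] AE_I2) auto
qed

lemma C1_01_continuous: "C1_01 f \<Longrightarrow> continuous_on {0..1} f"
  by (simp add: C1_01_def differentiable_imp_continuous_on)

lemma C1_01_has_vector_derivative:
  assumes "C1_01 f" "x \<in> {0..1}"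
  shows "(f has_vector_derivative deriv01 f x) (at x within {0..1})"
  using assms unfolding C1_01_def deriv01_def differentiable_on_def
  by (simp add: vector_derivative_works[symmetric])

lemma C1_01_has_real_derivative_interior:
  assumes "C1_01 f" "x \<in> {0<..<1}"
  shows "(f has_real_derivative deriv01 f x) (at x)"
proof -
  have "(f has_real_derivative deriv01 f x) (at x within {0..1})"
    using C1_01_has_vector_derivative[OF assms(1), of x] assms(2)
    by (simp add: has_real_derivative_iff_has_vector_derivative)
  moreover have "at x within {0..1} = at x"
    using assms(2) by (intro at_within_interior) (simp add: interior_atLeastAtMost_real)
  ultimately show ?thesis by simp
qed

lemma C1_01_integral_deriv:
  assumes "C1_01 f" shows "(LINT x|\<U>. deriv01 f x) = f 1 - f 0"
proof -
  have c: "continuous_on {0..1} (deriv01 f)" using assms by (simp add: C1_01_def)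
  have "(deriv01 f has_integral f 1 - f 0) {0..1}"
    by (rule fundamental_theorem_of_calculus) (use C1_01_has_vector_derivative[OF assms] in auto)
  moreover have "set_integrable lborel {0..1} (deriv01 f)"
    by (rule borel_integrable_atLeastAtMost'[OF c])
  ultimately have "(LINT x:{0..1}|lborel. deriv01 f x) = f 1 - f 0"
    by (simp add: set_borel_integral_eq_integral(2) integral_unique)
  then show ?thesis
    unfolding unit_interval_measure_def set_lebesgue_integral_def by (subst integral_restrict_space) auto
qed

lemma C1_01_lipschitz:
  assumes "C1_01 f"
  obtains L where "0 \<le> L" "\<And>x y. x \<in> {0..1} \<Longrightarrow> y \<in> {0..1} \<Longrightarrow> \<bar>f x - f y\<bar> \<le> L * \<bar>x - y\<bar>"
proof -
  obtain L where L: "\<forall>x\<in>{0..1}. \<bar>deriv01 f x\<bar> \<le> L"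
    using continuous_unit_interval(3)[of "deriv01 f"] assms by (auto simp: C1_01_def)
  show ?thesis
  proof (rule that[of L])
    show "0 \<le> L" using L[rule_format, of 0] by simp
    fix x y :: real assume "x \<in> {0..1}" "y \<in> {0..1}"
    then show "\<bar>f x - f y\<bar> \<le> L * \<bar>x - y\<bar>"
      using field_differentiable_bound[of "{0..1}" f "deriv01 f" L x y] L
        C1_01_has_vector_derivative[OF assms]
      by (simp add: has_real_derivative_iff_has_vector_derivative)
  qed
qed

lemma AE_unit_interval_interior: "AE x in \<U>. x \<in> {0<..<1}"
proof -
  have "AE x in lborel. x \<in> {0..1} \<longrightarrow> x \<in> {0<..<(1::real)}"
    using AE_lborel_singleton[of 0] AE_lborel_singleton[of 1] by eventually_elim auto
  then show ?thesis unfolding unit_interval_measure_def by (subst AE_restrict_space_iff) auto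
qed

text \<open>The flux minus the right-hand side is constant, and the constant is fixed by the boundary
  values through the vanishing integral of the derivative.\<close>

lemma dirichlet_solution_observable:
  assumes sol: "dirichlet_solution A f u" and f: "C1_01 f"
    and A: "continuous_on {0..1} A" "\<And>x. x \<in> {0..1} \<Longrightarrow> 0 < A x"
    and g: "continuous_on {0..1} g"
  shows "(LINT x|\<U>. deriv01 u x * g x) = (LINT x|\<U>. f x * g x / A x)
    - (LINT x|\<U>. f x / A x) * (LINT x|\<U>. g x / A x) / (LINT x|\<U>. 1 / A x)"
proof -
  have u: "C1_01 u" "u 0 = 0" "u 1 = 0"
    and eq: "\<And>x. x \<in> {0<..<1} \<Longrightarrow> ((\<lambda>y. A y * deriv01 u y) has_real_derivative deriv01 f x) (at x)"
    using sol by (auto simp: dirichlet_solution_def)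
  have "\<exists>c. \<forall>x\<in>{0<..<1}. A x * deriv01 u x - f x = c"
  proof (rule has_field_derivative_zero_constant)
    fix x :: real assume x: "x \<in> {0<..<1}"
    show "((\<lambda>x. A x * deriv01 u x - f x) has_real_derivative 0) (at x within {0<..<1})"
      using DERIV_diff[OF eq[OF x] C1_01_has_real_derivative_interior[OF f x]]
      by (auto intro: has_field_derivative_at_within)
  qed simp
  then obtain c where c: "\<And>x. x \<in> {0<..<1} \<Longrightarrow> A x * deriv01 u x - f x = c" by blast
  have ae: "AE x in \<U>. deriv01 u x = f x / A x + c * (1 / A x)"
    using AE_unit_interval_interior
  proof eventually_elim
    fix x :: real assume x: "x \<in> {0<..<1}"
    then show "deriv01 u x = f x / A x + c * (1 / A x)"
      using c[OF x] A(2)[of x] by (simp add: field_simps)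
  qed
  have A0: "\<forall>x\<in>{0..1}. A x \<noteq> 0" using A(2) by fastforce
  note fc = C1_01_continuous[OF f]
  have c1: "continuous_on {0..1} (\<lambda>x. f x / A x)" "continuous_on {0..1} (\<lambda>x. 1 / A x)"
    "continuous_on {0..1} (\<lambda>x. g x / A x)" "continuous_on {0..1} (\<lambda>x. f x * g x / A x)"
    using A0 by (auto intro!: continuous_intros fc A(1) g)
  note I = c1[THEN continuous_unit_interval(2)]
  have cd: "continuous_on {0..1} (deriv01 u)" using u(1) by (simp add: C1_01_def)
  note [measurable] = continuous_unit_interval(1)[OF cd] continuous_unit_interval(1)[OF g]
    c1[THEN continuous_unit_interval(1)]
  have "0 = (LINT x|\<U>. deriv01 u x)" using C1_01_integral_deriv[OF u(1)] u by simp
  also have "\<dots> = (LINT x|\<U>. f x / A x + c * (1 / A x))"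
    by (intro integral_cong_AE ae borel_measurable_add borel_measurable_times) measurable
  also have "\<dots> = (LINT x|\<U>. f x / A x) + c * (LINT x|\<U>. 1 / A x)"
    by (subst Bochner_Integration.integral_add[OF I(1) integrable_mult_right[OF I(2)]]) (simp only: integral_mult_right_zero)
  finally have z: "(LINT x|\<U>. f x / A x) + c * (LINT x|\<U>. 1 / A x) = 0" by simp
  have W: "0 < (LINT x|\<U>. 1 / A x)"
  proof -
    have "0 \<le> (LINT x|\<U>. 1 / A x)" by (rule Bochner_Integration.integral_nonneg) (use A(2) in \<open>simp add: less_imp_le\<close>)
    moreover have "(LINT x|\<U>. 1 / A x) \<noteq> 0"
    proof
      assume "(LINT x|\<U>. 1 / A x) = 0"
      then have "AE x in \<U>. 1 / A x = 0"
        by (subst (asm) integral_nonneg_eq_0_iff_AE[OF I(2)]) (auto intro!: AE_I2 less_imp_le A(2))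
      then have "AE x in \<U>. False" using AE_space by eventually_elim (use A0 in auto)
      then show False by simp
    qed
    ultimately show ?thesis by linarith
  qed
  have "(LINT x|\<U>. deriv01 u x * g x) = (LINT x|\<U>. f x * g x / A x + c * (g x / A x))"
  proof (rule integral_cong_AE)
    show "AE x in \<U>. deriv01 u x * g x = f x * g x / A x + c * (g x / A x)"
      using ae by eventually_elim (simp add: field_simps)
  qed measurable
  also have "\<dots> = (LINT x|\<U>. f x * g x / A x) + c * (LINT x|\<U>. g x / A x)"
    by (subst Bochner_Integration.integral_add[OF I(4) integrable_mult_right[OF I(3)]]) (simp only: integral_mult_right_zero)
  also have "c = - (LINT x|\<U>. f x / A x) / (LINT x|\<U>. 1 / A x)"
    using z W by (simp add: field_simps)
  finally show ?thesis by simp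
qed

section \<open>The variance of the observable\<close>

text \<open>The cross term is split by the weighted inequality \<open>2 \<bar>a v\<bar> \<le> \<delta> a\<^sup>2 + v\<^sup>2 / \<delta>\<close>, which leaves \<open>\<delta>\<close> to
  be balanced against the two second moments.\<close>

lemma (in prob_space) variance_perturbation:
  fixes A V :: "'a \<Rightarrow> real"
  assumes [measurable]: "A \<in> borel_measurable M" "V \<in> borel_measurable M"
    and A2: "integrable M (\<lambda>\<omega>. (A \<omega>)\<^sup>2)" and V2: "integrable M (\<lambda>\<omega>. (V \<omega>)\<^sup>2)"
    and A0: "expectation A = 0" and \<delta>: "0 < \<delta>"
  shows "\<bar>variance (\<lambda>\<omega>. k + A \<omega> - V \<omega>) - expectation (\<lambda>\<omega>. (A \<omega>)\<^sup>2)\<bar>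
    \<le> \<delta> * expectation (\<lambda>\<omega>. (A \<omega>)\<^sup>2) + (1 / \<delta> + 1) * expectation (\<lambda>\<omega>. (V \<omega>)\<^sup>2)"
proof -
  have A1: "integrable M A" and V1: "integrable M V"
    by (auto intro: square_integrable_imp_integrable A2 V2)
  have y: "\<bar>2 * a * v\<bar> \<le> \<delta> * a\<^sup>2 + (1 / \<delta>) * v\<^sup>2" for a v :: real
  proof -
    have "0 \<le> (\<delta> * \<bar>a\<bar> - \<bar>v\<bar>)\<^sup>2 / \<delta>" using \<delta> by simp
    also have "\<dots> = \<delta> * a\<^sup>2 + (1 / \<delta>) * v\<^sup>2 - \<bar>2 * a * v\<bar>"
      using \<delta> by (simp add: power2_diff abs_mult field_simps power2_eq_square)
    finally show ?thesis by simp
  qed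
  have AV: "integrable M (\<lambda>\<omega>. 2 * A \<omega> * V \<omega>)"
    by (rule Bochner_Integration.integrable_bound[where f = "\<lambda>\<omega>. \<delta> * (A \<omega>)\<^sup>2 + (1 / \<delta>) * (V \<omega>)\<^sup>2"])
       (use A2 V2 y in \<open>auto intro!: Bochner_Integration.integrable_add integrable_mult_right AE_I2 order_trans[OF _ abs_ge_self]\<close>)
  have "\<bar>expectation (\<lambda>\<omega>. 2 * A \<omega> * V \<omega>)\<bar> \<le> expectation (\<lambda>\<omega>. \<bar>2 * A \<omega> * V \<omega>\<bar>)"
    by (rule integral_abs_bound)
  also have "\<dots> \<le> expectation (\<lambda>\<omega>. \<delta> * (A \<omega>)\<^sup>2 + (1 / \<delta>) * (V \<omega>)\<^sup>2)"
    by (intro integral_mono integrable_abs AV y Bochner_Integration.integrable_add integrable_mult_right A2 V2)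
  also have "\<dots> = \<delta> * expectation (\<lambda>\<omega>. (A \<omega>)\<^sup>2) + (1 / \<delta>) * expectation (\<lambda>\<omega>. (V \<omega>)\<^sup>2)"
    by (subst Bochner_Integration.integral_add)
       (intro integrable_mult_right A2 V2, intro integrable_mult_right A2 V2, simp only: integral_mult_right_zero)
  finally have c: "\<bar>expectation (\<lambda>\<omega>. 2 * A \<omega> * V \<omega>)\<bar> \<le> \<dots>" .
  have mean: "expectation (\<lambda>\<omega>. k + A \<omega> - V \<omega>) = k - expectation V"
    using A1 V1 A0 by (simp add: prob_space)
  define v where "v = expectation V"
  have "variance (\<lambda>\<omega>. k + A \<omega> - V \<omega>) =
      expectation (\<lambda>\<omega>. (A \<omega>)\<^sup>2 - 2 * A \<omega> * V \<omega> + (V \<omega>)\<^sup>2 + 2 * v * A \<omega> - 2 * v * V \<omega> + v\<^sup>2)"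
    unfolding mean v_def[symmetric]
    by (intro Bochner_Integration.integral_cong refl) (simp add: power2_eq_square algebra_simps)
  also have "\<dots> = expectation (\<lambda>\<omega>. (A \<omega>)\<^sup>2) - expectation (\<lambda>\<omega>. 2 * A \<omega> * V \<omega>) + expectation (\<lambda>\<omega>. (V \<omega>)\<^sup>2)
      + 2 * v * expectation A - 2 * v * expectation V + v\<^sup>2"
    using A2 V2 AV A1 V1 by (simp add: prob_space)
  also have "\<dots> = expectation (\<lambda>\<omega>. (A \<omega>)\<^sup>2) - expectation (\<lambda>\<omega>. 2 * A \<omega> * V \<omega>) + (expectation (\<lambda>\<omega>. (V \<omega>)\<^sup>2) - v\<^sup>2)"
    by (simp add: A0 v_def[symmetric] power2_eq_square)
  finally have eq: "variance (\<lambda>\<omega>. k + A \<omega> - V \<omega>) - expectation (\<lambda>\<omega>. (A \<omega>)\<^sup>2) =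
    (expectation (\<lambda>\<omega>. (V \<omega>)\<^sup>2) - v\<^sup>2) - expectation (\<lambda>\<omega>. 2 * A \<omega> * V \<omega>)" by simp
  have "0 \<le> variance V" by simp
  also have "variance V = expectation (\<lambda>\<omega>. (V \<omega>)\<^sup>2) - v\<^sup>2"
    using variance_eq[OF V1 V2] by (simp add: v_def)
  finally show ?thesis unfolding eq using c zero_le_power2[of v] by (simp only: distrib_right)
qed

text \<open>If the denominator is at least 1/2 it is replaced by 1/2. Otherwise \<open>\<bar>a0\<bar> \<ge> 1/2\<close>, the ratio is
  bounded by \<open>p * q / 2\<close>, and a bounded quantity is dominated by a multiple of \<open>a0 ^ 4\<close>. Thus fourth
  moments suffice, and no negative moment of the denominator appears.\<close>

lemma squared_ratio_bound:
  fixes a0 a1 a2 p q :: real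
  assumes w: "0 \<le> 1 + a0" and a1: "\<bar>a1\<bar> \<le> p * (1 + a0)" and a2: "\<bar>a2\<bar> \<le> q * (1 + a0)" and "0 \<le> p" "0 \<le> q"
  shows "(a1 * a2 / (1 + a0))\<^sup>2 \<le> 2 * a1 ^ 4 + 2 * a2 ^ 4 + 4 * (p * q)\<^sup>2 * a0 ^ 4"
proof (cases "1 / 2 \<le> 1 + a0")
  case True
  have "\<bar>a1 * a2 / (1 + a0)\<bar> \<le> \<bar>a1 * a2\<bar> * 2"
    using True mult_left_mono[of 1 "2 * (1 + a0)" "\<bar>a1 * a2\<bar>"] by (simp add: field_simps)
  then have "(a1 * a2 / (1 + a0))\<^sup>2 \<le> (\<bar>a1 * a2\<bar> * 2)\<^sup>2"
    by (metis abs_ge_zero power2_abs power_mono)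
  also have "\<dots> = 2 * (2 * (a1\<^sup>2 * a2\<^sup>2))" by (simp add: power_mult_distrib)
  also have "2 * (a1\<^sup>2 * a2\<^sup>2) \<le> (a1\<^sup>2)\<^sup>2 + (a2\<^sup>2)\<^sup>2"
    using zero_le_power2[of "a1\<^sup>2 - a2\<^sup>2"] by (simp only: power2_diff)
  finally have "(a1 * a2 / (1 + a0))\<^sup>2 \<le> 2 * a1 ^ 4 + 2 * a2 ^ 4" by simp
  also have "\<dots> \<le> 2 * a1 ^ 4 + 2 * a2 ^ 4 + 4 * (p * q)\<^sup>2 * a0 ^ 4"
    by simp
  finally show ?thesis .
next
  case False
  have "\<bar>a1 * a2 / (1 + a0)\<bar> \<le> p * q * (1 + a0)"
  proof (cases "1 + a0 = 0")
    case False
    have "\<bar>a1\<bar> * \<bar>a2\<bar> \<le> (p * (1 + a0)) * (q * (1 + a0))" using assms by (intro mult_mono) auto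
    then show ?thesis using False w by (simp add: abs_mult field_simps)
  qed simp
  also have "\<dots> \<le> p * q * (1 / 2)" using False assms by (intro mult_left_mono) auto
  finally have "(a1 * a2 / (1 + a0))\<^sup>2 \<le> (p * q * (1 / 2))\<^sup>2"
    by (metis abs_ge_zero power2_abs power_mono)
  also have "\<dots> = 4 * (p * q)\<^sup>2 * (1 / 2) ^ 4" by (simp add: power_mult_distrib power_divide)
  also have "(1 / 2) ^ 4 \<le> \<bar>a0\<bar> ^ 4" using False by (intro power_mono) auto
  finally have "(a1 * a2 / (1 + a0))\<^sup>2 \<le> 4 * (p * q)\<^sup>2 * a0 ^ 4" by (simp add: mult_left_mono power_even_abs)
  moreover have "0 \<le> a1 ^ 4" "0 \<le> a2 ^ 4" by simp_all
  ultimately show ?thesis by linarith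
qed

text \<open>The left-hand side is the total mass of \<open>w\<close> times a covariance under the normalized weight \<open>w\<close>.\<close>

lemma covariance_form_centered:
  fixes \<mu> :: "real measure" and f g w :: "real \<Rightarrow> real"
  assumes "integrable \<mu> w" "integrable \<mu> (\<lambda>x. f x * w x)" "integrable \<mu> (\<lambda>x. g x * w x)"
    and "integrable \<mu> (\<lambda>x. f x * g x * w x)" and W: "(LINT x|\<mu>. w x) \<noteq> 0"
  shows "(LINT x|\<mu>. f x * g x * w x) - (LINT x|\<mu>. f x * w x) * (LINT x|\<mu>. g x * w x) / (LINT x|\<mu>. w x)
    = (LINT x|\<mu>. (f x - p) * (g x - q) * w x)
      - (LINT x|\<mu>. (f x - p) * w x) * (LINT x|\<mu>. (g x - q) * w x) / (LINT x|\<mu>. w x)"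
proof -
  have "(LINT x|\<mu>. (f x - p) * (g x - q) * w x) =
      (LINT x|\<mu>. f x * g x * w x - p * (g x * w x) - q * (f x * w x) + p * q * w x)"
    by (simp add: algebra_simps)
  also have "\<dots> = (LINT x|\<mu>. f x * g x * w x) - p * (LINT x|\<mu>. g x * w x) - q * (LINT x|\<mu>. f x * w x) + p * q * (LINT x|\<mu>. w x)"
    using assms by simp
  finally have 1: "(LINT x|\<mu>. (f x - p) * (g x - q) * w x) = \<dots>" .
  have 2: "(LINT x|\<mu>. (f x - p) * w x) = (LINT x|\<mu>. f x * w x) - p * (LINT x|\<mu>. w x)"
    "(LINT x|\<mu>. (g x - q) * w x) = (LINT x|\<mu>. g x * w x) - q * (LINT x|\<mu>. w x)"
    using assms by (simp_all add: left_diff_distrib)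
  show ?thesis unfolding 1 2 using W by (simp add: field_simps)
qed

context lognormal_field begin

lemma fluct_mean:
  assumes \<phi> [measurable]: "\<phi> \<in> borel_measurable \<U>" and b: "\<And>x. x \<in> {0..1} \<Longrightarrow> \<bar>\<phi> x\<bar> \<le> b" and \<epsilon>: "0 < \<epsilon>"
  shows "expectation (fluct \<phi> \<epsilon>) = 0"
proof -
  interpret UM: pair_sigma_finite \<U> M ..
  have F [measurable]: "(\<lambda>(x, \<omega>). \<phi> x * \<xi> (x / \<epsilon>) \<omega>) \<in> borel_measurable (\<U> \<Otimes>\<^sub>M M)"
    using \<phi> b \<epsilon> by (rule weighted_\<xi>_measurable)
  have hb: "has_bochner_integral M (\<lambda>\<omega>. \<phi> x * \<xi> (x / \<epsilon>) \<omega>) 0" for x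
    using has_bochner_integral_mult_right[OF \<xi>_mean[of "x / \<epsilon>"], of "\<phi> x"] by simp
  have i1: "integrable M (\<lambda>\<omega>. \<phi> x * \<xi> (x / \<epsilon>) \<omega>)" for x
    using hb by (rule integrable.intros)
  have i: "integrable (\<U> \<Otimes>\<^sub>M M) (\<lambda>(x, \<omega>). \<phi> x * \<xi> (x / \<epsilon>) \<omega>)"
  proof (rule UM.Fubini_integrable[OF F])
    have le: "expectation (\<lambda>\<omega>. \<bar>\<phi> x * \<xi> (x / \<epsilon>) \<omega>\<bar>) \<le> 1 + b\<^sup>2 * \<bar>e 0\<bar>" if x: "x \<in> {0..1}" for x
    proof -
      note sq = weighted_\<xi>_square[OF \<phi> b \<epsilon> x]
      have t: "\<bar>t\<bar> \<le> 1 + t\<^sup>2" for t :: real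
        using zero_le_power2[of "\<bar>t\<bar> - 1"] by (simp add: power2_diff)
      have "expectation (\<lambda>\<omega>. \<bar>\<phi> x * \<xi> (x / \<epsilon>) \<omega>\<bar>) \<le> expectation (\<lambda>\<omega>. 1 + (\<phi> x * \<xi> (x / \<epsilon>) \<omega>)\<^sup>2)"
        by (intro integral_mono integrable_abs i1 Bochner_Integration.integrable_add sq t) auto
      also have "\<dots> = 1 + expectation (\<lambda>\<omega>. (\<phi> x * \<xi> (x / \<epsilon>) \<omega>)\<^sup>2)"
        using sq by (subst Bochner_Integration.integral_add) (auto simp: prob_space)
      finally show ?thesis using sq(2) by linarith
    qed
    show "integrable \<U> (\<lambda>x. LINT \<omega>|M. norm (case (x, \<omega>) of (x, \<omega>) \<Rightarrow> \<phi> x * \<xi> (x / \<epsilon>) \<omega>))"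
    proof (rule U.integrable_const_bound[where B = "1 + b\<^sup>2 * \<bar>e 0\<bar>"])
      show "AE x in \<U>. norm (LINT \<omega>|M. norm (case (x, \<omega>) of (x, \<omega>) \<Rightarrow> \<phi> x * \<xi> (x / \<epsilon>) \<omega>)) \<le> 1 + b\<^sup>2 * \<bar>e 0\<bar>"
        by (intro AE_I2) (use le in auto)
      show "(\<lambda>x. LINT \<omega>|M. norm (case (x, \<omega>) of (x, \<omega>) \<Rightarrow> \<phi> x * \<xi> (x / \<epsilon>) \<omega>)) \<in> borel_measurable \<U>"
        by (rule borel_measurable_lebesgue_integral) (use F in \<open>simp add: case_prod_beta'\<close>)
    qed
    show "AE x in \<U>. integrable M (\<lambda>\<omega>. case (x, \<omega>) of (x, \<omega>) \<Rightarrow> \<phi> x * \<xi> (x / \<epsilon>) \<omega>)"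
      using i1 by simp
  qed
  have "expectation (fluct \<phi> \<epsilon>) = (LINT x|\<U>. expectation (\<lambda>\<omega>. \<phi> x * \<xi> (x / \<epsilon>) \<omega>))"
    unfolding fluct_def by (rule UM.Fubini_integral[OF i])
  then show ?thesis unfolding has_bochner_integral_integral_eq[OF hb] by simp
qed

lemma integral_exp_fluct:
  assumes \<phi>: "continuous_on {0..1} \<phi>" and \<omega>: "\<omega> \<in> space M"
  shows "integrable \<U> (\<lambda>x. \<phi> x * exp (- H (x / \<epsilon>) \<omega>))"
    and "(LINT x|\<U>. \<phi> x * exp (- H (x / \<epsilon>) \<omega>)) = m * ((LINT x|\<U>. \<phi> x) + fluct \<phi> \<epsilon> \<omega>)"
proof -
  obtain b where b: "\<And>x. x \<in> {0..1} \<Longrightarrow> \<bar>\<phi> x\<bar> \<le> b" using continuous_unit_interval(3)[OF \<phi>] by blast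
  note i = continuous_unit_interval(2)[OF \<phi>] integrable_mult_\<xi>[OF continuous_unit_interval(1)[OF \<phi>] b \<omega>, where \<epsilon> = \<epsilon>]
  have eq: "\<phi> x * exp (- H (x / \<epsilon>) \<omega>) = m * (\<phi> x + \<phi> x * \<xi> (x / \<epsilon>) \<omega>)" for x
    using m_pos by (simp add: \<xi>_def field_simps)
  show "integrable \<U> (\<lambda>x. \<phi> x * exp (- H (x / \<epsilon>) \<omega>))"
    unfolding eq using i by simp
  show "(LINT x|\<U>. \<phi> x * exp (- H (x / \<epsilon>) \<omega>)) = m * ((LINT x|\<U>. \<phi> x) + fluct \<phi> \<epsilon> \<omega>)"
    unfolding eq fluct_def using i by simp
qed

text \<open>The observable in terms of the coefficient field alone, see \<open>dirichlet_solution_observable\<close>.\<close>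

definition obs :: "(real \<Rightarrow> real) \<Rightarrow> (real \<Rightarrow> real) \<Rightarrow> real \<Rightarrow> 'w \<Rightarrow> real" where
  "obs f g \<epsilon> \<omega> = (LINT x|\<U>. f x * g x * exp (- H (x / \<epsilon>) \<omega>))
    - (LINT x|\<U>. f x * exp (- H (x / \<epsilon>) \<omega>)) * (LINT x|\<U>. g x * exp (- H (x / \<epsilon>) \<omega>))
      / (LINT x|\<U>. exp (- H (x / \<epsilon>) \<omega>))"

lemma fluct_one_pos:
  assumes \<omega>: "\<omega> \<in> space M"
  shows "0 < 1 + fluct (\<lambda>_. 1) \<epsilon> \<omega>"
proof -
  have c: "continuous_on {0..1} (\<lambda>_. 1 :: real)" by simp
  note i = integral_exp_fluct[OF c \<omega>, of \<epsilon>]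
  have "0 \<le> (LINT x|\<U>. 1 * exp (- H (x / \<epsilon>) \<omega>))" by (rule Bochner_Integration.integral_nonneg) simp
  moreover have "(LINT x|\<U>. 1 * exp (- H (x / \<epsilon>) \<omega>)) \<noteq> 0"
  proof
    assume "(LINT x|\<U>. 1 * exp (- H (x / \<epsilon>) \<omega>)) = 0"
    then have "AE x in \<U>. 1 * exp (- H (x / \<epsilon>) \<omega>) = 0"
      by (subst (asm) integral_nonneg_eq_0_iff_AE[OF i(1)]) auto
    then show False by simp
  qed
  ultimately have "0 < m * ((LINT x|\<U>. 1) + fluct (\<lambda>_. 1) \<epsilon> \<omega>)"
    unfolding i(2) by linarith
  then show ?thesis using m_pos by (simp add: zero_less_mult_iff U.prob_space[simplified])
qed

lemma fluct_le_fluct_one: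
  assumes \<omega>: "\<omega> \<in> space M" and \<phi>: "continuous_on {0..1} \<phi>" "(LINT x|\<U>. \<phi> x) = 0"
    and b: "\<And>x. x \<in> {0..1} \<Longrightarrow> \<bar>\<phi> x\<bar> \<le> b"
  shows "\<bar>fluct \<phi> \<epsilon> \<omega>\<bar> \<le> b * (1 + fluct (\<lambda>_. 1) \<epsilon> \<omega>)"
proof -
  have c: "continuous_on {0..1} (\<lambda>_. 1 :: real)" by simp
  note i = integral_exp_fluct[OF c \<omega>, of \<epsilon>] and j = integral_exp_fluct[OF \<phi>(1) \<omega>, of \<epsilon>]
  have "\<bar>LINT x|\<U>. \<phi> x * exp (- H (x / \<epsilon>) \<omega>)\<bar> \<le> (LINT x|\<U>. \<bar>\<phi> x * exp (- H (x / \<epsilon>) \<omega>)\<bar>)"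
    by (rule integral_abs_bound)
  also have "\<dots> \<le> (LINT x|\<U>. b * (1 * exp (- H (x / \<epsilon>) \<omega>)))"
    using b by (intro integral_mono integrable_abs j(1) integrable_mult_right i(1))
      (auto simp: abs_mult intro!: mult_right_mono)
  also have "\<dots> = b * (m * (1 + fluct (\<lambda>_. 1) \<epsilon> \<omega>))"
    using i(2) by (simp add: U.prob_space[simplified])
  finally have "m * \<bar>fluct \<phi> \<epsilon> \<omega>\<bar> \<le> m * (b * (1 + fluct (\<lambda>_. 1) \<epsilon> \<omega>))"
    unfolding j(2) \<phi>(2) using m_pos by (simp add: abs_mult mult_ac)
  then show ?thesis using m_pos by simp
qed

text \<open>Decomposition into a constant, the leading fluctuation and a remainder that is quadratic in
  fluctuations. The centering of the weights removes the deterministic part of the factors of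
  the remainder.\<close>

lemma obs_eq_fluct:
  assumes \<omega>: "\<omega> \<in> space M" and f: "continuous_on {0..1} f" and g: "continuous_on {0..1} g"
  defines "fh \<equiv> \<lambda>x. f x - (LINT y|\<U>. f y)" and "gh \<equiv> \<lambda>x. g x - (LINT y|\<U>. g y)"
  shows "obs f g \<epsilon> \<omega> = m * (LINT x|\<U>. fh x * gh x) + m * fluct (\<lambda>x. fh x * gh x) \<epsilon> \<omega>
    - m * (fluct fh \<epsilon> \<omega> * fluct gh \<epsilon> \<omega> / (1 + fluct (\<lambda>_. 1) \<epsilon> \<omega>))"
proof -
  have c: "continuous_on {0..1} (\<lambda>_. 1 :: real)" by simp
  have cfg: "continuous_on {0..1} (\<lambda>x. f x * g x)" "continuous_on {0..1} fh" "continuous_on {0..1} gh"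
    "continuous_on {0..1} (\<lambda>x. fh x * gh x)"
    unfolding fh_def gh_def by (intro continuous_intros f g)+
  note i = integral_exp_fluct[OF _ \<omega>, of _ \<epsilon>]
  have one: "(LINT x|\<U>. exp (- H (x / \<epsilon>) \<omega>)) = m * (1 + fluct (\<lambda>_. 1) \<epsilon> \<omega>)"
    using i(2)[OF c] by (simp add: U.prob_space[simplified])
  have fh0: "(LINT x|\<U>. fh x) = 0" "(LINT x|\<U>. gh x) = 0"
    unfolding fh_def gh_def using continuous_unit_interval(2)[OF f] continuous_unit_interval(2)[OF g]
    by (simp_all add: U.prob_space[simplified])
  have "obs f g \<epsilon> \<omega> = (LINT x|\<U>. fh x * gh x * exp (- H (x / \<epsilon>) \<omega>))
    - (LINT x|\<U>. fh x * exp (- H (x / \<epsilon>) \<omega>)) * (LINT x|\<U>. gh x * exp (- H (x / \<epsilon>) \<omega>))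
      / (LINT x|\<U>. exp (- H (x / \<epsilon>) \<omega>))"
    unfolding obs_def fh_def gh_def
  proof (rule covariance_form_centered)
    show "integrable \<U> (\<lambda>x. exp (- H (x / \<epsilon>) \<omega>))" using i(1)[OF c] by simp
    show "(LINT x|\<U>. exp (- H (x / \<epsilon>) \<omega>)) \<noteq> 0"
      unfolding one using fluct_one_pos[OF \<omega>, of \<epsilon>] m_pos by simp
  qed (intro i(1) f g cfg)+
  also have "\<dots> = m * ((LINT x|\<U>. fh x * gh x) + fluct (\<lambda>x. fh x * gh x) \<epsilon> \<omega>)
      - (m * fluct fh \<epsilon> \<omega>) * (m * fluct gh \<epsilon> \<omega>) / (m * (1 + fluct (\<lambda>_. 1) \<epsilon> \<omega>))"
    unfolding one i(2)[OF cfg(4)] i(2)[OF cfg(3)] i(2)[OF cfg(2)] fh0 by simp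
  also have "\<dots> = m * (LINT x|\<U>. fh x * gh x) + m * fluct (\<lambda>x. fh x * gh x) \<epsilon> \<omega>
    - m * (fluct fh \<epsilon> \<omega> * fluct gh \<epsilon> \<omega> / (1 + fluct (\<lambda>_. 1) \<epsilon> \<omega>))"
  proof -
    have "(m * x) * (m * y) / (m * w) = m * (x * y / w)" for x y w using m_pos by (simp add: mult_ac)
    then show ?thesis by (simp only:) (simp only: distrib_left)
  qed
  finally show ?thesis .
qed

text \<open>Only continuity and the Lipschitz bounds of the data enter, through the weight
  \<open>(f - mean f) * (g - mean g)\<close>. The leading fluctuation has the covariance asymptotics as its variance,
  with error of order \<open>\<epsilon> powr (\<beta> - 1)\<close>, and the quadratic remainder causes the error of order
  \<open>sqrt \<epsilon>\<close>.\<close>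

lemma obs_variance:
  assumes f: "continuous_on {0..1} f" and g: "continuous_on {0..1} g"
    and fL: "0 \<le> Lf" "\<And>x y. x \<in> {0..1} \<Longrightarrow> y \<in> {0..1} \<Longrightarrow> \<bar>f x - f y\<bar> \<le> Lf * \<bar>x - y\<bar>"
    and gL: "0 \<le> Lg" "\<And>x y. x \<in> {0..1} \<Longrightarrow> y \<in> {0..1} \<Longrightarrow> \<bar>g x - g y\<bar> \<le> Lg * \<bar>x - y\<bar>"
  shows "\<exists>c. \<forall>\<epsilon>\<in>{0<..1/2}. obs f g \<epsilon> \<in> borel_measurable M \<and>
    \<bar>variance (obs f g \<epsilon>) / \<epsilon> - m\<^sup>2 * (LINT t|lborel. e t) *
      (LINT x|\<U>. (f x - (LINT y|\<U>. f y))\<^sup>2 * (g x - (LINT y|\<U>. g y))\<^sup>2)\<bar>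
    \<le> c * \<epsilon> powr min (1/2) (\<beta> - 1)"
proof -
  define fh where "fh = (\<lambda>x. f x - (LINT y|\<U>. f y))"
  define gh where "gh = (\<lambda>x. g x - (LINT y|\<U>. g y))"
  define h where "h = (\<lambda>x. fh x * gh x)"
  have cf: "continuous_on {0..1} fh" and cg: "continuous_on {0..1} gh" and ch: "continuous_on {0..1} h"
    and c1: "continuous_on {0..1} (\<lambda>_. 1 :: real)"
    unfolding fh_def gh_def h_def by (intro continuous_intros f g)+
  note mf = continuous_unit_interval(1)[OF cf] and mg = continuous_unit_interval(1)[OF cg]
    and mh = continuous_unit_interval(1)[OF ch] and m1 = continuous_unit_interval(1)[OF c1]
  obtain bf where bf: "\<And>x. x \<in> {0..1} \<Longrightarrow> \<bar>fh x\<bar> \<le> bf" using continuous_unit_interval(3)[OF cf] by blast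
  obtain bg where bg: "\<And>x. x \<in> {0..1} \<Longrightarrow> \<bar>gh x\<bar> \<le> bg" using continuous_unit_interval(3)[OF cg] by blast
  have bf0: "0 \<le> bf" and bg0: "0 \<le> bg" using bf[of 0] bg[of 0] by auto
  have fh0: "(LINT x|\<U>. fh x) = 0" "(LINT x|\<U>. gh x) = 0"
    unfolding fh_def gh_def using continuous_unit_interval(2)[OF f] continuous_unit_interval(2)[OF g]
    by (simp_all add: U.prob_space[simplified])
  have b1: "\<bar>1 :: real\<bar> \<le> 1" by simp
  have bh: "\<bar>h x\<bar> \<le> bf * bg" if "x \<in> {0..1}" for x
    unfolding h_def abs_mult using bf[OF that] bg[OF that] by (intro mult_mono bf0) auto
  have hL: "\<bar>h x - h y\<bar> \<le> (bf * Lg + bg * Lf) * \<bar>x - y\<bar>" if xy: "x \<in> {0..1}" "y \<in> {0..1}" for x y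
  proof -
    have "h x - h y = fh x * (g x - g y) + gh y * (f x - f y)"
      by (simp add: h_def fh_def gh_def algebra_simps)
    then have "\<bar>h x - h y\<bar> \<le> \<bar>fh x\<bar> * \<bar>g x - g y\<bar> + \<bar>gh y\<bar> * \<bar>f x - f y\<bar>"
      by (metis abs_mult abs_triangle_ineq)
    also have "\<dots> \<le> bf * (Lg * \<bar>x - y\<bar>) + bg * (Lf * \<bar>x - y\<bar>)"
      by (intro add_mono mult_mono bf bg fL gL xy bf0 bg0) auto
    finally show ?thesis by (simp add: algebra_simps)
  qed
  define Q where "Q = (LINT t|lborel. e t) * (LINT x|\<U>. (h x)\<^sup>2)"
  define cQ where "cQ = bf * bg * ((bf * Lg + bg * Lf) + 2 * (bf * bg)) * D * (LINT s|lborel. \<bar>s\<bar> powr (- \<beta>) * min 1 \<bar>s\<bar>)"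
  define c4 where "c4 = 140 * D ^ 6 * (LINT t|lborel. decay_kernel \<beta> t)\<^sup>2"
  define cV where "cV = m\<^sup>2 * (2 * (c4 * bf ^ 4) + 2 * (c4 * bg ^ 4) + 4 * (bf * bg)\<^sup>2 * (c4 * 1 ^ 4))"
  define cA where "cA = m\<^sup>2 * (\<bar>Q\<bar> + cQ)"
  define c where "c = m\<^sup>2 * cQ + (cA + 2 * cV)"
  have cQ0: "0 \<le> cQ" unfolding cQ_def using bf0 bg0 fL(1) gL(1) D_ge_1
    by (intro mult_nonneg_nonneg add_nonneg_nonneg Bochner_Integration.integral_nonneg) auto
  have c40: "0 \<le> c4" using D_ge_1 by (simp add: c4_def)
  have cV0: "0 \<le> cV" unfolding cV_def using c40 bf0 bg0 by (intro mult_nonneg_nonneg add_nonneg_nonneg) auto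
  have cA0: "0 \<le> cA" using cQ0 by (simp add: cA_def)
  have "obs f g \<epsilon> \<in> borel_measurable M \<and>
    \<bar>variance (obs f g \<epsilon>) / \<epsilon> - m\<^sup>2 * Q\<bar> \<le> c * \<epsilon> powr min (1/2) (\<beta> - 1)" if \<epsilon>12: "\<epsilon> \<in> {0<..1/2}" for \<epsilon>
  proof -
    have \<epsilon>: "0 < \<epsilon>" "\<epsilon> \<le> 1" using \<epsilon>12 by auto
    define A where "A = (\<lambda>\<omega>. m * fluct h \<epsilon> \<omega>)"
    define V where "V = (\<lambda>\<omega>. m * (fluct fh \<epsilon> \<omega> * fluct gh \<epsilon> \<omega> / (1 + fluct (\<lambda>_. 1) \<epsilon> \<omega>)))"
    have [measurable]: "fluct fh \<epsilon> \<in> borel_measurable M" "fluct gh \<epsilon> \<in> borel_measurable M"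
      "fluct h \<epsilon> \<in> borel_measurable M" "fluct (\<lambda>_. 1) \<epsilon> \<in> borel_measurable M"
      using fluct_measurable[OF mf bf \<epsilon>(1)] fluct_measurable[OF mg bg \<epsilon>(1)]
        fluct_measurable[OF mh bh \<epsilon>(1)] fluct_measurable[OF m1 b1 \<epsilon>(1)] by auto
    have Am [measurable]: "A \<in> borel_measurable M" and Vm [measurable]: "V \<in> borel_measurable M"
      unfolding A_def V_def by measurable
    have obs: "obs f g \<epsilon> \<omega> = m * (LINT x|\<U>. h x) + A \<omega> - V \<omega>" if "\<omega> \<in> space M" for \<omega>
      using obs_eq_fluct[OF that f g, of \<epsilon>] by (simp add: A_def V_def h_def fh_def gh_def)
    have obsm: "obs f g \<epsilon> \<in> borel_measurable M"
      by (subst measurable_cong[OF obs]) measurable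
    have var: "variance (obs f g \<epsilon>) = variance (\<lambda>\<omega>. m * (LINT x|\<U>. h x) + A \<omega> - V \<omega>)"
      using obs by (intro Bochner_Integration.integral_cong refl) (simp cong: Bochner_Integration.integral_cong)
    have s2: "integrable M (\<lambda>\<omega>. (fluct h \<epsilon> \<omega>)\<^sup>2)"
      "expectation (\<lambda>\<omega>. (fluct h \<epsilon> \<omega>)\<^sup>2) =
        (LINT p|(\<U> \<Otimes>\<^sub>M \<U>). h (fst p) * h (snd p) * e ((fst p - snd p) / \<epsilon>))"
      "integrable (\<U> \<Otimes>\<^sub>M \<U>) (\<lambda>p. h (fst p) * h (snd p) * e ((fst p - snd p) / \<epsilon>))"
      by (rule fluct_second_moment[OF mh bh \<epsilon>(1)]; assumption)+
    have A2: "integrable M (\<lambda>\<omega>. (A \<omega>)\<^sup>2)"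
      using s2(1) by (simp add: A_def power_mult_distrib)
    have EA2: "expectation (\<lambda>\<omega>. (A \<omega>)\<^sup>2) = m\<^sup>2 * expectation (\<lambda>\<omega>. (fluct h \<epsilon> \<omega>)\<^sup>2)"
      by (simp add: A_def power_mult_distrib)
    have "\<bar>expectation (\<lambda>\<omega>. (fluct h \<epsilon> \<omega>)\<^sup>2) / \<epsilon> - Q\<bar> \<le> cQ * \<epsilon> powr (\<beta> - 1)"
      unfolding s2(2) Q_def cQ_def
      by (rule covariance_integral_asymptotics[OF \<beta> \<epsilon>(1) e_measurable e_decay mh bh hL s2(3)])
    then have "m\<^sup>2 * \<bar>expectation (\<lambda>\<omega>. (fluct h \<epsilon> \<omega>)\<^sup>2) / \<epsilon> - Q\<bar> \<le> m\<^sup>2 * (cQ * \<epsilon> powr (\<beta> - 1))"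
      by (intro mult_left_mono) auto
    moreover have "expectation (\<lambda>\<omega>. (A \<omega>)\<^sup>2) / \<epsilon> - m\<^sup>2 * Q = m\<^sup>2 * (expectation (\<lambda>\<omega>. (fluct h \<epsilon> \<omega>)\<^sup>2) / \<epsilon> - Q)"
      unfolding EA2 by (simp add: right_diff_distrib)
    ultimately have lim: "\<bar>expectation (\<lambda>\<omega>. (A \<omega>)\<^sup>2) / \<epsilon> - m\<^sup>2 * Q\<bar> \<le> m\<^sup>2 * cQ * \<epsilon> powr (\<beta> - 1)"
      by (simp add: abs_mult mult.assoc)
    have EA: "expectation (\<lambda>\<omega>. (A \<omega>)\<^sup>2) \<le> cA * \<epsilon>"
    proof -
      have "\<epsilon> powr (\<beta> - 1) \<le> 1" using \<epsilon> \<beta> by (intro powr_le1) auto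
      then have "m\<^sup>2 * cQ * \<epsilon> powr (\<beta> - 1) \<le> m\<^sup>2 * cQ" using cQ0 by (intro mult_left_le) auto
      moreover have "m\<^sup>2 * Q \<le> m\<^sup>2 * \<bar>Q\<bar>" by (intro mult_left_mono) auto
      ultimately have "expectation (\<lambda>\<omega>. (A \<omega>)\<^sup>2) / \<epsilon> \<le> cA"
        unfolding cA_def distrib_left using lim by linarith
      then show ?thesis using \<epsilon> by (simp add: divide_le_eq)
    qed
    have A0: "expectation A = 0"
      unfolding A_def using fluct_mean[OF mh bh \<epsilon>(1)] by simp
    note f4 = fluct_fourth_moment[OF mf bf \<epsilon>(1), folded c4_def] and g4 = fluct_fourth_moment[OF mg bg \<epsilon>(1), folded c4_def]
      and o4 = fluct_fourth_moment[OF m1 b1 \<epsilon>(1), folded c4_def]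
    let ?V = "\<lambda>\<omega>. m\<^sup>2 * (2 * fluct fh \<epsilon> \<omega> ^ 4 + 2 * fluct gh \<epsilon> \<omega> ^ 4 + 4 * (bf * bg)\<^sup>2 * fluct (\<lambda>_. 1) \<epsilon> \<omega> ^ 4)"
    have Vle: "(V \<omega>)\<^sup>2 \<le> ?V \<omega>" if \<omega>: "\<omega> \<in> space M" for \<omega>
      unfolding V_def power_mult_distrib[of m]
      by (intro mult_left_mono squared_ratio_bound fluct_le_fluct_one[OF \<omega> cf fh0(1) bf]
          fluct_le_fluct_one[OF \<omega> cg fh0(2) bg] less_imp_le[OF fluct_one_pos[OF \<omega>]] bf0 bg0) auto
    have iV: "integrable M ?V"
      by (intro integrable_mult_right Bochner_Integration.integrable_add f4(1) g4(1) o4(1))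
    have V2: "integrable M (\<lambda>\<omega>. (V \<omega>)\<^sup>2)"
      by (rule Bochner_Integration.integrable_bound[OF iV])
         (use Vle in \<open>auto intro!: AE_I2\<close>)
    have EV: "expectation (\<lambda>\<omega>. (V \<omega>)\<^sup>2) \<le> cV * \<epsilon>\<^sup>2"
    proof -
      have "expectation (\<lambda>\<omega>. (V \<omega>)\<^sup>2) \<le> expectation ?V"
        by (intro integral_mono V2 iV Vle)
      also have "\<dots> = m\<^sup>2 * (2 * expectation (\<lambda>\<omega>. fluct fh \<epsilon> \<omega> ^ 4) + 2 * expectation (\<lambda>\<omega>. fluct gh \<epsilon> \<omega> ^ 4)
          + 4 * (bf * bg)\<^sup>2 * expectation (\<lambda>\<omega>. fluct (\<lambda>_. 1) \<epsilon> \<omega> ^ 4))"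
        using f4(1) g4(1) o4(1) by simp
      also have "\<dots> \<le> m\<^sup>2 * (2 * (c4 * bf ^ 4 * \<epsilon>\<^sup>2) + 2 * (c4 * bg ^ 4 * \<epsilon>\<^sup>2) + 4 * (bf * bg)\<^sup>2 * (c4 * 1 ^ 4 * \<epsilon>\<^sup>2))"
        by (intro mult_left_mono add_mono f4(2) g4(2) o4(2)) auto
      also have "\<dots> = cV * \<epsilon>\<^sup>2" by (simp add: cV_def algebra_simps)
      finally show ?thesis .
    qed
    \<comment> \<open>with \<open>E A\<^sup>2\<close> of order \<open>\<epsilon>\<close> and \<open>E V\<^sup>2\<close> of order \<open>\<epsilon>\<^sup>2\<close>, both parts of the cross term become \<open>\<epsilon> powr (3/2)\<close>\<close>
    define \<delta> where "\<delta> = sqrt \<epsilon>"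
    have \<delta>: "0 < \<delta>" "\<delta> \<le> 1" "\<epsilon> = \<delta> * \<delta>" using \<epsilon> by (auto simp: \<delta>_def)
    have "\<bar>variance (obs f g \<epsilon>) - expectation (\<lambda>\<omega>. (A \<omega>)\<^sup>2)\<bar>
        \<le> \<delta> * expectation (\<lambda>\<omega>. (A \<omega>)\<^sup>2) + (1 / \<delta> + 1) * expectation (\<lambda>\<omega>. (V \<omega>)\<^sup>2)"
      unfolding var by (rule variance_perturbation[OF Am Vm A2 V2 A0 \<delta>(1)])
    also have "\<dots> \<le> \<delta> * (cA * \<epsilon>) + (1 / \<delta> + 1) * (cV * \<epsilon>\<^sup>2)"
      using \<delta> by (intro add_mono mult_left_mono EA EV) auto
    also have "\<dots> = \<delta> * \<epsilon> * (cA + cV + \<delta> * cV)"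
      using \<delta>(1) by (simp add: \<delta>(3) field_simps power2_eq_square)
    also have "\<dots> \<le> \<delta> * \<epsilon> * (cA + 2 * cV)"
      using \<delta> \<epsilon> cV0 mult_right_mono[of \<delta> 1 cV] by (intro mult_left_mono) auto
    finally have "\<bar>variance (obs f g \<epsilon>) - expectation (\<lambda>\<omega>. (A \<omega>)\<^sup>2)\<bar> / \<epsilon> \<le> (cA + 2 * cV) * \<delta>"
      using \<epsilon> by (simp add: divide_le_eq mult_ac)
    then have pert: "\<bar>variance (obs f g \<epsilon>) / \<epsilon> - expectation (\<lambda>\<omega>. (A \<omega>)\<^sup>2) / \<epsilon>\<bar> \<le> (cA + 2 * cV) * \<delta>"
      using \<epsilon> by (simp add: abs_divide flip: diff_divide_distrib)
    have p1: "\<epsilon> powr (\<beta> - 1) \<le> \<epsilon> powr min (1/2) (\<beta> - 1)"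
      and "\<epsilon> powr (1/2) \<le> \<epsilon> powr min (1/2) (\<beta> - 1)"
      using \<epsilon> powr_mono'[OF min.cobounded2[of "1/2" "\<beta> - 1"], of \<epsilon>]
        powr_mono'[OF min.cobounded1[of "1/2" "\<beta> - 1"], of \<epsilon>] by simp_all
    then have p2: "\<delta> \<le> \<epsilon> powr min (1/2) (\<beta> - 1)"
      using \<epsilon> by (simp add: \<delta>_def powr_half_sqrt)
    have "\<bar>variance (obs f g \<epsilon>) / \<epsilon> - m\<^sup>2 * Q\<bar> \<le> (cA + 2 * cV) * \<delta> + m\<^sup>2 * cQ * \<epsilon> powr (\<beta> - 1)"
      using pert lim by linarith
    also have "\<dots> \<le> (cA + 2 * cV) * \<epsilon> powr min (1/2) (\<beta> - 1) + m\<^sup>2 * cQ * \<epsilon> powr min (1/2) (\<beta> - 1)"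
      using cA0 cV0 cQ0 by (intro add_mono mult_left_mono p1 p2) auto
    also have "\<dots> = c * \<epsilon> powr min (1/2) (\<beta> - 1)" by (simp add: c_def algebra_simps)
    finally show ?thesis using obsm by blast
  qed
  then show ?thesis
    unfolding Q_def h_def fh_def gh_def power_mult_distrib mult.assoc[symmetric] by blast
qed

end

section \<open>Positivity of the limiting variance\<close>

lemma integral_self_convolution:
  assumes [measurable]: "h \<in> borel_measurable borel" and h: "integrable lborel h"
  shows "integrable lborel (convolution h h)" and "(LINT x|lborel. convolution h h x) = (LINT y|lborel. h y)\<^sup>2"
proof -
  have sh: "integrable lborel (\<lambda>x. k (x - y))" "(LINT x|lborel. k (x - y)) = (LINT x|lborel. k x)"
    if "integrable lborel k" for y and k :: "real \<Rightarrow> real"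
    using lborel_integrable_real_affine[OF that, of 1 "- y"] lborel_integral_real_affine[of 1 k "- y"]
    by (simp_all add: add.commute[of "- y"])
  have i: "integrable (lborel \<Otimes>\<^sub>M lborel) (\<lambda>(y, x). h y * h (x - y))"
  proof (rule lborel_pair.Fubini_integrable)
    have "(\<lambda>y. LINT x|lborel. norm (case (y, x) of (y, x) \<Rightarrow> h y * h (x - y))) =
        (\<lambda>y. \<bar>h y\<bar> * (LINT x|lborel. \<bar>h x\<bar>))"
      using sh(2)[OF integrable_abs[OF h]] by (simp add: abs_mult)
    then show "integrable lborel (\<lambda>y. LINT x|lborel. norm (case (y, x) of (y, x) \<Rightarrow> h y * h (x - y)))"
      using h by simp
    show "AE y in lborel. integrable lborel (\<lambda>x. case (y, x) of (y, x) \<Rightarrow> h y * h (x - y))"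
      using sh(1)[OF h] by simp
  qed measurable
  show "integrable lborel (convolution h h)"
    using lborel_pair.integrable_snd[OF i] by (simp add: convolution_def[abs_def])
  have "(LINT x|lborel. convolution h h x) = (LINT y|lborel. LINT x|lborel. h y * h (x - y))"
    unfolding convolution_def by (rule lborel_pair.Fubini_integral[OF i])
  also have "\<dots> = (LINT y|lborel. h y)\<^sup>2"
    using sh(2)[OF h] by (simp add: power2_eq_square)
  finally show "(LINT x|lborel. convolution h h x) = (LINT y|lborel. h y)\<^sup>2" .
qed

lemma hoelder_at_zero_positive:
  assumes "hoelder_at_zero C" "0 < C 0"
  obtains \<delta> where "0 < \<delta>" "\<And>x. \<bar>x\<bar> < \<delta> \<Longrightarrow> 0 < C x"
proof -
  obtain \<gamma> L \<delta> where h: "0 < \<gamma>" "0 < \<delta>" "\<And>x. \<bar>x\<bar> < \<delta> \<Longrightarrow> \<bar>C x - C 0\<bar> \<le> L * \<bar>x\<bar> powr \<gamma>"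
    using assms(1) unfolding hoelder_at_zero_def by blast
  define y where "y = C 0 / (\<bar>L\<bar> + 1)"
  have y: "0 < y" "(\<bar>L\<bar> + 1) * y = C 0" using assms(2) by (auto simp: y_def add_nonneg_pos)
  show ?thesis
  proof (rule that[of "min \<delta> (y powr (1 / \<gamma>))"])
    show "0 < min \<delta> (y powr (1 / \<gamma>))" using h y by simp
    fix x assume x: "\<bar>x\<bar> < min \<delta> (y powr (1 / \<gamma>))"
    have "\<bar>x\<bar> powr \<gamma> < (y powr (1 / \<gamma>)) powr \<gamma>" using x h(1) by (intro powr_less_mono2) auto
    then have p: "\<bar>x\<bar> powr \<gamma> < y" using h(1) y(1) by (simp add: powr_powr)
    have "\<bar>C x - C 0\<bar> \<le> L * \<bar>x\<bar> powr \<gamma>" using h(3) x by simp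
    also have "\<dots> \<le> (\<bar>L\<bar> + 1) * \<bar>x\<bar> powr \<gamma>" by (intro mult_right_mono) auto
    also have "\<dots> < (\<bar>L\<bar> + 1) * y" using p by (intro mult_strict_left_mono) auto
    finally show "0 < C x" using y(2) by linarith
  qed
qed

text \<open>Since \<open>exp c - 1 - c\<close> is nonnegative, it is enough that it be positive on a set of positive
  measure, and near the origin the covariance is positive because of its Hoelder bound there.\<close>

lemma integral_exp_covariance_positive:
  assumes C_int: "integrable lborel C" and e_int: "integrable lborel (\<lambda>t. exp (C t) - 1 :: real)"
    and nonneg: "0 \<le> (LINT t|lborel. C t)"
    and pos: "0 < C 0" "hoelder_at_zero C"
  shows "0 < (LINT t|lborel. exp (C t) - 1)"
proof -
  have i: "integrable lborel (\<lambda>t. (exp (C t) - 1) - C t)" using C_int e_int by simp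
  have ge: "0 \<le> (exp c - 1) - c" for c :: real using exp_ge_add_one_self[of c] by linarith
  have gt: "0 < (exp c - 1) - c" if "0 < c" for c :: real
  proof -
    have "(1 + c / 2)\<^sup>2 \<le> (exp (c / 2))\<^sup>2"
      using exp_ge_add_one_self[of "c / 2"] that by (intro power_mono) auto
    also have "\<dots> = exp c" by (simp add: power2_eq_square flip: exp_add)
    finally have "1 + c + c\<^sup>2 / 4 \<le> exp c" by (simp add: power2_eq_square field_simps)
    then show ?thesis using that by (smt (verit) zero_less_power divide_pos_pos)
  qed
  obtain \<delta> where \<delta>: "0 < \<delta>" "\<And>x. \<bar>x\<bar> < \<delta> \<Longrightarrow> 0 < C x"
    by (rule hoelder_at_zero_positive[OF pos(2,1)]) blast
  have "(LINT t|lborel. (exp (C t) - 1) - C t) \<noteq> 0"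
  proof
    assume "(LINT t|lborel. (exp (C t) - 1) - C t) = 0"
    then have "AE t in lborel. (exp (C t) - 1) - C t = 0"
      using integral_nonneg_eq_0_iff_AE[OF i] ge by auto
    then have "AE t in lborel. t \<notin> {-\<delta><..<\<delta>}"
    proof eventually_elim
      fix t assume "(exp (C t) - 1) - C t = 0"
      then show "t \<notin> {-\<delta><..<\<delta>}" using gt[of "C t"] \<delta>(2)[of t] by auto
    qed
    then have "{-\<delta><..<\<delta>} \<in> null_sets lborel" by (subst AE_iff_null_sets) auto
    then show False using \<delta>(1) by (simp add: null_sets_def)
  qed
  moreover have "0 \<le> (LINT t|lborel. (exp (C t) - 1) - C t)"
    by (rule Bochner_Integration.integral_nonneg) (rule ge)
  ultimately have "0 < (LINT t|lborel. (exp (C t) - 1) - C t)" by linarith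
  also have "\<dots> = (LINT t|lborel. exp (C t) - 1) - (LINT t|lborel. C t)"
    by (rule Bochner_Integration.integral_diff[OF e_int C_int])
  finally show ?thesis using nonneg by linarith
qed

text \<open>A stationary field of variance zero vanishes almost surely at each rational point, hence
  identically by continuity of its paths.\<close>

lemma stationary_field_variance_positive:
  assumes "prob_space M" and field: "stationary_centered_gaussian_field M G C"
    and nz: "\<not> (AE \<omega> in M. \<forall>x. G x \<omega> = 0)"
  shows "0 < C 0"
proof (rule ccontr)
  interpret prob_space M by fact
  have gf: "gaussian_field M G" and mean: "\<And>x. expectation (G x) = 0"
    and cv: "\<And>x y. expectation (\<lambda>\<omega>. G x \<omega> * G y \<omega>) = C (x - y)"
    and cont: "AE \<omega> in M. continuous_on UNIV (\<lambda>x. G x \<omega>)"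
    using field unfolding stationary_centered_gaussian_field_def by blast+
  assume "\<not> 0 < C 0"
  have z: "AE \<omega> in M. G x \<omega> = 0" for x
  proof -
    have i: "integrable M (\<lambda>\<omega>. G x \<omega> * G x \<omega>)" by (rule gaussian_field_integrable_mult[OF gf mean])
    have "0 \<le> expectation (\<lambda>\<omega>. G x \<omega> * G x \<omega>)" by (rule Bochner_Integration.integral_nonneg) simp
    with \<open>\<not> 0 < C 0\<close> have "expectation (\<lambda>\<omega>. G x \<omega> * G x \<omega>) = 0" using cv[of x x] by simp
    then have "AE \<omega> in M. G x \<omega> * G x \<omega> = 0"
      by (subst (asm) integral_nonneg_eq_0_iff_AE[OF i]) auto
    then show ?thesis by simp
  qed
  have "AE \<omega> in M. \<forall>x\<in>\<rat>. G x \<omega> = 0"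
    using z by (subst AE_ball_countable) (auto intro: countable_rat)
  then have "AE \<omega> in M. \<forall>x. G x \<omega> = 0"
    using cont
  proof eventually_elim
    fix \<omega> assume q: "\<forall>x\<in>\<rat>. G x \<omega> = 0" and c: "continuous_on UNIV (\<lambda>x. G x \<omega>)"
    have "closed {x. G x \<omega> = 0}"
      by (intro closed_Collect_eq c continuous_on_const)
    moreover have "\<rat> \<subseteq> {x. G x \<omega> = 0}" using q by auto
    ultimately have "closure \<rat> \<subseteq> {x. G x \<omega> = 0}" by (intro closure_minimal)
    then show "\<forall>x. G x \<omega> = 0" by (auto simp: Rats_closure_real)
  qed
  with nz show False by blast
qed

section \<open>Convergence of the rescaled variance\<close>

lemma completion_borel_measurable_AE:
  fixes X Y :: "'a \<Rightarrow> real"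
  assumes Y: "Y \<in> borel_measurable M" and ae: "AE \<omega> in M. X \<omega> = Y \<omega>"
  shows "X \<in> borel_measurable (completion M)"
proof (rule measurableI)
  fix S :: "real set" assume S: "S \<in> sets borel"
  have Y': "Y -` S \<inter> space M \<in> sets M" using Y S by (rule measurable_sets)
  have ae': "AE \<omega> in completion M. \<omega> \<in> Y -` S \<inter> space M \<longleftrightarrow> \<omega> \<in> X -` S \<inter> space (completion M)"
    using AE_completion[OF ae] by eventually_elim simp
  show "X -` S \<inter> space (completion M) \<in> sets (completion M)"
    by (rule completion.in_sets_AE[OF ae' sets_completionI_sets[OF Y']]) simp
qed simp

lemma (in prob_space) variance_completion_AE:
  fixes X Y :: "'a \<Rightarrow> real"
  assumes Y [measurable]: "Y \<in> borel_measurable M" and ae: "AE \<omega> in M. X \<omega> = Y \<omega>"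
  shows "prob_space.variance (completion M) X = variance Y"
proof -
  have X [measurable]: "X \<in> borel_measurable (completion M)"
    by (rule completion_borel_measurable_AE[OF Y ae])
  have Y' [measurable]: "Y \<in> borel_measurable (completion M)"
    by (rule measurable_completion[OF Y])
  note ae' = AE_completion[OF ae]
  have 1: "integral\<^sup>L (completion M) X = expectation Y"
    by (subst integral_cong_AE[OF X Y' ae']) (rule integral_completion[OF Y])
  have "prob_space.variance (completion M) X = (LINT \<omega>|completion M. (Y \<omega> - expectation Y)\<^sup>2)"
    unfolding 1
  proof (rule integral_cong_AE)
    show "AE \<omega> in completion M. (X \<omega> - expectation Y)\<^sup>2 = (Y \<omega> - expectation Y)\<^sup>2"
      using ae' by eventually_elim simp
  qed measurable
  also have "\<dots> = variance Y" by (rule integral_completion) measurable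
  finally show ?thesis .
qed

theorem proposition5p2:
  fixes M :: "'w measure"
    and G :: "real \<Rightarrow> 'w \<Rightarrow> real"
    and C f g :: "real \<Rightarrow> real"
    and \<beta> K :: real
    and u v :: "real \<Rightarrow> 'w \<Rightarrow> real \<Rightarrow> real"
  assumes "prob_space M"
    and "stationary_centered_gaussian_field M G C"
    and "\<beta> > 1"
    and "covariance_decay \<beta> K C"
    and "\<not> (AE \<omega> in M. \<forall>x. G x \<omega> = 0)"
    and "C1_01 f" and "C1_01 g"
    and "\<And>\<epsilon>. \<epsilon> \<in> {0<..1/2} \<Longrightarrow>
           AE \<omega> in M. dirichlet_solution (\<lambda>x. coeff_field G (x / \<epsilon>) \<omega>) f (u \<epsilon> \<omega>)"
    and "\<And>\<epsilon>. \<epsilon> \<in> {0<..1/2} \<Longrightarrow>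
           AE \<omega> in M. dirichlet_solution (\<lambda>x. coeff_field G (x / \<epsilon>) \<omega>) g (v \<epsilon> \<omega>)"
  shows "(\<forall>\<epsilon>\<in>{0<..1/2}. AE \<omega> in M. observable (u \<epsilon>) g \<omega> = observable (v \<epsilon>) f \<omega>) \<and>
         Q_const M G > 0 \<and>
         (\<exists>B. \<forall>\<epsilon>\<in>{0<..1/2}.
            \<bar>(sigma_eps M \<epsilon> (u \<epsilon>) g)\<^sup>2 - sigma_squared M G f g\<bar>
              \<le> B * \<epsilon> powr min (1/2) (\<beta> - 1))"
proof -
  interpret prob_space M by fact
  have gf: "gaussian_field M G" and mean: "\<And>x. expectation (G x) = 0"
    and cv: "\<And>x y. expectation (\<lambda>\<omega>. G x \<omega> * G y \<omega>) = C (x - y)"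
    and cont: "AE \<omega> in M. continuous_on UNIV (\<lambda>x. G x \<omega>)"
    using assms(2) unfolding stationary_centered_gaussian_field_def by blast+
  have Gm [measurable]: "G x \<in> borel_measurable M" for x
    using gaussian_field_gaussian_rv[OF gf] by (simp add: gaussian_rv_def)
  obtain C0 where hoelder: "hoelder_at_zero C" and decay: "\<And>x. \<bar>C x\<bar> \<le> K * decay_kernel \<beta> x"
    and C0m [measurable]: "C0 \<in> borel_measurable borel" and conv: "C = convolution C0 C0"
    and C0b: "\<And>x y. y \<in> ball x 1 \<Longrightarrow> \<bar>C0 y\<bar> \<le> K * (1 + \<bar>x\<bar>) powr (- ((1 + \<beta>) / 2))"
    using assms(4) unfolding covariance_decay_def decay_kernel_def by blast
  have K0: "0 \<le> K" using decay[of 0] by (simp add: decay_kernel_def)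
  have C0d: "\<bar>C0 x\<bar> \<le> K * decay_kernel ((1 + \<beta>) / 2) x" for x
    using C0b[of x x] by (simp add: decay_kernel_def)
  have "integrable lborel (\<lambda>x. K * decay_kernel ((1 + \<beta>) / 2) x)"
    using assms(3) by (intro integrable_mult_right integrable_decay_kernel) simp
  then have C0i: "integrable lborel C0"
    by (rule Bochner_Integration.integrable_bound) (use C0d K0 in \<open>auto simp: abs_mult\<close>)
  have Ci: "integrable lborel C" and Cpos: "0 \<le> (LINT x|lborel. C x)"
    using integral_self_convolution[OF C0m C0i] by (simp_all add: conv)
  have C00: "0 < C 0" by (rule stationary_field_variance_positive[OF assms(1,2,5)])
  obtain H where Hc: "\<And>\<omega>. continuous_on UNIV (\<lambda>x. H x \<omega>)"
    and Hm [measurable]: "case_prod H \<in> borel_measurable (borel \<Otimes>\<^sub>M M)"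
    and HG: "AE \<omega> in M. \<forall>x. H x \<omega> = G x \<omega>"
    using continuous_modification[OF Gm cont] by blast
  have Hx [measurable]: "H x \<in> borel_measurable M" for x
    using measurable_Pair2[OF Hm, of x] by simp
  \<comment> \<open>the rate does not improve beyond exponent 3/2, so a faster decay may be weakened to it\<close>
  define \<beta>' where "\<beta>' = min \<beta> (3/2)"
  have \<beta>': "1 < \<beta>'" "\<beta>' < 2" "\<beta>' \<le> \<beta>" "min (1/2) (\<beta>' - 1) = min (1/2) (\<beta> - 1)"
    using assms(3) by (auto simp: \<beta>'_def min_def)
  interpret L: lognormal_field M H C \<beta>' K
  proof
    show "case_prod H \<in> borel_measurable (borel \<Otimes>\<^sub>M M)" by fact
    show "continuous_on UNIV (\<lambda>x. H x \<omega>)" for \<omega> by (rule Hc)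
    show "integrable M (\<lambda>\<omega>. \<Prod>i\<in>I. exp (- H (x i) \<omega>))"
      and "expectation (\<lambda>\<omega>. \<Prod>i\<in>I. exp (- H (x i) \<omega>)) = exp ((\<Sum>i\<in>I. \<Sum>j\<in>I. C (x i - x j)) / 2)"
      if I: "finite I" for I and x :: "nat \<Rightarrow> real"
    proof -
      have ae: "AE \<omega> in M. (\<Prod>i\<in>I. exp (- H (x i) \<omega>)) = (\<Prod>i\<in>I. exp (- G (x i) \<omega>))"
        using HG by eventually_elim simp
      note m = gaussian_field_exp_moment[OF gf mean cv I, of x]
      show "integrable M (\<lambda>\<omega>. \<Prod>i\<in>I. exp (- H (x i) \<omega>))"
        using m(1) by (subst integrable_cong_AE[OF _ _ ae]) measurable
      show "expectation (\<lambda>\<omega>. \<Prod>i\<in>I. exp (- H (x i) \<omega>)) = exp ((\<Sum>i\<in>I. \<Sum>j\<in>I. C (x i - x j)) / 2)"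
        using m(2) by (subst integral_cong_AE[OF _ _ ae]) measurable
    qed
    show "C (- t) = C t" for t using cv[of 0 t] cv[of t 0] by (simp add: mult.commute)
    show "C \<in> borel_measurable borel" using Ci by simp
    show "\<bar>C t\<bar> \<le> K * decay_kernel \<beta>' t" for t
    proof -
      have "decay_kernel \<beta> t \<le> decay_kernel \<beta>' t" unfolding decay_kernel_def using \<beta>' by (intro powr_mono) auto
      then show ?thesis using decay[of t] K0 by (meson mult_left_mono order_trans)
    qed
    show "1 < \<beta>'" "\<beta>' < 2" by (fact \<beta>')+
  qed
  have cov: "cov M (\<lambda>\<omega>. 1 / coeff_field G x \<omega>) (\<lambda>\<omega>. 1 / coeff_field G 0 \<omega>) = L.m\<^sup>2 * L.e x" for x
  proof -
    have inv: "1 / coeff_field G x \<omega> = exp (- G x \<omega>)" for x \<omega>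
      by (simp add: coeff_field_def exp_minus inverse_eq_divide)
    have H\<xi>: "exp (- H x \<omega>) = L.m * (1 + L.\<xi> x \<omega>)" for x \<omega>
      using L.m_pos by (simp add: L.\<xi>_def)
    have [measurable]: "L.\<xi> x \<in> borel_measurable M" for x
      using L.\<xi>_mean[of x] by (auto simp: has_bochner_integral_iff)
    have E: "expectation (\<lambda>\<omega>. exp (- G x \<omega>)) = L.m" for x
    proof -
      have "expectation (\<lambda>\<omega>. exp (- G x \<omega>)) = expectation (\<lambda>\<omega>. L.m * (1 + L.\<xi> x \<omega>))"
      proof (rule integral_cong_AE)
        show "AE \<omega> in M. exp (- G x \<omega>) = L.m * (1 + L.\<xi> x \<omega>)"
          using HG by eventually_elim (simp flip: H\<xi>)
      qed measurable
      also have "\<dots> = L.m"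
        using L.\<xi>_mean[of x] by (simp add: has_bochner_integral_iff prob_space)
      finally show ?thesis .
    qed
    have "cov M (\<lambda>\<omega>. 1 / coeff_field G x \<omega>) (\<lambda>\<omega>. 1 / coeff_field G 0 \<omega>) =
        expectation (\<lambda>\<omega>. (exp (- G x \<omega>) - L.m) * (exp (- G 0 \<omega>) - L.m))"
      unfolding cov_def inv E ..
    also have "\<dots> = expectation (\<lambda>\<omega>. L.m\<^sup>2 * (L.\<xi> x \<omega> * L.\<xi> 0 \<omega>))"
    proof (rule integral_cong_AE)
      show "AE \<omega> in M. (exp (- G x \<omega>) - L.m) * (exp (- G 0 \<omega>) - L.m) = L.m\<^sup>2 * (L.\<xi> x \<omega> * L.\<xi> 0 \<omega>)"
        using HG
      proof eventually_elim
        fix \<omega> assume "\<forall>x. H x \<omega> = G x \<omega>"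
        then have "exp (- G y \<omega>) = L.m * (1 + L.\<xi> y \<omega>)" for y by (simp flip: H\<xi>)
        then show "(exp (- G x \<omega>) - L.m) * (exp (- G 0 \<omega>) - L.m) = L.m\<^sup>2 * (L.\<xi> x \<omega> * L.\<xi> 0 \<omega>)"
          by (simp add: algebra_simps power2_eq_square)
      qed
    qed measurable
    also have "\<dots> = L.m\<^sup>2 * L.e x"
      using L.\<xi>_covariance[of x 0] by (simp add: has_bochner_integral_iff)
    finally show ?thesis .
  qed
  have Q: "Q_const M G = L.m\<^sup>2 * (LINT t|lborel. L.e t)"
    unfolding Q_const_def cov by simp
  have Qpos: "0 < Q_const M G"
    unfolding Q using integral_exp_covariance_positive[OF Ci _ Cpos C00 hoelder] L.integrable_e L.m_pos
    by (simp add: L.e_def[abs_def])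
  have fc: "continuous_on {0..1} f" and gc: "continuous_on {0..1} g"
    using assms(6,7) by (auto intro: C1_01_continuous)
  \<comment> \<open>almost surely the observable is the explicit functional of the coefficient field\<close>
  have obs: "AE \<omega> in M. observable w g \<omega> = L.obs f g \<epsilon> \<omega>"
    if sol: "AE \<omega> in M. dirichlet_solution (\<lambda>x. coeff_field G (x / \<epsilon>) \<omega>) f (w \<omega>)"
      and f: "C1_01 f" and g: "continuous_on {0..1} g" for w \<epsilon> f g
    using sol HG
  proof eventually_elim
    fix \<omega>
    assume s: "dirichlet_solution (\<lambda>x. coeff_field G (x / \<epsilon>) \<omega>) f (w \<omega>)" and h: "\<forall>x. H x \<omega> = G x \<omega>"
    have c: "continuous_on {0..1} (\<lambda>x. coeff_field G (x / \<epsilon>) \<omega>)"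
      unfolding coeff_field_def h[rule_format, symmetric]
      by (rule continuous_on_exp, rule continuous_on_compose2[OF Hc])
        (auto intro!: continuous_intros simp: divide_inverse)
    have i: "y / coeff_field G x \<omega> = y * exp (- H x \<omega>)" for x y
      by (simp add: coeff_field_def h exp_minus divide_inverse)
    show "observable w g \<omega> = L.obs f g \<epsilon> \<omega>"
      using dirichlet_solution_observable[OF s f c _ g]
      unfolding observable_def L.obs_def i integral_unit_interval_measure[symmetric]
      by (simp add: coeff_field_def)
  qed
  have "AE \<omega> in M. observable (u \<epsilon>) g \<omega> = observable (v \<epsilon>) f \<omega>" if \<epsilon>: "\<epsilon> \<in> {0<..1/2}" for \<epsilon>
    using obs[OF assms(8)[OF \<epsilon>] assms(6) gc] obs[OF assms(9)[OF \<epsilon>] assms(7) fc]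
    by eventually_elim (simp add: L.obs_def mult.commute)
  moreover obtain Lf where Lf: "0 \<le> Lf" "\<And>x y. x \<in> {0..1} \<Longrightarrow> y \<in> {0..1} \<Longrightarrow> \<bar>f x - f y\<bar> \<le> Lf * \<bar>x - y\<bar>"
    by (rule C1_01_lipschitz[OF assms(6)]) blast
  obtain Lg where Lg: "0 \<le> Lg" "\<And>x y. x \<in> {0..1} \<Longrightarrow> y \<in> {0..1} \<Longrightarrow> \<bar>g x - g y\<bar> \<le> Lg * \<bar>x - y\<bar>"
    by (rule C1_01_lipschitz[OF assms(7)]) blast
  obtain B where B: "\<And>\<epsilon>. \<epsilon> \<in> {0<..1/2} \<Longrightarrow> L.obs f g \<epsilon> \<in> borel_measurable M"
    "\<And>\<epsilon>. \<epsilon> \<in> {0<..1/2} \<Longrightarrow> \<bar>variance (L.obs f g \<epsilon>) / \<epsilon> - L.m\<^sup>2 * (LINT t|lborel. L.e t) *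
      (LINT x|\<U>. (f x - (LINT y|\<U>. f y))\<^sup>2 * (g x - (LINT y|\<U>. g y))\<^sup>2)\<bar>
      \<le> B * \<epsilon> powr min (1/2) (\<beta> - 1)"
    using L.obs_variance[OF fc gc Lf Lg] unfolding \<beta>'(4) by blast
  have "\<bar>(sigma_eps M \<epsilon> (u \<epsilon>) g)\<^sup>2 - sigma_squared M G f g\<bar> \<le> B * \<epsilon> powr min (1/2) (\<beta> - 1)"
    if \<epsilon>: "\<epsilon> \<in> {0<..1/2}" for \<epsilon>
  proof -
    have "0 \<le> variance (L.obs f g \<epsilon>) / \<epsilon>" using \<epsilon> by simp
    then have "(sigma_eps M \<epsilon> (u \<epsilon>) g)\<^sup>2 = variance (L.obs f g \<epsilon>) / \<epsilon>"
      unfolding sigma_eps_def variance_completion_AE[OF B(1)[OF \<epsilon>] obs[OF assms(8)[OF \<epsilon>] assms(6) gc]]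
      by (rule real_sqrt_pow2)
    then show ?thesis
      using B(2)[OF \<epsilon>] by (simp add: sigma_squared_def Q integral_unit_interval_measure)
  qed
  ultimately show ?thesis using Qpos by blast
qed

end
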